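(* Let $k\in\mathbb N$ and let $I$ be an ideal of $\mathcal R^k_{[1]}(\mathbb R^2)$. Then there exists $f\in I$ such that for every $g\in I$ there exist an integer $N\in\mathbb N$ and $h\in\mathcal R^k_{[1]}(\mathbb R^2)$ with $g^N=fh$. In particular, there exists $f\in I$ with $\sqrt{I}=\sqrt{(f)}$.
   Context: For $k\in\mathbb N\cup\{\infty\}$, $\mathcal R^k(\mathbb R^2)$ denotes the ring of functions $f:\mathbb R^2\to\mathbb R$ of class $C^k$ that coincide with $p/q$ ($p,q$ polynomials, $q$ nonvanishing there) on some nonempty Zariski open set. For $l\in\mathbb N$: consider compositions $\pi:M\to\mathbb R^2$ of successive blowings-up $M_i\to M_{i-1}$ ($M_0=\mathbb R^2$), each centred at points. An infinitely near point of order $j$ is a sequence $a_0\in M_0,\dots,a_j\in M_j$ where $M_i$ is the blowing-up of $M_{i-1}$ at $a_{i-1}$ and $a_i$ maps to $a_{i-1}$; the number of stages of $\pi$ is the maximal order of infinitely near points in $M$. $\mathcal R^k_{[l]}(\mathbb R^2)$ is the set of $f\in\mathcal R^k(\mathbb R^2)$ for which there is such a $\pi$ with at most $l$ stages such that $f\circ\pi$ is regular on $M$. *)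

theory Defs
  imports "HOL-Analysis.Analysis"
begin

type_synonym pt = "real \<times> real"

definition polyfun2 :: "(pt \<Rightarrow> real) \<Rightarrow> bool" where
  "polyfun2 p \<longleftrightarrow> (\<exists>n c. \<forall>x y. p (x, y) = (\<Sum>i\<le>n. \<Sum>j\<le>n. c i j * x ^ i * y ^ j))"

definition zariski_closed :: "pt set \<Rightarrow> bool" where
  "zariski_closed S \<longleftrightarrow>
     (\<exists>P. finite P \<and> (\<forall>p\<in>P. polyfun2 p) \<and> S = {z. \<forall>p\<in>P. p z = 0})"

definition zariski_open :: "pt set \<Rightarrow> bool" where
  "zariski_open U \<longleftrightarrow> zariski_closed (- U)"

fun Ck :: "nat \<Rightarrow> (pt \<Rightarrow> real) \<Rightarrow> bool" where
  "Ck 0 f = continuous_on UNIV f"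
| "Ck (Suc n) f = (\<exists>g1 g2. (\<forall>z. (f has_derivative (\<lambda>(h1, h2). g1 z * h1 + g2 z * h2)) (at z))
                          \<and> Ck n g1 \<and> Ck n g2)"

definition Rk :: "nat \<Rightarrow> (pt \<Rightarrow> real) set" where
  "Rk k = {f. Ck k f \<and> (\<exists>p q U. polyfun2 p \<and> polyfun2 q \<and> zariski_open U \<and> U \<noteq> {}
               \<and> (\<forall>z\<in>U. q z \<noteq> 0 \<and> f z = p z / q z))}"

definition regular_on :: "pt set \<Rightarrow> (pt \<Rightarrow> real) \<Rightarrow> bool" where
  "regular_on S F \<longleftrightarrow> (\<forall>x\<in>S. \<exists>p q. polyfun2 p \<and> polyfun2 q \<and> q x \<noteq> 0 \<and>
                         (\<forall>y\<in>S. q y \<noteq> 0 \<longrightarrow> F y = p y / q y))"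

text \<open>Regularity of f \<circ> \<pi> on the blowing-up M of R^2 at a finite set A of (distinct) points,
  expressed via the standard affine open cover of M:
  the part over R^2 - A, and for each a in A the two standard charts
  (u,v) |-> (a1+u, a2+uv) and (u,v) |-> (a1+uv, a2+v) (restricted to the complement
  of the preimages of the other blown-up points).\<close>
definition regular_after_blowup :: "pt set \<Rightarrow> (pt \<Rightarrow> real) \<Rightarrow> bool" where
  "regular_after_blowup A f \<longleftrightarrow>
     regular_on (- A) f \<and>
     (\<forall>a\<in>A.
        regular_on {(u, v). (fst a + u, snd a + u * v) \<notin> A - {a}}
                   (\<lambda>(u, v). f (fst a + u, snd a + u * v)) \<and>
        regular_on {(u, v). (fst a + u * v, snd a + v) \<notin> A - {a}}
                   (\<lambda>(u, v). f (fst a + u * v, snd a + v)))"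

text \<open>R^k_[1](R^2): a composition of point blowings-up with at most one stage is the
  blowing-up of finitely many distinct points of R^2 (possibly none).\<close>
definition Rk1 :: "nat \<Rightarrow> (pt \<Rightarrow> real) set" where
  "Rk1 k = {f \<in> Rk k. \<exists>A. finite A \<and> regular_after_blowup A f}"

definition is_ideal_in :: "(pt \<Rightarrow> real) set \<Rightarrow> (pt \<Rightarrow> real) set \<Rightarrow> bool" where
  "is_ideal_in R I \<longleftrightarrow> I \<subseteq> R \<and> (\<lambda>_. 0) \<in> I \<and>
     (\<forall>a\<in>I. \<forall>b\<in>I. (\<lambda>z. a z + b z) \<in> I) \<and>
     (\<forall>r\<in>R. \<forall>a\<in>I. (\<lambda>z. r z * a z) \<in> I)"

definition principal_ideal :: "(pt \<Rightarrow> real) set \<Rightarrow> (pt \<Rightarrow> real) \<Rightarrow> (pt \<Rightarrow> real) set" where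
  "principal_ideal R f = {g. \<exists>h\<in>R. g = (\<lambda>z. f z * h z)}"

definition radical_in :: "(pt \<Rightarrow> real) set \<Rightarrow> (pt \<Rightarrow> real) set \<Rightarrow> (pt \<Rightarrow> real) set" where
  "radical_in R I = {g \<in> R. \<exists>N::nat. (\<lambda>z. g z ^ N) \<in> I}"

end

theory Submission
  imports Defs "HOL-Computational_Algebra.Field_as_Ring" "HOL-Computational_Algebra.Polynomial_Factorial"
begin

text \<open>
  A function of class \<open>C\<^sup>k\<close> lies in \<open>Rk1 k\<close> iff it is a fraction \<open>P / Q\<close> of polynomials where \<open>Q\<close> is
  definite: at every point the initial form of \<open>Q\<close> has no nontrivial real zero. Let \<open>d\<close> be the greatest
  common divisor of the polynomials in the ideal \<open>I\<close>. Clearing denominators, every \<open>g \<in> I\<close> is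
  \<open>d P / Q\<close> with \<open>Q\<close> definite; and the polynomials of \<open>I\<close> divided by \<open>d\<close> contain nonzero polynomials in
  \<open>x\<close> alone and in \<open>y\<close> alone, hence a definite polynomial \<open>D\<close>, so that \<open>d D \<in> I\<close>. The points of
  \<open>Z(d) - Z(I)\<close> are definite zeros of \<open>d\<close>, of which there are finitely many because the derivative of
  an irreducible factor vanishes there. Choose \<open>G = d P / V \<in> I\<close> nonzero at these points and at the points of
  \<open>Z(D) - Z(I)\<close>, and a polynomial \<open>E\<close> that vanishes to high order exactly at the finitely many points
  of \<open>Z(I)\<close> where \<open>D V = 0\<close>. Then \<open>f = (d D)\<^sup>2 + (E G)\<^sup>2\<close> has the zero set \<open>Z(I)\<close>, and
  \<open>f V\<^sup>2 = d\<^sup>2 W\<close> with \<open>W\<close> definite. Since \<open>g Q\<close> vanishes on \<open>Z(I)\<close> to a higher order than \<open>Q\<close>, for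
  large \<open>N\<close> the fraction \<open>g\<^sup>N / f\<close> has a definite denominator and is of class \<open>C\<^sup>k\<close>.
\<close>

section \<open>Polynomial functions of two variables\<close>

text \<open>Definiteness enters as a two-sided bound: near \<open>z\<close> the denominator
  \<open>Q\<close> is comparable to \<open>dist w z ^ m\<close>. Such bounds pass to factors of a
  product, and a quotient is of class C^k as soon as its numerator has order
  \<open>m + k + 1\<close>. High powers of \<open>g\<close> reach any such order because orders of
  polynomials are integers: \<open>g\<close> is merely continuous, so at a zero of \<open>g\<close>
  the polynomial \<open>g Q = d P\<close> is only known to be of smaller growth than
  \<open>dist w z ^ q\<close>, but this already forces order \<open>q + 1\<close>. Each further
  factor \<open>g\<close> thus gains one full order, while the amount to be compensated stays
  bounded, since only finitely many points matter. The obstacle is that \<open>d D\<close> has too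
  many zeros: members of the ideal need not vanish at all zeros of \<open>d\<close>, because their
  denominators may vanish there too, and \<open>D\<close> adds zeros of its own. The summand with
  \<open>G\<close> removes these zeros. It must not spoil the definiteness of
  \<open>W = (D V)^2 + (E P)^2\<close>. Off the zero set of the ideal \<open>f\<close> is nonzero,
  so \<open>W\<close> divides a definite polynomial and is definite for free; on it only the zeros
  of \<open>D V\<close> are critical, and there \<open>E\<close> makes the second square
  negligible.\<close>

definition ev :: "real poly poly \<Rightarrow> real \<Rightarrow> real \<Rightarrow> real" where
  "ev p x y = poly (poly p [:x:]) y"

lemma ev_simps [simp]:
  "ev 0 x y = 0" "ev 1 x y = 1" "ev (p + q) x y = ev p x y + ev q x y"
  "ev (p - q) x y = ev p x y - ev q x y" "ev (p * q) x y = ev p x y * ev q x y"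
  "ev (smult c p) x y = poly c y * ev p x y" "ev [:c:] x y = poly c y"
  "ev (p ^ n) x y = ev p x y ^ n" "ev (monom c n) x y = poly c y * x ^ n"
  "ev (pCons c p) x y = poly c y + x * ev p x y"
  by (auto simp: ev_def poly_monom poly_power)

lemma ev_sum: "ev (\<Sum>i\<in>A. p i) x y = (\<Sum>i\<in>A. ev (p i) x y)"
  by (induction A rule: infinite_finite_induct) auto

lemma poly_eq_sum_le:
  fixes p :: "'a::comm_semiring_1 poly"
  assumes "degree p \<le> n" shows "poly p x = (\<Sum>i\<le>n. coeff p i * x ^ i)"
  unfolding poly_altdef by (rule sum.mono_neutral_left) (use assms in \<open>auto simp: coeff_eq_0\<close>)

lemma polyfun2_iff_ev: "polyfun2 f \<longleftrightarrow> (\<exists>p. \<forall>x y. f (x, y) = ev p x y)"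
proof
  assume "polyfun2 f"
  then obtain n c where c: "\<And>x y. f (x, y) = (\<Sum>i\<le>n. \<Sum>j\<le>n. c i j * x ^ i * y ^ j)"
    unfolding polyfun2_def by blast
  have "f (x, y) = ev (\<Sum>i\<le>n. \<Sum>j\<le>n. monom (monom (c i j) j) i) x y" for x y
    by (simp add: ev_sum c poly_monom mult_ac)
  then show "\<exists>p. \<forall>x y. f (x, y) = ev p x y" by blast
next
  assume "\<exists>p. \<forall>x y. f (x, y) = ev p x y"
  then obtain p where p: "\<And>x y. f (x, y) = ev p x y" by blast
  define n where "n = degree p + (\<Sum>i\<le>degree p. degree (coeff p i))"
  have deg: "degree (coeff p i) \<le> n" for i
  proof (cases "i \<le> degree p")
    case True
    then have "degree (coeff p i) \<le> (\<Sum>i\<le>degree p. degree (coeff p i))"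
      by (intro member_le_sum) auto
    then show ?thesis by (simp add: n_def)
  qed (simp add: coeff_eq_0)
  have "f (x, y) = (\<Sum>i\<le>n. \<Sum>j\<le>n. coeff (coeff p i) j * x ^ i * y ^ j)" for x y
  proof -
    have "f (x, y) = (\<Sum>i\<le>n. poly (coeff p i) y * x ^ i)"
      unfolding p ev_def by (subst poly_eq_sum_le[of p n]) (auto simp: n_def poly_sum poly_power)
    also have "\<dots> = (\<Sum>i\<le>n. \<Sum>j\<le>n. coeff (coeff p i) j * x ^ i * y ^ j)"
      using deg by (simp add: poly_eq_sum_le[of _ n] sum_distrib_right sum_distrib_left mult_ac)
    finally show ?thesis .
  qed
  then show "polyfun2 f"
    unfolding polyfun2_def by (intro exI[of _ n] exI[of _ "\<lambda>i j. coeff (coeff p i) j"]) blast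
qed

lemma polyfun2_const [intro, simp]: "polyfun2 (\<lambda>z. c)"
  unfolding polyfun2_iff_ev by (rule exI[of _ "[:[:c:]:]"]) simp

lemma polyfun2_add [intro]: "polyfun2 p \<Longrightarrow> polyfun2 q \<Longrightarrow> polyfun2 (\<lambda>z. p z + q z)"
  unfolding polyfun2_iff_ev by (metis ev_simps(3))

lemma polyfun2_diff [intro]: "polyfun2 p \<Longrightarrow> polyfun2 q \<Longrightarrow> polyfun2 (\<lambda>z. p z - q z)"
  unfolding polyfun2_iff_ev by (metis ev_simps(4))

lemma polyfun2_mult [intro]: "polyfun2 p \<Longrightarrow> polyfun2 q \<Longrightarrow> polyfun2 (\<lambda>z. p z * q z)"
  unfolding polyfun2_iff_ev by (metis ev_simps(5))

lemma polyfun2_fst [intro, simp]: "polyfun2 fst"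
  unfolding polyfun2_iff_ev by (rule exI[of _ "[:0, 1:]"]) (simp add: one_pCons)

lemma polyfun2_snd [intro, simp]: "polyfun2 snd"
  unfolding polyfun2_iff_ev by (rule exI[of _ "[:[:0, 1:]:]"]) simp

lemma polyfun2_power [intro]: "polyfun2 p \<Longrightarrow> polyfun2 (\<lambda>z. p z ^ n)"
  by (induction n) auto

lemma polyfun2_sum [intro]: "(\<And>i. i \<in> A \<Longrightarrow> polyfun2 (p i)) \<Longrightarrow> polyfun2 (\<lambda>z. \<Sum>i\<in>A. p i z)"
  by (induction A rule: infinite_finite_induct) auto

lemma polyfun2_prod [intro]: "(\<And>i. i \<in> A \<Longrightarrow> polyfun2 (p i)) \<Longrightarrow> polyfun2 (\<lambda>z. \<Prod>i\<in>A. p i z)"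
  by (induction A rule: infinite_finite_induct) auto

lemma polyfun2_compose:
  assumes "polyfun2 p" "polyfun2 a" "polyfun2 b"
  shows "polyfun2 (\<lambda>z. p (a z, b z))"
proof -
  obtain n c where c: "\<And>x y. p (x, y) = (\<Sum>i\<le>n. \<Sum>j\<le>n. c i j * x ^ i * y ^ j)"
    using assms(1) unfolding polyfun2_def by blast
  show ?thesis unfolding c using assms by (intro polyfun2_sum polyfun2_mult polyfun2_power polyfun2_const)
qed

lemma polyfun2_flip: "polyfun2 p \<Longrightarrow> polyfun2 (\<lambda>z. p (snd z, fst z))"
  by (intro polyfun2_compose) auto

lemma polyfun2_translate: "polyfun2 p \<Longrightarrow> polyfun2 (\<lambda>z. p (a + fst z, b + snd z))"
  by (intro polyfun2_compose) auto

lemma polyfun2_ev [intro, simp]: "polyfun2 (\<lambda>z. ev p (fst z) (snd z))" "polyfun2 (\<lambda>z. ev p (snd z) (fst z))"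
proof -
  show *: "polyfun2 (\<lambda>z. ev p (fst z) (snd z))" unfolding polyfun2_iff_ev by auto
  show "polyfun2 (\<lambda>z. ev p (snd z) (fst z))" using polyfun2_flip[OF *] by simp
qed

lemma polyfun2_obtain_ev:
  assumes "polyfun2 f" obtains p where "f = (\<lambda>z. ev p (fst z) (snd z))"
  using assms unfolding polyfun2_iff_ev by (metis prod.collapse ext)

text \<open>In \<open>ev\<close> the outer variable of \<open>real poly poly\<close> is x and the
  coefficients are polynomials in y; here the roles are exchanged. Both readings are needed to find
  elements of an ideal with a factor in x alone and with one in y alone.\<close>

lemma polyfun2_obtain_ev_swap:
  assumes "polyfun2 f" obtains p where "f = (\<lambda>z. ev p (snd z) (fst z))"
proof -
  obtain p where "(\<lambda>z. f (snd z, fst z)) = (\<lambda>z. ev p (fst z) (snd z))"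
    using polyfun2_obtain_ev[OF polyfun2_flip[OF assms]] by blast
  then have "f z = ev p (snd z) (fst z)" for z
    by (metis fst_conv snd_conv prod.collapse)
  with that show ?thesis by blast
qed

lemma poly_fun_eq_0: "(\<And>x::real. poly p x = 0) \<Longrightarrow> p = 0"
  using poly_all_0_iff_0 by blast

text \<open>Over the integral domain of polynomials in y, \<open>p\<close> has every constant
  \<open>[:x:]\<close> as a root, hence infinitely many roots.\<close>

lemma ev_eq_0_imp: assumes "\<And>x y. ev p x y = 0" shows "p = 0"
proof -
  have "poly p [:x:] = 0" for x
    using assms by (intro poly_fun_eq_0) (simp add: ev_def)
  then have "range (\<lambda>x. [:x:]) \<subseteq> {q. poly p q = 0}" by auto
  moreover have "infinite (range (\<lambda>x::real. [:x:]))"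
    using infinite_UNIV_char_0[where 'a=real] by (subst finite_image_iff) (auto intro: injI)
  ultimately have "infinite {q. poly p q = 0}" using finite_subset by blast
  then show ?thesis using poly_roots_finite by blast
qed

lemma ev_inject:
  "(\<lambda>z. ev p (fst z) (snd z)) = (\<lambda>z. ev q (fst z) (snd z)) \<longleftrightarrow> p = q"
  "(\<lambda>z. ev p (snd z) (fst z)) = (\<lambda>z. ev q (snd z) (fst z)) \<longleftrightarrow> p = q"
proof -
  have "p = q" if "\<And>x y. ev p x y = ev q x y" using ev_eq_0_imp[of "p - q"] that by simp
  then show "(\<lambda>z. ev p (fst z) (snd z)) = (\<lambda>z. ev q (fst z) (snd z)) \<longleftrightarrow> p = q"
    "(\<lambda>z. ev p (snd z) (fst z)) = (\<lambda>z. ev q (snd z) (fst z)) \<longleftrightarrow> p = q"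
    by (auto simp: fun_eq_iff)
qed

lemma polyfun2_mult_eq_0:
  assumes "polyfun2 p" "polyfun2 q" "\<And>z. p z * q z = 0"
  shows "(\<forall>z. p z = 0) \<or> (\<forall>z. q z = 0)"
proof -
  obtain p' q' where p: "p = (\<lambda>z. ev p' (fst z) (snd z))" and q: "q = (\<lambda>z. ev q' (fst z) (snd z))"
    using assms polyfun2_obtain_ev by metis
  have "p' * q' = 0" by (rule ev_eq_0_imp) (use assms(3)[of "(_, _)"] in \<open>simp add: p q\<close>)
  then show ?thesis by (auto simp: p q)
qed

lemma continuous_on_polyfun2:
  assumes "polyfun2 p" shows "continuous_on A p"
proof -
  obtain n c where c: "\<And>x y. p (x, y) = (\<Sum>i\<le>n. \<Sum>j\<le>n. c i j * x ^ i * y ^ j)"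
    using assms unfolding polyfun2_def by blast
  have "p = (\<lambda>z. \<Sum>i\<le>n. \<Sum>j\<le>n. c i j * fst z ^ i * snd z ^ j)"
    by (auto simp: fun_eq_iff c)
  then show ?thesis by (auto intro!: continuous_intros)
qed

lemma isCont_polyfun2: "polyfun2 p \<Longrightarrow> isCont p z"
  using continuous_on_polyfun2[of p UNIV] continuous_on_eq_continuous_at by blast

lemma has_derivative_polyfun2:
  assumes "polyfun2 p"
  obtains p1 p2 where "polyfun2 p1" "polyfun2 p2"
    "\<And>z. (p has_derivative (\<lambda>(h1, h2). p1 z * h1 + p2 z * h2)) (at z)"
proof -
  obtain n c where c: "\<And>x y. p (x, y) = (\<Sum>i\<le>n. \<Sum>j\<le>n. c i j * x ^ i * y ^ j)"
    using assms unfolding polyfun2_def by blast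
  have p: "p = (\<lambda>z. \<Sum>i\<le>n. \<Sum>j\<le>n. c i j * fst z ^ i * snd z ^ j)"
    by (auto simp: fun_eq_iff c)
  define p1 where "p1 = (\<lambda>z::pt. \<Sum>i\<le>n. \<Sum>j\<le>n. c i j * (of_nat i * fst z ^ (i - 1)) * snd z ^ j)"
  define p2 where "p2 = (\<lambda>z::pt. \<Sum>i\<le>n. \<Sum>j\<le>n. c i j * fst z ^ i * (of_nat j * snd z ^ (j - 1)))"
  have "(p has_derivative (\<lambda>(h1, h2). p1 z * h1 + p2 z * h2)) (at z)" for z
    unfolding p by (auto intro!: derivative_eq_intros ext simp: p1_def p2_def case_prod_unfold
       sum_distrib_right sum_distrib_left sum.distrib algebra_simps)
  moreover have "polyfun2 p1" "polyfun2 p2"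
    unfolding p1_def p2_def by (intro polyfun2_sum polyfun2_mult polyfun2_power polyfun2_const polyfun2_fst polyfun2_snd)+
  ultimately show ?thesis using that by blast
qed

section \<open>Orders of vanishing\<close>

text \<open>Growth bounds replace Taylor coefficients so that one calculus serves polynomials,
  continuous functions and quotients. Since \<open>nhds z\<close> includes \<open>z\<close> itself,
  positive order forces the value 0 at \<open>z\<close>.\<close>

definition vord_ge :: "nat \<Rightarrow> pt \<Rightarrow> (pt \<Rightarrow> real) \<Rightarrow> bool" where
  "vord_ge m z p \<longleftrightarrow> (\<exists>C. \<forall>\<^sub>F w in nhds z. \<bar>p w\<bar> \<le> C * dist w z ^ m)"

text \<open>This is what a product with a continuous function vanishing at \<open>z\<close>
  provides; for polynomials it improves to \<open>vord_ge (Suc m)\<close>.\<close>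

definition vord_gt :: "nat \<Rightarrow> pt \<Rightarrow> (pt \<Rightarrow> real) \<Rightarrow> bool" where
  "vord_gt m z p \<longleftrightarrow> (\<forall>e>0. \<forall>\<^sub>F w in nhds z. \<bar>p w\<bar> \<le> e * dist w z ^ m)"

text \<open>For a polynomial \<open>p\<close> this says that the initial form of \<open>p\<close> at \<open>z\<close> has degree \<open>m\<close> and no nontrivial
  real zero; equivalently, the strict transform of \<open>p\<close> does not meet the exceptional curve over \<open>z\<close>.\<close>
definition definite_order :: "nat \<Rightarrow> pt \<Rightarrow> (pt \<Rightarrow> real) \<Rightarrow> bool" where
  "definite_order m z p \<longleftrightarrow> vord_ge m z p \<and> (\<exists>c>0. \<forall>\<^sub>F w in nhds z. c * dist w z ^ m \<le> \<bar>p w\<bar>)"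

lemma eventually_dist_le: "e > 0 \<Longrightarrow> \<forall>\<^sub>F w in nhds z. dist w z \<le> e"
  by (metis eventually_nhds_metric less_imp_le)

lemma vord_geI: "\<forall>\<^sub>F w in nhds z. \<bar>p w\<bar> \<le> C * dist w z ^ m \<Longrightarrow> vord_ge m z p"
  unfolding vord_ge_def by blast

lemma vord_geE:
  assumes "vord_ge m z p"
  obtains C where "C > 0" "\<forall>\<^sub>F w in nhds z. \<bar>p w\<bar> \<le> C * dist w z ^ m"
proof -
  from assms obtain C where "\<forall>\<^sub>F w in nhds z. \<bar>p w\<bar> \<le> C * dist w z ^ m"
    unfolding vord_ge_def by blast
  then have "\<forall>\<^sub>F w in nhds z. \<bar>p w\<bar> \<le> max C 1 * dist w z ^ m"
    by eventually_elim (meson max.cobounded1 mult_right_mono order_trans zero_le_dist zero_le_power)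
  then show ?thesis using that[of "max C 1"] by simp
qed

lemma vord_ge_mono: assumes "vord_ge m z p" "n \<le> m" shows "vord_ge n z p"
proof -
  obtain C where C: "C > 0" "\<forall>\<^sub>F w in nhds z. \<bar>p w\<bar> \<le> C * dist w z ^ m" using vord_geE[OF assms(1)] .
  from C(2) eventually_dist_le[OF zero_less_one, of z]
  have "\<forall>\<^sub>F w in nhds z. \<bar>p w\<bar> \<le> C * dist w z ^ n"
  proof eventually_elim
    case (elim w)
    then have "dist w z ^ m \<le> dist w z ^ n" using assms(2) by (intro power_decreasing) auto
    then have "C * dist w z ^ m \<le> C * dist w z ^ n" using C(1) by simp
    with elim show ?case by linarith
  qed
  then show ?thesis by (rule vord_geI)
qed

lemma vord_ge_mult:
  assumes "vord_ge m z p" "vord_ge n z q" shows "vord_ge (m + n) z (\<lambda>w. p w * q w)"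
proof -
  obtain C where C: "C > 0" "\<forall>\<^sub>F w in nhds z. \<bar>p w\<bar> \<le> C * dist w z ^ m" using vord_geE[OF assms(1)] .
  obtain D where D: "D > 0" "\<forall>\<^sub>F w in nhds z. \<bar>q w\<bar> \<le> D * dist w z ^ n" using vord_geE[OF assms(2)] .
  from C(2) D(2) have "\<forall>\<^sub>F w in nhds z. \<bar>p w * q w\<bar> \<le> (C * D) * dist w z ^ (m + n)"
  proof eventually_elim
    case (elim w)
    then have "\<bar>p w\<bar> * \<bar>q w\<bar> \<le> (C * dist w z ^ m) * (D * dist w z ^ n)"
      using C(1) by (intro mult_mono) auto
    then show ?case by (simp add: abs_mult power_add mult_ac)
  qed
  then show ?thesis by (rule vord_geI)
qed

lemma vord_ge_add:
  assumes "vord_ge m z p" "vord_ge m z q" shows "vord_ge m z (\<lambda>w. p w + q w)"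
proof -
  obtain C where C: "C > 0" "\<forall>\<^sub>F w in nhds z. \<bar>p w\<bar> \<le> C * dist w z ^ m" using vord_geE[OF assms(1)] .
  obtain D where D: "D > 0" "\<forall>\<^sub>F w in nhds z. \<bar>q w\<bar> \<le> D * dist w z ^ m" using vord_geE[OF assms(2)] .
  from C(2) D(2) have "\<forall>\<^sub>F w in nhds z. \<bar>p w + q w\<bar> \<le> (C + D) * dist w z ^ m"
    by eventually_elim (simp add: algebra_simps)
  then show ?thesis by (rule vord_geI)
qed

lemma vord_ge_zero: "vord_ge m z (\<lambda>w. 0)"
  by (rule vord_geI[where C=0]) simp

lemma vord_ge_sum: "(\<And>i. i \<in> A \<Longrightarrow> vord_ge m z (p i)) \<Longrightarrow> vord_ge m z (\<lambda>w. \<Sum>i\<in>A. p i w)"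
  by (induction A rule: infinite_finite_induct) (auto intro: vord_ge_add vord_ge_zero)

lemma vord_ge_uminus: "vord_ge m z p \<Longrightarrow> vord_ge m z (\<lambda>w. - p w)"
  by (simp add: vord_ge_def)

lemma vord_ge_diff: "vord_ge m z p \<Longrightarrow> vord_ge m z q \<Longrightarrow> vord_ge m z (\<lambda>w. p w - q w)"
  using vord_ge_add[OF _ vord_ge_uminus] by fastforce

lemma vord_ge_isCont: assumes "isCont p z" shows "vord_ge 0 z p"
proof -
  have "(p \<longlongrightarrow> p z) (nhds z)" using assms by (metis isCont_def tendsto_at_iff_tendsto_nhds)
  then have "\<forall>\<^sub>F w in nhds z. dist (p w) (p z) < 1" by (simp add: tendsto_iff)
  then have "\<forall>\<^sub>F w in nhds z. \<bar>p w\<bar> \<le> (\<bar>p z\<bar> + 1) * dist w z ^ 0"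
    by eventually_elim (auto simp: dist_real_def)
  then show ?thesis by (rule vord_geI)
qed

lemma vord_ge_const: "vord_ge 0 z (\<lambda>w. c)" by (rule vord_ge_isCont) simp

lemma vord_ge_power: "vord_ge m z p \<Longrightarrow> vord_ge (m * n) z (\<lambda>w. p w ^ n)"
proof (induction n)
  case (Suc n)
  then show ?case using vord_ge_mult[of m z p "m * n" "\<lambda>w. p w ^ n"] by simp
qed (simp add: vord_ge_const)

lemma vord_ge_mult_isCont: "vord_ge m z p \<Longrightarrow> isCont q z \<Longrightarrow> vord_ge m z (\<lambda>w. p w * q w)"
  using vord_ge_mult[OF _ vord_ge_isCont] by fastforce

lemma vord_ge_fst_diff: "vord_ge 1 z (\<lambda>w. fst w - fst z)"
  by (rule vord_geI[where C=1]) (auto intro!: always_eventually simp: dist_real_def[symmetric] dist_fst_le)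

lemma vord_ge_snd_diff: "vord_ge 1 z (\<lambda>w. snd w - snd z)"
  by (rule vord_geI[where C=1]) (auto intro!: always_eventually simp: dist_real_def[symmetric] dist_snd_le)

lemma vord_ge_Suc_imp_gt: assumes "vord_ge (Suc m) z p" shows "vord_gt m z p"
  unfolding vord_gt_def
proof (intro allI impI)
  fix e :: real assume "e > 0"
  obtain C where C: "C > 0" "\<forall>\<^sub>F w in nhds z. \<bar>p w\<bar> \<le> C * dist w z ^ Suc m" using vord_geE[OF assms(1)] .
  from C(2) eventually_dist_le[OF divide_pos_pos[OF \<open>e > 0\<close> C(1)], of z]
  show "\<forall>\<^sub>F w in nhds z. \<bar>p w\<bar> \<le> e * dist w z ^ m"
  proof eventually_elim
    case (elim w)
    then have "C * dist w z \<le> e" using C(1) by (simp add: field_simps)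
    then have "C * dist w z * dist w z ^ m \<le> e * dist w z ^ m" by (intro mult_right_mono) auto
    with elim show ?case by (simp add: mult_ac)
  qed
qed

lemma vord_gt_mult:
  assumes "isCont g z" "g z = 0" "vord_ge m z p" shows "vord_gt m z (\<lambda>w. g w * p w)"
  unfolding vord_gt_def
proof (intro allI impI)
  fix e :: real assume "e > 0"
  obtain C where C: "C > 0" "\<forall>\<^sub>F w in nhds z. \<bar>p w\<bar> \<le> C * dist w z ^ m" using vord_geE[OF assms(3)] .
  have "(g \<longlongrightarrow> g z) (nhds z)" using assms by (metis isCont_def tendsto_at_iff_tendsto_nhds)
  then have "\<forall>\<^sub>F w in nhds z. dist (g w) (g z) < e / C"
    using \<open>e > 0\<close> C(1) unfolding tendsto_iff by (meson divide_pos_pos)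
  with C(2) show "\<forall>\<^sub>F w in nhds z. \<bar>g w * p w\<bar> \<le> e * dist w z ^ m"
  proof eventually_elim
    case (elim w)
    then have "\<bar>g w\<bar> * \<bar>p w\<bar> \<le> (e / C) * (C * dist w z ^ m)"
      using C(1) \<open>e > 0\<close> assms(2) by (intro mult_mono) (auto simp: dist_real_def)
    then show ?case using C(1) by (simp add: abs_mult)
  qed
qed

lemma vord_ge_1_imp_zero: assumes "vord_ge m z p" "m > 0" shows "p z = 0"
proof -
  obtain C where C: "C > 0" "\<forall>\<^sub>F w in nhds z. \<bar>p w\<bar> \<le> C * dist w z ^ m" using vord_geE[OF assms(1)] .
  then show ?thesis using eventually_nhds_x_imp_x[OF C(2)] assms(2) by (simp add: power_0_left)
qed

lemma definite_order_imp_vord_ge: "definite_order m z p \<Longrightarrow> vord_ge m z p"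
  by (simp add: definite_order_def)

lemma definite_order_mult:
  assumes "definite_order m z p" "definite_order n z q"
  shows "definite_order (m + n) z (\<lambda>w. p w * q w)"
proof -
  obtain c where c: "c > 0" "\<forall>\<^sub>F w in nhds z. c * dist w z ^ m \<le> \<bar>p w\<bar>"
    using assms(1) unfolding definite_order_def by blast
  obtain d where d: "d > 0" "\<forall>\<^sub>F w in nhds z. d * dist w z ^ n \<le> \<bar>q w\<bar>"
    using assms(2) unfolding definite_order_def by blast
  from c(2) d(2) have "\<forall>\<^sub>F w in nhds z. (c * d) * dist w z ^ (m + n) \<le> \<bar>p w * q w\<bar>"
  proof eventually_elim
    case (elim w)
    then have "(c * dist w z ^ m) * (d * dist w z ^ n) \<le> \<bar>p w\<bar> * \<bar>q w\<bar>"
      using c(1) d(1) by (intro mult_mono) auto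
    then show ?case by (simp add: abs_mult power_add mult_ac)
  qed
  then show ?thesis using c(1) d(1) assms unfolding definite_order_def
    by (auto intro: vord_ge_mult mult_pos_pos)
qed

lemma definite_order_0:
  assumes "isCont p z" "p z \<noteq> 0" shows "definite_order 0 z p"
proof -
  have "(p \<longlongrightarrow> p z) (nhds z)" using assms by (metis isCont_def tendsto_at_iff_tendsto_nhds)
  then have "\<forall>\<^sub>F w in nhds z. dist (p w) (p z) < \<bar>p z\<bar> / 2"
    using assms(2) unfolding tendsto_iff by (meson half_gt_zero_iff zero_less_abs_iff)
  then have "\<forall>\<^sub>F w in nhds z. \<bar>p z\<bar> / 2 * dist w z ^ 0 \<le> \<bar>p w\<bar>"
    by eventually_elim (auto simp: dist_real_def abs_if split: if_splits)
  then show ?thesis using assms unfolding definite_order_def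
    by (auto intro!: vord_ge_isCont exI[of _ "\<bar>p z\<bar> / 2"])
qed

lemma definite_order_power: "definite_order m z p \<Longrightarrow> definite_order (m * n) z (\<lambda>w. p w ^ n)"
proof (induction n)
  case (Suc n)
  then show ?case using definite_order_mult[of m z p "m * n" "\<lambda>w. p w ^ n"] by simp
qed (simp add: definite_order_0)

lemma definite_order_add:
  assumes "definite_order m z p" "vord_ge (Suc m) z q"
  shows "definite_order m z (\<lambda>w. p w + q w)"
proof -
  obtain c where c: "c > 0" "\<forall>\<^sub>F w in nhds z. c * dist w z ^ m \<le> \<bar>p w\<bar>"
    using assms(1) unfolding definite_order_def by blast
  have "\<forall>\<^sub>F w in nhds z. \<bar>q w\<bar> \<le> c / 2 * dist w z ^ m"
    using vord_ge_Suc_imp_gt[OF assms(2)] c(1) unfolding vord_gt_def by (meson half_gt_zero)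
  with c(2) have "\<forall>\<^sub>F w in nhds z. (c / 2) * dist w z ^ m \<le> \<bar>p w + q w\<bar>"
    by eventually_elim linarith
  then show ?thesis using c(1) assms vord_ge_mono[OF assms(2), of m] unfolding definite_order_def
    by (auto intro!: vord_ge_add exI[of _ "c / 2"])
qed

lemma definite_order_nonzero_near:
  assumes "definite_order m z p" shows "\<forall>\<^sub>F w in at z. p w \<noteq> 0"
proof -
  obtain c where c: "c > 0" "\<forall>\<^sub>F w in nhds z. c * dist w z ^ m \<le> \<bar>p w\<bar>"
    using assms(1) unfolding definite_order_def by blast
  have "\<forall>\<^sub>F w in nhds z. w \<noteq> z \<longrightarrow> p w \<noteq> 0" using c(2)
  proof eventually_elim
    case (elim w)
    show ?case
    proof
      assume "w \<noteq> z" then have "0 < c * dist w z ^ m" using c(1) by simp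
      then show "p w \<noteq> 0" using elim by auto
    qed
  qed
  then show ?thesis by (simp add: eventually_at_filter)
qed

section \<open>Orders of vanishing of polynomials, read off their Taylor coefficients\<close>

lemma coeff_zero_of_littleo:
  fixes T :: "real poly"
  assumes "\<And>e. e > 0 \<Longrightarrow> \<forall>\<^sub>F t in at 0. \<bar>poly T t\<bar> \<le> e * \<bar>t\<bar> ^ q" and "s \<le> q"
  shows "coeff T s = 0"
proof (cases "T = 0")
  case False
  define n where "n = order 0 T"
  obtain T' where T': "T = monom 1 n * T'" and nd: "\<not> [:0, 1:] dvd T'"
    using order_decomp[OF False, of 0] by (auto simp: n_def monom_altdef)
  have T'0: "poly T' 0 \<noteq> 0" using nd by (metis dvd_iff_poly_eq_0 minus_zero)
  \<comment> \<open>Near 0 the values of \<open>T\<close> exceed half of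
    \<open>\<bar>poly T' 0\<bar> * \<bar>t\<bar> ^ n\<close> in absolute value, which contradicts
    the hypothesis for \<open>e = \<bar>poly T' 0\<bar> / 2\<close> unless
    \<open>n > q\<close>.\<close>
  have "n > q"
  proof (rule ccontr)
    assume "\<not> n > q"
    have "((\<lambda>t. poly T' t) \<longlongrightarrow> poly T' 0) (at 0)" by (rule isContD) simp
    then have 1: "\<forall>\<^sub>F t in at 0. dist (poly T' t) (poly T' 0) < \<bar>poly T' 0\<bar> / 2"
      using T'0 unfolding tendsto_iff by (meson half_gt_zero_iff zero_less_abs_iff)
    have 2: "\<forall>\<^sub>F t in at 0. \<bar>poly T t\<bar> \<le> \<bar>poly T' 0\<bar> / 2 * \<bar>t\<bar> ^ q"
      using assms(1)[of "\<bar>poly T' 0\<bar> / 2"] T'0 by simp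
    have 3: "\<forall>\<^sub>F t::real in at 0. t \<noteq> 0 \<and> \<bar>t\<bar> \<le> 1"
      unfolding eventually_at by (rule exI[of _ 1]) auto
    have "\<forall>\<^sub>F t::real in at 0. False" using 1 2 3
    proof eventually_elim
      case (elim t)
      have "\<bar>t\<bar> ^ n * \<bar>poly T' t\<bar> \<le> \<bar>poly T' 0\<bar> / 2 * \<bar>t\<bar> ^ q"
        using elim by (simp add: T' poly_monom abs_mult power_abs)
      also have "\<dots> \<le> \<bar>poly T' 0\<bar> / 2 * \<bar>t\<bar> ^ n"
        using elim \<open>\<not> n > q\<close> by (intro mult_left_mono power_decreasing) auto
      finally have "\<bar>poly T' t\<bar> \<le> \<bar>poly T' 0\<bar> / 2" using elim by (simp add: mult.commute)
      then show ?case using elim by (auto simp: dist_real_def abs_if split: if_splits)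
    qed
    then show False by simp
  qed
  then show ?thesis using assms(2) by (simp add: T' coeff_monom_mult)
qed simp

lemma polyfun2_taylor:
  assumes "polyfun2 p"
  obtains n c where "\<And>w. p w = (\<Sum>i\<le>n. \<Sum>j\<le>n. c i j * (fst w - fst z) ^ i * (snd w - snd z) ^ j)"
proof -
  have "polyfun2 (\<lambda>w. p (fst z + fst w, snd z + snd w))" using polyfun2_translate[OF assms] .
  then obtain n c where c: "\<And>x y. p (fst z + x, snd z + y) = (\<Sum>i\<le>n. \<Sum>j\<le>n. c i j * x ^ i * y ^ j)"
    unfolding polyfun2_def by auto
  have "p w = (\<Sum>i\<le>n. \<Sum>j\<le>n. c i j * (fst w - fst z) ^ i * (snd w - snd z) ^ j)" for w
    using c[of "fst w - fst z" "snd w - snd z"] by simp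
  then show ?thesis using that by blast
qed

text \<open>Restricted to a line through \<open>z\<close>, \<open>p\<close> becomes a univariate
  polynomial whose coefficient of degree \<open>s\<close> is the homogeneous part of degree
  \<open>s\<close> at the direction of the line. The growth bound kills it for every direction, so
  the homogeneous part is zero.\<close>

lemma taylor_coeff_zero:
  assumes p: "\<And>w. p w = (\<Sum>i\<le>n. \<Sum>j\<le>n. c i j * (fst w - fst z) ^ i * (snd w - snd z) ^ j)"
    and gt: "vord_gt q z p" and ij: "i \<le> n" "j \<le> n" "i + j \<le> q"
  shows "c i j = 0"
proof -
  define s where "s = i + j"
  have hom: "(\<Sum>i\<le>n. \<Sum>j\<le>n. if i + j = s then c i j * x ^ i * y ^ j else 0) = 0" for x y
  proof -
    define T where "T = (\<Sum>i\<le>n. \<Sum>j\<le>n. monom (c i j * x ^ i * y ^ j) (i + j))"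
    define l where "l = (\<lambda>t. (fst z + t * x, snd z + t * y))"
    have T: "poly T t = p (l t)" for t
      by (simp add: T_def p l_def poly_sum poly_monom power_mult_distrib power_add mult_ac)
    have "(l \<longlongrightarrow> (fst z + 0 * x, snd z + 0 * y)) (at 0)"
      unfolding l_def by (intro tendsto_intros)
    then have lim: "filterlim l (nhds z) (at 0)" by simp
    have dl: "dist (l t) z = \<bar>t\<bar> * norm (x, y)" for t
    proof -
      have "l t - z = t *\<^sub>R (x, y)" by (auto simp: l_def prod_eq_iff)
      then show ?thesis by (simp only: dist_norm norm_scaleR)
    qed
    have "coeff T s = 0"
    proof (rule coeff_zero_of_littleo)
      fix e :: real assume e: "e > 0"
      \<comment> \<open>Distances along the line are \<open>\<bar>t\<bar>\<close> times the norm of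
        the direction; dividing \<open>e\<close> absorbs this norm, and the summand 1 keeps the
        divisor positive for the zero direction.\<close>
      have pos: "norm (x, y) ^ q + 1 > 0" by (smt (verit) norm_ge_zero zero_le_power)
      then have "\<forall>\<^sub>F w in nhds z. \<bar>p w\<bar> \<le> e / (norm (x, y) ^ q + 1) * dist w z ^ q"
        using gt e unfolding vord_gt_def by (meson divide_pos_pos)
      then have "\<forall>\<^sub>F t in at 0. \<bar>p (l t)\<bar> \<le> e / (norm (x, y) ^ q + 1) * dist (l t) z ^ q"
        using lim by (rule eventually_compose_filterlim)
      then show "\<forall>\<^sub>F t in at 0. \<bar>poly T t\<bar> \<le> e * \<bar>t\<bar> ^ q"
      proof eventually_elim
        case (elim t)
        have "e / (norm (x, y) ^ q + 1) * (\<bar>t\<bar> * norm (x, y)) ^ q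
            = e * \<bar>t\<bar> ^ q * (norm (x, y) ^ q / (norm (x, y) ^ q + 1))"
          by (simp add: power_mult_distrib)
        also have "\<dots> \<le> e * \<bar>t\<bar> ^ q * 1"
          using e pos by (intro mult_left_mono) (auto simp: field_simps)
        finally show ?case using elim by (simp add: T dl)
      qed
    qed (use ij s_def in simp)
    then show ?thesis by (simp add: T_def coeff_sum if_distrib cong: if_cong)
  qed
  \<comment> \<open>The form is dehomogenised at y = 1; as \<open>i + j = s\<close>, the exponent
    \<open>i\<close> alone identifies a coefficient.\<close>
  define U where "U = (\<Sum>i\<le>n. \<Sum>j\<le>n. if i + j = s then monom (c i j) i else 0)"
  have "poly U x = 0" for x
    using hom[of x 1] by (simp add: U_def poly_sum if_distrib[of "\<lambda>p. poly p x"] poly_monom cong: if_cong)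
  then have "U = 0" by (rule poly_fun_eq_0)
  then have "0 = coeff U i" by simp
  also have "\<dots> = (\<Sum>i'\<le>n. \<Sum>j'\<le>n. if j' = j then if i' = i then c i j else 0 else 0)"
    unfolding U_def coeff_sum by (intro sum.cong refl) (auto simp: s_def)
  also have "\<dots> = c i j" using ij by simp
  finally show ?thesis by simp
qed

lemma vord_ge_of_taylor:
  assumes p: "\<And>w. p w = (\<Sum>i\<le>n. \<Sum>j\<le>n. c i j * (fst w - fst z) ^ i * (snd w - snd z) ^ j)"
    and c0: "\<And>i j. i \<le> n \<Longrightarrow> j \<le> n \<Longrightarrow> i + j < N \<Longrightarrow> c i j = 0"
  shows "vord_ge N z p"
proof -
  note 1 = vord_ge_fst_diff[of z] and 2 = vord_ge_snd_diff[of z]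
  have "vord_ge N z (\<lambda>w. c i j * (fst w - fst z) ^ i * (snd w - snd z) ^ j)" if "i \<le> n" "j \<le> n" for i j
  proof (cases "i + j < N")
    case False
    have "vord_ge (0 + 1 * i + 1 * j) z (\<lambda>w. c i j * (fst w - fst z) ^ i * (snd w - snd z) ^ j)"
      by (intro vord_ge_mult vord_ge_const vord_ge_power 1 2)
    then show ?thesis by (rule vord_ge_mono) (use False in simp)
  qed (use c0 that vord_ge_zero in simp)
  then have "vord_ge N z (\<lambda>w. \<Sum>i\<le>n. \<Sum>j\<le>n. c i j * (fst w - fst z) ^ i * (snd w - snd z) ^ j)"
    by (intro vord_ge_sum) auto
  then show ?thesis by (simp add: p[abs_def])
qed

text \<open>The order of a polynomial is an integer, so anything better than order \<open>q\<close>
  is order \<open>q + 1\<close>. This turns mere continuity of a function into a gain of a full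
  order.\<close>

lemma vord_gt_imp_ge_Suc:
  assumes "polyfun2 p" "vord_gt q z p" shows "vord_ge (Suc q) z p"
proof -
  obtain n c where c: "\<And>w. p w = (\<Sum>i\<le>n. \<Sum>j\<le>n. c i j * (fst w - fst z) ^ i * (snd w - snd z) ^ j)"
    by (rule polyfun2_taylor[OF assms(1), of z]) blast
  show ?thesis
    by (rule vord_ge_of_taylor[OF c]) (rule taylor_coeff_zero[OF c assms(2)], auto)
qed

lemma taylor_coeff_zero':
  assumes p: "\<And>w. p w = (\<Sum>i\<le>n. \<Sum>j\<le>n. c i j * (fst w - fst z) ^ i * (snd w - snd z) ^ j)"
    and ge: "vord_ge N z p" and ij: "i \<le> n" "j \<le> n" "i + j < N"
  shows "c i j = 0"
proof (cases N)
  case (Suc q)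
  show ?thesis
    by (rule taylor_coeff_zero[OF p vord_ge_Suc_imp_gt]) (use ge ij Suc in auto)
qed (use ij in simp)

lemma polyfun2_zero_of_vord_all:
  assumes "polyfun2 p" "\<And>N. vord_ge N z p" shows "p = (\<lambda>w. 0)"
proof -
  obtain n c where c: "\<And>w. p w = (\<Sum>i\<le>n. \<Sum>j\<le>n. c i j * (fst w - fst z) ^ i * (snd w - snd z) ^ j)"
    by (rule polyfun2_taylor[OF assms(1), of z]) blast
  have "c i j = 0" if "i \<le> n" "j \<le> n" for i j
    by (rule taylor_coeff_zero'[OF c assms(2)[of "Suc (i + j)"]]) (use that in auto)
  then show ?thesis by (auto simp: c)
qed

lemma polyfun2_zero_of_eventually:
  assumes "polyfun2 p" "\<forall>\<^sub>F w in nhds z. p w = 0" shows "p = (\<lambda>w. 0)"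
proof (rule polyfun2_zero_of_vord_all[OF assms(1)])
  show "vord_ge N z p" for N
    by (rule vord_geI[where C=0]) (use assms(2) in eventually_elim, auto)
qed

lemma exists_order:
  assumes "polyfun2 p" "p \<noteq> (\<lambda>w. 0)"
  obtains N where "vord_ge N z p" "\<not> vord_ge (Suc N) z p"
proof -
  have "\<exists>N. \<not> vord_ge N z p" using polyfun2_zero_of_vord_all assms by blast
  then obtain N where "\<not> vord_ge N z p" "\<And>M. M < N \<Longrightarrow> vord_ge M z p"
    using exists_least_iff[of "\<lambda>N. \<not> vord_ge N z p"] by blast
  moreover have "vord_ge 0 z p" using vord_ge_isCont isCont_polyfun2 assms by blast
  ultimately show ?thesis using that by (cases N) auto
qed

text \<open>The set where \<open>f\<close> and \<open>g\<close> differ is open, and a nonzero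
  polynomial cannot vanish on a nonempty open set. This permits cancelling polynomial factors in
  identities between continuous functions, even at the zeros of the factor.\<close>

lemma eq_by_density:
  assumes "polyfun2 p" "p \<noteq> (\<lambda>w. 0)" "continuous_on UNIV f" "continuous_on UNIV g"
    and eq: "\<And>z. p z \<noteq> 0 \<Longrightarrow> f z = (g z :: real)"
  shows "f z = g z"
proof (rule ccontr)
  assume "f z \<noteq> g z"
  moreover have "open {w. f w \<noteq> g w}" using assms by (intro open_Collect_neq)
  ultimately have "\<forall>\<^sub>F w in nhds z. f w \<noteq> g w" by (intro eventually_nhds[THEN iffD2]) auto
  then have "\<forall>\<^sub>F w in nhds z. p w = 0" by eventually_elim (use eq in blast)
  then show False using polyfun2_zero_of_eventually assms by blast
qed

text \<open>For finite \<open>S\<close> the factors are sums of two real squares, so the zero set is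
  exactly \<open>S\<close>, without further curves.\<close>

definition dist_poly :: "pt set \<Rightarrow> pt \<Rightarrow> real" where
  "dist_poly S z = (\<Prod>b\<in>S. (fst z - fst b) ^ 2 + (snd z - snd b) ^ 2)"

lemma polyfun2_dist_poly [intro]: "polyfun2 (dist_poly S)"
  unfolding dist_poly_def[abs_def]
  by (intro polyfun2_prod polyfun2_add polyfun2_power polyfun2_diff) auto

lemma dist_poly_eq_0_iff: "finite S \<Longrightarrow> dist_poly S z = 0 \<longleftrightarrow> z \<in> S"
  by (auto simp: dist_poly_def sum_power2_eq_zero_iff prod_eq_iff)

lemma eq_by_cofinite:
  assumes "finite (S :: pt set)" "continuous_on UNIV f" "continuous_on UNIV g"
    and "\<And>z. z \<notin> S \<Longrightarrow> f z = (g z :: real)"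
  shows "f z = g z"
proof (rule eq_by_density[OF polyfun2_dist_poly])
  obtain x where "x \<notin> fst ` S"
    using assms(1) infinite_UNIV_char_0[where 'a=real] ex_new_if_finite by (metis finite_imageI)
  then obtain w where "w \<notin> S" by (metis fst_conv image_eqI)
  then show "dist_poly S \<noteq> (\<lambda>w. 0)" using dist_poly_eq_0_iff[OF assms(1)] by metis
qed (use assms dist_poly_eq_0_iff in auto)

text \<open>The bound is not sharp, but high powers of \<open>dist_poly\<close> are taken later, so
  order 1 suffices. It follows from the integrality of orders alone.\<close>

lemma vord_ge_dist_poly:
  assumes "finite S" "b \<in> S" shows "vord_ge 1 b (dist_poly S)"
proof -
  have "vord_gt 0 b (\<lambda>w. dist_poly S w * 1)"
    using assms by (intro vord_gt_mult isCont_polyfun2 vord_ge_const) (auto simp: dist_poly_eq_0_iff)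
  then show ?thesis using vord_gt_imp_ge_Suc by (auto simp: polyfun2_dist_poly)
qed

section \<open>Charts of the blowing-up\<close>

text \<open>In the chart the monomial with exponents \<open>i\<close>, \<open>j\<close> at
  \<open>z\<close> becomes \<open>u^(i+j) v^j\<close>, so order at least \<open>N\<close> makes
  everything divisible by \<open>u^N\<close>. On the exceptional line \<open>u = 0\<close> the
  quotient is the part of degree \<open>N\<close> at the direction \<open>(1, v)\<close>; if
  \<open>N\<close> is the exact order, \<open>p'\<close> is the strict transform.\<close>

lemma blowup_chart:
  assumes "polyfun2 p" "vord_ge N z p"
  obtains p' where "polyfun2 p'" "\<And>u v. p (fst z + u, snd z + u * v) = u ^ N * p' (u, v)"
    "\<not> vord_ge (Suc N) z p \<longrightarrow> (\<exists>v. p' (0, v) \<noteq> 0)"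
proof -
  obtain n c where c: "\<And>w. p w = (\<Sum>i\<le>n. \<Sum>j\<le>n. c i j * (fst w - fst z) ^ i * (snd w - snd z) ^ j)"
    by (rule polyfun2_taylor[OF assms(1), of z]) blast
  have c0: "c i j = 0" if "i \<le> n" "j \<le> n" "i + j < N" for i j
    using taylor_coeff_zero'[OF c assms(2)] that by blast
  \<comment> \<open>The truncated subtraction is harmless: the coefficients with
    \<open>i + j < N\<close> vanish.\<close>
  define p' where "p' = (\<lambda>w::pt. \<Sum>i\<le>n. \<Sum>j\<le>n. c i j * fst w ^ (i + j - N) * snd w ^ j)"
  have "polyfun2 p'" unfolding p'_def by (intro polyfun2_sum polyfun2_mult polyfun2_power) auto
  moreover have "p (fst z + u, snd z + u * v) = u ^ N * p' (u, v)" for u v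
  proof -
    have "c i j * u ^ i * (u * v) ^ j = u ^ N * (c i j * u ^ (i + j - N) * v ^ j)" if "i \<le> n" "j \<le> n" for i j
    proof (cases "i + j < N")
      case False
      then have "u ^ N * u ^ (i + j - N) = u ^ (i + j)" by (simp add: power_add[symmetric])
      then show ?thesis by (simp add: power_mult_distrib power_add mult_ac)
    qed (use c0 that in simp)
    then show ?thesis unfolding c p'_def sum_distrib_left by (intro sum.cong refl) auto
  qed
  moreover have "\<exists>v. p' (0, v) \<noteq> 0" if "\<not> vord_ge (Suc N) z p"
  proof (rule ccontr)
    assume "\<nexists>v. p' (0, v) \<noteq> 0"
    then have p'0: "p' (0, v) = 0" for v by blast
    \<comment> \<open>This is \<open>p'\<close> on the exceptional line as a polynomial in
      \<open>v\<close>. By \<open>0 ^ 0 = 1\<close> it retains the terms with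
      \<open>i + j = N\<close>; truncation also retains those with \<open>i + j < N\<close>, whose
      coefficients are 0.\<close>
    define V where "V = (\<Sum>i\<le>n. \<Sum>j\<le>n. monom (c i j * 0 ^ (i + j - N)) j)"
    have "poly V v = 0" for v
      using p'0[of v] by (simp add: V_def p'_def poly_sum poly_monom)
    then have V: "V = 0" by (rule poly_fun_eq_0)
    have "c i j = 0" if ij: "i \<le> n" "j \<le> n" "i + j < Suc N" for i j
    proof (cases "i + j < N")
      case False
      then have N: "N = i + j" using ij by simp
      have "0 = coeff V j" by (simp add: V)
      also have "\<dots> = (\<Sum>i'\<le>n. \<Sum>j'\<le>n. if j' = j then c i' j * 0 ^ (i' + j - N) else 0)"
        unfolding V_def coeff_sum by (intro sum.cong refl) auto
      also have "\<dots> = (\<Sum>i'\<le>n. c i' j * 0 ^ (i' + j - N))" using ij by simp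
      also have "\<dots> = (\<Sum>i'\<le>n. if i' = i then c i j else 0)"
      proof (intro sum.cong refl)
        fix i' assume "i' \<in> {..n}"
        then show "c i' j * 0 ^ (i' + j - N) = (if i' = i then c i j else 0)"
          using c0[of i' j] ij N by (cases "i' < i") (auto simp: power_0_left)
      qed
      also have "\<dots> = c i j" using ij by simp
      finally show ?thesis by simp
    qed (use c0 ij in simp)
    then have "vord_ge (Suc N) z p" by (intro vord_ge_of_taylor[OF c]) auto
    then show False using that by simp
  qed
  ultimately show ?thesis using that by blast
qed

lemma filterlim_chart: "filterlim (\<lambda>u. (fst z + u, snd z + u * v)) (nhds z) (at (0::real))"
proof -
  have "((\<lambda>u. (fst z + u, snd z + u * v)) \<longlongrightarrow> (fst z + 0, snd z + 0 * v)) (at (0::real))"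
    by (intro tendsto_intros)
  then show ?thesis by simp
qed

lemma dist_chart: "dist (fst z + u, snd z + u * v) z = \<bar>u\<bar> * norm (1::real, v::real)"
proof -
  have "(fst z + u, snd z + u * v) - z = u *\<^sub>R (1, v)" by (auto simp: prod_eq_iff)
  then show ?thesis by (simp only: dist_norm norm_scaleR)
qed

lemma norm_1_pos: "norm (1::real, v::real) > 0" by (simp add: prod_eq_iff zero_prod_def)

lemma tendsto_chart: "polyfun2 p \<Longrightarrow> ((\<lambda>u. p (u, v)) \<longlongrightarrow> p (0, v)) (at (0::real))"
  by (rule isCont_tendsto_compose[OF isCont_polyfun2]) (auto intro!: tendsto_intros)

text \<open>After division by \<open>\<bar>u\<bar> ^ N\<close> the lower bound no longer depends on
  \<open>u\<close>, so it survives the limit at the exceptional line.\<close>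

lemma definite_order_chart_nonzero:
  assumes "definite_order N z p" "polyfun2 p'" and eq: "\<And>u v. p (fst z + u, snd z + u * v) = u ^ N * p' (u, v)"
  shows "p' (0, v) \<noteq> 0"
proof -
  obtain c where c: "c > 0" "\<forall>\<^sub>F w in nhds z. c * dist w z ^ N \<le> \<bar>p w\<bar>"
    using assms(1) unfolding definite_order_def by blast
  have "\<forall>\<^sub>F u in at 0. c * dist (fst z + u, snd z + u * v) z ^ N \<le> \<bar>p (fst z + u, snd z + u * v)\<bar>"
    using c(2) filterlim_chart by (rule eventually_compose_filterlim)
  moreover have "\<forall>\<^sub>F u::real in at 0. u \<noteq> 0" by (simp add: eventually_at_filter)
  ultimately have "\<forall>\<^sub>F u in at 0. c * norm (1::real, v) ^ N \<le> \<bar>p' (u, v)\<bar>"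
  proof eventually_elim
    case (elim u)
    then have "\<bar>u\<bar> ^ N * (c * norm (1::real, v) ^ N) \<le> \<bar>u\<bar> ^ N * \<bar>p' (u, v)\<bar>"
      by (simp add: dist_chart eq abs_mult power_abs power_mult_distrib mult_ac)
    then show ?case using elim by simp
  qed
  then have "c * norm (1::real, v) ^ N \<le> \<bar>p' (0, v)\<bar>"
    by (intro tendsto_lowerbound[OF tendsto_rabs[OF tendsto_chart[OF assms(2)]]]) auto
  moreover have "c * norm (1::real, v) ^ N > 0" using c(1) norm_1_pos by simp
  ultimately show ?thesis by auto
qed

lemma definite_order_not_zero: "definite_order m z p \<Longrightarrow> p \<noteq> (\<lambda>w. 0)"
proof
  assume "definite_order m z p" "p = (\<lambda>w. 0)"
  then have "\<forall>\<^sub>F w in at z. False" using definite_order_nonzero_near[of m z p] by simp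
  then show False by simp
qed

text \<open>Let \<open>i\<close> and \<open>j\<close> be the exact orders of the factors. Along a
  direction where neither strict transform vanishes the product has order exactly
  \<open>i + j\<close>, so \<open>m\<close> cannot be larger. Dividing the lower bound for
  \<open>p q\<close> by the upper bound for \<open>q\<close> then bounds \<open>p\<close> from below
  by a multiple of \<open>dist w z ^ i\<close>.\<close>

lemma definite_order_factor:
  assumes p: "polyfun2 p" and q: "polyfun2 q" and pq: "definite_order m z (\<lambda>w. p w * q w)"
  obtains i where "definite_order i z p"
proof -
  have nz: "p \<noteq> (\<lambda>w. 0)" "q \<noteq> (\<lambda>w. 0)" using definite_order_not_zero[OF pq] by auto
  obtain i where i: "vord_ge i z p" "\<not> vord_ge (Suc i) z p" using exists_order[OF p nz(1)] .
  obtain j where j: "vord_ge j z q" "\<not> vord_ge (Suc j) z q" using exists_order[OF q nz(2)] .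
  obtain p' where p': "polyfun2 p'" "\<And>u v. p (fst z + u, snd z + u * v) = u ^ i * p' (u, v)"
      "\<not> vord_ge (Suc i) z p \<longrightarrow> (\<exists>v. p' (0, v) \<noteq> 0)"
    by (rule blowup_chart[OF p i(1)]) (rule that)
  obtain q' where q': "polyfun2 q'" "\<And>u v. q (fst z + u, snd z + u * v) = u ^ j * q' (u, v)"
      "\<not> vord_ge (Suc j) z q \<longrightarrow> (\<exists>v. q' (0, v) \<noteq> 0)"
    by (rule blowup_chart[OF q j(1)]) (rule that)
  have poly0: "polyfun2 (\<lambda>w. p' (0, snd w))" "polyfun2 (\<lambda>w. q' (0, snd w))"
    by (rule polyfun2_compose[OF p'(1) polyfun2_const polyfun2_snd]
        polyfun2_compose[OF q'(1) polyfun2_const polyfun2_snd])+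
  \<comment> \<open>Two nonzero polynomials in \<open>v\<close> have a common point where neither
    vanishes.\<close>
  have "\<exists>v. p' (0, v) * q' (0, v) \<noteq> 0"
  proof (rule ccontr)
    assume "\<nexists>v. p' (0, v) * q' (0, v) \<noteq> 0"
    then have "(\<forall>w::pt. p' (0, snd w) = 0) \<or> (\<forall>w::pt. q' (0, snd w) = 0)"
      by (intro polyfun2_mult_eq_0 poly0) blast
    then show False using p'(3) q'(3) i(2) j(2) by auto
  qed
  then obtain v where v: "p' (0, v) * q' (0, v) \<noteq> 0" by blast
  have "m \<le> i + j"
  proof (rule ccontr)
    assume "\<not> m \<le> i + j"
    then obtain r where m: "m = i + j + Suc r" by (metis add_Suc_right less_imp_Suc_add not_le)
    obtain C where C: "C > 0" "\<forall>\<^sub>F w in nhds z. \<bar>p w * q w\<bar> \<le> C * dist w z ^ m"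
      using vord_geE[OF definite_order_imp_vord_ge[OF pq]] .
    have "\<forall>\<^sub>F u in at 0. \<bar>p (fst z + u, snd z + u * v) * q (fst z + u, snd z + u * v)\<bar>
        \<le> C * dist (fst z + u, snd z + u * v) z ^ m"
      using C(2) filterlim_chart by (rule eventually_compose_filterlim)
    moreover have "\<forall>\<^sub>F u::real in at 0. u \<noteq> 0" by (simp add: eventually_at_filter)
    ultimately have "\<forall>\<^sub>F u in at 0. \<bar>p' (u, v) * q' (u, v)\<bar> \<le> C * norm (1::real, v) ^ m * \<bar>u\<bar> ^ Suc r"
    proof eventually_elim
      case (elim u)
      then have "\<bar>u\<bar> ^ (i + j) * \<bar>p' (u, v) * q' (u, v)\<bar>
          \<le> \<bar>u\<bar> ^ (i + j) * (C * norm (1::real, v) ^ m * \<bar>u\<bar> ^ Suc r)"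
        by (simp add: dist_chart p' q' abs_mult power_abs power_mult_distrib mult_ac power_add m)
      then show ?case using elim by (simp del: power_Suc)
    qed
    moreover have "((\<lambda>u. \<bar>p' (u, v) * q' (u, v)\<bar>) \<longlongrightarrow> \<bar>p' (0, v) * q' (0, v)\<bar>) (at 0)"
      by (intro tendsto_intros tendsto_chart p' q')
    moreover have "((\<lambda>u. C * norm (1::real, v) ^ m * \<bar>u\<bar> ^ Suc r) \<longlongrightarrow> C * norm (1::real, v) ^ m * \<bar>0\<bar> ^ Suc r) (at 0)"
      by (intro tendsto_intros)
    ultimately have "\<bar>p' (0, v) * q' (0, v)\<bar> \<le> C * norm (1::real, v) ^ m * \<bar>0\<bar> ^ Suc r"
      by (intro tendsto_le) auto
    then show False using v by simp
  qed
  obtain c where c: "c > 0" "\<forall>\<^sub>F w in nhds z. c * dist w z ^ m \<le> \<bar>p w * q w\<bar>"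
    using pq unfolding definite_order_def by blast
  obtain D where D: "D > 0" "\<forall>\<^sub>F w in nhds z. \<bar>q w\<bar> \<le> D * dist w z ^ j" using vord_geE[OF j(1)] .
  \<comment> \<open>At \<open>z\<close> itself the factor \<open>dist w z ^ j\<close> may be 0 and
    cannot be cancelled; the bound there is recovered by continuity.\<close>
  have "\<forall>\<^sub>F w in nhds z. w \<noteq> z \<longrightarrow> c / D * dist w z ^ i \<le> \<bar>p w\<bar>"
    using c(2) D(2) eventually_dist_le[OF zero_less_one, of z]
  proof eventually_elim
    case (elim w)
    show ?case
    proof
      assume "w \<noteq> z"
      then have pos: "dist w z ^ j > 0" by simp
      have "c * (dist w z ^ i * dist w z ^ j) \<le> c * dist w z ^ m"
        unfolding power_add[symmetric] using elim \<open>m \<le> i + j\<close> c(1) by (intro mult_left_mono power_decreasing) auto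
      also have "\<dots> \<le> \<bar>p w\<bar> * \<bar>q w\<bar>" using elim by (simp add: abs_mult)
      also have "\<dots> \<le> \<bar>p w\<bar> * (D * dist w z ^ j)" using elim by (intro mult_left_mono) auto
      finally have "(c * dist w z ^ i) * dist w z ^ j \<le> (\<bar>p w\<bar> * D) * dist w z ^ j" by (simp add: mult_ac)
      then have "c * dist w z ^ i \<le> \<bar>p w\<bar> * D" using pos by (simp only: mult_le_cancel_right)
      then show "c / D * dist w z ^ i \<le> \<bar>p w\<bar>" using D(1) by (simp add: field_simps)
    qed
  qed
  then have at: "\<forall>\<^sub>F w in at z. c / D * dist w z ^ i \<le> \<bar>p w\<bar>"
    by (simp add: eventually_at_filter)
  moreover have "c / D * dist z z ^ i \<le> \<bar>p z\<bar>"
  proof (rule tendsto_le[OF _ _ _ at])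
    show "((\<lambda>w. \<bar>p w\<bar>) \<longlongrightarrow> \<bar>p z\<bar>) (at z)" using isCont_polyfun2[OF p] by (intro tendsto_rabs) (simp add: isCont_def)
    show "((\<lambda>w. c / D * dist w z ^ i) \<longlongrightarrow> c / D * dist z z ^ i) (at z)" by (intro tendsto_intros)
  qed simp
  ultimately have "\<forall>\<^sub>F w in nhds z. c / D * dist w z ^ i \<le> \<bar>p w\<bar>"
    by (auto simp: eventually_nhds_conv_at)
  then have "definite_order i z p" using i(1) c(1) D(1) unfolding definite_order_def by (meson divide_pos_pos)
  then show ?thesis using that by blast
qed

lemma partials_unique:
  assumes "(f has_derivative (\<lambda>(h1, h2). a * h1 + b * h2)) (at (z::pt))"
    and "(f has_derivative (\<lambda>(h1, h2). a' * h1 + b' * h2)) (at z)"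
  shows "a = (a'::real)" "b = b'"
proof -
  have "(\<lambda>(h1, h2). a * h1 + b * h2) = (\<lambda>(h1, h2). a' * h1 + b' * h2)"
    using has_derivative_unique[OF assms] .
  from fun_cong[OF this, of "(1, 0)"] fun_cong[OF this, of "(0, 1)"] show "a = a'" "b = b'" by auto
qed

text \<open>By uniqueness of the derivative \<open>p1\<close> and \<open>p2\<close> are the termwise
  derivatives of the Taylor sum, in which each differentiated exponent drops by one.\<close>

lemma vord_ge_derivative:
  assumes p: "polyfun2 p" and der: "\<And>w. (p has_derivative (\<lambda>(h1, h2). p1 w * h1 + p2 w * h2)) (at w)"
    and ge: "vord_ge (Suc N) z p"
  shows "vord_ge N z p1" "vord_ge N z p2"
proof -
  obtain n c where c: "\<And>w. p w = (\<Sum>i\<le>n. \<Sum>j\<le>n. c i j * (fst w - fst z) ^ i * (snd w - snd z) ^ j)"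
    by (rule polyfun2_taylor[OF p, of z]) blast
  have c0: "c i j = 0" if "i \<le> n" "j \<le> n" "i + j < Suc N" for i j
    using taylor_coeff_zero'[OF c ge] that by blast
  note 1 = vord_ge_fst_diff[of z] and 2 = vord_ge_snd_diff[of z]
  define q1 where "q1 = (\<lambda>w. \<Sum>i\<le>n. \<Sum>j\<le>n. (c i j * of_nat i) * (fst w - fst z) ^ (i - 1) * (snd w - snd z) ^ j)"
  define q2 where "q2 = (\<lambda>w. \<Sum>i\<le>n. \<Sum>j\<le>n. (c i j * of_nat j) * (fst w - fst z) ^ i * (snd w - snd z) ^ (j - 1))"
  have "(p has_derivative (\<lambda>(h1, h2). q1 w * h1 + q2 w * h2)) (at w)" for w
    unfolding c[abs_def] by (auto intro!: derivative_eq_intros ext simp: q1_def q2_def case_prod_unfold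
       sum_distrib_right sum_distrib_left sum.distrib algebra_simps)
  then have "p1 w = q1 w" "p2 w = q2 w" for w using partials_unique[OF der] by blast+
  then have eq: "p1 = q1" "p2 = q2" by auto
  have *: "vord_ge N z (\<lambda>w. a * (fst w - fst z) ^ i * (snd w - snd z) ^ j)" if "N \<le> i + j" for a i j
  proof -
    have "vord_ge (0 + 1 * i + 1 * j) z (\<lambda>w. a * (fst w - fst z) ^ i * (snd w - snd z) ^ j)"
      by (intro vord_ge_mult vord_ge_const vord_ge_power 1 2)
    then show ?thesis by (rule vord_ge_mono) (use that in simp)
  qed
  have "vord_ge N z (\<lambda>w. (c i j * of_nat i) * (fst w - fst z) ^ (i - 1) * (snd w - snd z) ^ j)"
      "vord_ge N z (\<lambda>w. (c i j * of_nat j) * (fst w - fst z) ^ i * (snd w - snd z) ^ (j - 1))"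
    if "i \<le> n" "j \<le> n" for i j
  proof (atomize (full), cases "i + j < Suc N")
    case True
    then show "vord_ge N z (\<lambda>w. (c i j * of_nat i) * (fst w - fst z) ^ (i - 1) * (snd w - snd z) ^ j) \<and>
      vord_ge N z (\<lambda>w. (c i j * of_nat j) * (fst w - fst z) ^ i * (snd w - snd z) ^ (j - 1))"
      using c0 that by (simp add: vord_ge_zero)
  next
    case False
    then show "vord_ge N z (\<lambda>w. (c i j * of_nat i) * (fst w - fst z) ^ (i - 1) * (snd w - snd z) ^ j) \<and>
      vord_ge N z (\<lambda>w. (c i j * of_nat j) * (fst w - fst z) ^ i * (snd w - snd z) ^ (j - 1))"
      by (intro conjI *) auto
  qed
  then show "vord_ge N z p1" "vord_ge N z p2" unfolding eq q1_def q2_def by (intro vord_ge_sum; simp)+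
qed

text \<open>The sector around the horizontal direction is the image of
  \<open>\<bar>v\<bar> \<le> 1\<close>. By compactness of this piece of the exceptional line,
  \<open>p'\<close> stays away from 0 on a neighbourhood of it.\<close>

lemma chart_lower_bound:
  assumes "polyfun2 p'" "\<And>v. p' (0, v) \<noteq> 0" and eq: "\<And>u v. p (fst z + u, snd z + u * v) = u ^ N * p' (u, v)"
  obtains c where "c > 0" "\<forall>\<^sub>F w in nhds z. \<bar>snd w - snd z\<bar> \<le> \<bar>fst w - fst z\<bar> \<longrightarrow> c * dist w z ^ N \<le> \<bar>p w\<bar>"
proof -
  define K where "K = {0::real} \<times> {-1..1::real}"
  have K: "compact K" "K \<noteq> {}" unfolding K_def by (auto intro: compact_Times)
  have cont: "continuous_on A (\<lambda>w. \<bar>p' w\<bar>)" for A by (intro continuous_on_rabs continuous_on_polyfun2 assms(1))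
  obtain k where k: "k \<in> K" "\<And>w. w \<in> K \<Longrightarrow> \<bar>p' k\<bar> \<le> \<bar>p' w\<bar>"
    using continuous_attains_inf[OF K cont] by blast
  define e where "e = \<bar>p' k\<bar>"
  have "e > 0" using k(1) assms(2) by (auto simp: e_def K_def)
  have op: "open {w. e / 2 < \<bar>p' w\<bar>}" by (intro open_Collect_less cont continuous_on_const)
  have "K \<subseteq> {w. e / 2 < \<bar>p' w\<bar>}" using k(2) \<open>e > 0\<close> unfolding e_def by fastforce
  then obtain d where d: "d > 0" "{y. infdist y K \<le> d} \<subseteq> {w. e / 2 < \<bar>p' w\<bar>}"
    using compact_in_open_separated[OF K(2,1) op] by blast
  have lb: "e / 2 < \<bar>p' (u, v)\<bar>" if "\<bar>u\<bar> \<le> d" "\<bar>v\<bar> \<le> 1" for u v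
  proof -
    have "infdist (u, v) K \<le> dist (u, v) (0, v)"
      by (rule infdist_le) (use that in \<open>auto simp: K_def\<close>)
    also have "\<dots> \<le> d" using that by (simp add: dist_Pair_Pair)
    finally show ?thesis using d(2) by auto
  qed
  have "\<forall>\<^sub>F w in nhds z. \<bar>snd w - snd z\<bar> \<le> \<bar>fst w - fst z\<bar> \<longrightarrow> (e / 2 / 2 ^ N) * dist w z ^ N \<le> \<bar>p w\<bar>"
    using eventually_dist_le[OF d(1), of z]
  proof eventually_elim
    case (elim w)
    show ?case
    proof
      assume le: "\<bar>snd w - snd z\<bar> \<le> \<bar>fst w - fst z\<bar>"
      define u where "u = fst w - fst z"
      \<comment> \<open>If \<open>u = 0\<close>, the sector condition gives \<open>w = z\<close>,
        and \<open>v = 0\<close> by the convention for division by 0, so the chart still represents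
        \<open>w\<close>.\<close>
      define v where "v = (snd w - snd z) / u"
      have w: "w = (fst z + u, snd z + u * v)" using le by (auto simp: u_def v_def prod_eq_iff)
      have "\<bar>u\<bar> \<le> d" using elim dist_fst_le[of w z] by (simp add: u_def dist_real_def)
      moreover have "\<bar>v\<bar> \<le> 1" using le by (cases "u = 0") (auto simp: v_def u_def)
      ultimately have "e / 2 < \<bar>p' (u, v)\<bar>" by (rule lb)
      have "dist w z = norm (u, snd w - snd z)"
        by (simp add: dist_norm u_def minus_prod_def)
      also have "\<dots> \<le> \<bar>u\<bar> + \<bar>snd w - snd z\<bar>" using norm_Pair_le[of u "snd w - snd z"] by simp
      finally have "dist w z \<le> 2 * \<bar>u\<bar>" using le by (simp add: u_def)
      then have "dist w z ^ N \<le> (2 * \<bar>u\<bar>) ^ N" by (intro power_mono) auto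
      then have "(e / 2 / 2 ^ N) * dist w z ^ N \<le> (e / 2 / 2 ^ N) * (2 * \<bar>u\<bar>) ^ N"
        using \<open>e > 0\<close> by (intro mult_left_mono) auto
      also have "\<dots> = \<bar>u\<bar> ^ N * (e / 2)" by (simp add: power_mult_distrib)
      also have "\<dots> \<le> \<bar>u\<bar> ^ N * \<bar>p' (u, v)\<bar>" using \<open>e / 2 < _\<close> by (intro mult_left_mono) auto
      also have "\<dots> = \<bar>p w\<bar>" by (subst w) (simp add: eq abs_mult power_abs)
      finally show "(e / 2 / 2 ^ N) * dist w z ^ N \<le> \<bar>p w\<bar>" .
    qed
  qed
  then show ?thesis using that[of "e / 2 / 2 ^ N"] \<open>e > 0\<close> by simp
qed

section \<open>Symmetry under exchange of the two coordinates\<close>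

lemma dist_swap [simp]: "dist (prod.swap w) (prod.swap z) = dist w (z :: pt)"
  by (simp add: dist_prod_def prod.swap_def add.commute)

lemma polyfun2_swap: "polyfun2 p \<Longrightarrow> polyfun2 (\<lambda>z. p (prod.swap z))"
  unfolding prod.swap_def by (rule polyfun2_flip)

lemma continuous_on_swap [continuous_intros]:
  "continuous_on A f \<Longrightarrow> continuous_on A (\<lambda>z. prod.swap (f z))"
  unfolding prod.swap_def by (intro continuous_intros)

lemma eventually_nhds_swap:
  assumes "\<forall>\<^sub>F w in nhds z. P w" shows "\<forall>\<^sub>F w in nhds (prod.swap z). P (prod.swap w :: pt)"
proof -
  obtain d where "d > 0" "\<And>w. dist w z < d \<Longrightarrow> P w" using assms unfolding eventually_nhds_metric by blast
  moreover have "dist (prod.swap w) z < d" if "dist w (prod.swap z) < d" for w :: pt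
    using that dist_swap[of "prod.swap w" z] by simp
  ultimately show ?thesis unfolding eventually_nhds_metric by blast
qed

lemma vord_ge_swap: assumes "vord_ge m z p" shows "vord_ge m (prod.swap z) (\<lambda>w. p (prod.swap w))"
proof -
  obtain C where "C > 0" "\<forall>\<^sub>F w in nhds z. \<bar>p w\<bar> \<le> C * dist w z ^ m" using vord_geE[OF assms(1)] .
  from eventually_nhds_swap[OF this(2)] have "\<forall>\<^sub>F w in nhds (prod.swap z). \<bar>p (prod.swap w)\<bar> \<le> C * dist w (prod.swap z) ^ m"
    by eventually_elim (metis dist_swap swap_swap)
  then show ?thesis by (rule vord_geI)
qed

lemma definite_order_swap: assumes "definite_order m z p" shows "definite_order m (prod.swap z) (\<lambda>w. p (prod.swap w))"
proof -
  obtain c where c: "c > 0" "\<forall>\<^sub>F w in nhds z. c * dist w z ^ m \<le> \<bar>p w\<bar>"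
    using assms(1) unfolding definite_order_def by blast
  from eventually_nhds_swap[OF this(2)] have "\<forall>\<^sub>F w in nhds (prod.swap z). c * dist w (prod.swap z) ^ m \<le> \<bar>p (prod.swap w)\<bar>"
    by eventually_elim (metis dist_swap swap_swap)
  then show ?thesis using c(1) assms vord_ge_swap unfolding definite_order_def by blast
qed

text \<open>The sectors belonging to the two charts cover a neighbourhood of \<open>z\<close>; the
  second one is the first one for the function with exchanged coordinates.\<close>

lemma definite_order_of_charts:
  assumes "polyfun2 p" "vord_ge N z p"
    "polyfun2 p'" "\<And>v. p' (0, v) \<noteq> 0" "\<And>u v. p (fst z + u, snd z + u * v) = u ^ N * p' (u, v)"
    "polyfun2 p''" "\<And>v. p'' (0, v) \<noteq> 0" "\<And>u v. p (fst z + u * v, snd z + u) = u ^ N * p'' (u, v)"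
  shows "definite_order N z p"
proof -
  obtain c1 where c1: "c1 > 0" "\<forall>\<^sub>F w in nhds z. \<bar>snd w - snd z\<bar> \<le> \<bar>fst w - fst z\<bar> \<longrightarrow> c1 * dist w z ^ N \<le> \<bar>p w\<bar>"
    using chart_lower_bound[OF assms(3-5)] by blast
  have "\<And>u v. p (prod.swap (fst (prod.swap z) + u, snd (prod.swap z) + u * v)) = u ^ N * p'' (u, v)" using assms(8) by simp
  then obtain c2 where c2: "c2 > 0" "\<forall>\<^sub>F w in nhds (prod.swap z). \<bar>snd w - snd (prod.swap z)\<bar> \<le> \<bar>fst w - fst (prod.swap z)\<bar> \<longrightarrow>
      c2 * dist w (prod.swap z) ^ N \<le> \<bar>p (prod.swap w)\<bar>"
    using chart_lower_bound[OF assms(6,7), of "\<lambda>w. p (prod.swap w)" "prod.swap z" N] by auto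
  from c1(2) eventually_nhds_swap[OF c2(2)]
  have "\<forall>\<^sub>F w in nhds z. min c1 c2 * dist w z ^ N \<le> \<bar>p w\<bar>" unfolding fst_swap snd_swap swap_swap
  proof eventually_elim
    case (elim w)
    have "min c1 c2 * dist w z ^ N \<le> c1 * dist w z ^ N" "min c1 c2 * dist w z ^ N \<le> c2 * dist w z ^ N"
      by (intro mult_right_mono; simp)+
    then show ?case using elim by (cases "\<bar>snd w - snd z\<bar> \<le> \<bar>fst w - fst z\<bar>") (auto simp: not_le)
  qed
  then show ?thesis using assms(2) c1(1) c2(1) unfolding definite_order_def by (auto intro!: exI[of _ "min c1 c2"])
qed

section \<open>Ideals of polynomial functions\<close>

text \<open>\<open>d\<close> is the primitive part of an element of minimal degree: it divides all others by
  pseudo-division and the lemma of Gauss.\<close>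
lemma ideal_min_degree:
  fixes J :: "real poly poly set"
  assumes diff: "\<And>a b. a \<in> J \<Longrightarrow> b \<in> J \<Longrightarrow> a - b \<in> J"
    and mult: "\<And>r a. a \<in> J \<Longrightarrow> r * a \<in> J" and nz: "a \<in> J" "a \<noteq> 0"
  obtains d c where "c \<noteq> 0" "smult c d \<in> J" "\<And>p. p \<in> J \<Longrightarrow> d dvd p"
proof -
  obtain m where m: "m \<in> J" "m \<noteq> 0" and min: "\<And>p. p \<in> J \<Longrightarrow> p \<noteq> 0 \<Longrightarrow> degree m \<le> degree p"
    using ex_has_least_nat[of "\<lambda>p. p \<in> J \<and> p \<noteq> 0" a degree] nz by blast
  have "primitive_part m dvd p" if p: "p \<in> J" for p
  proof -
    obtain q r where qr: "pseudo_divmod p m = (q, r)" by fastforce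
    define k where "k = coeff m (degree m) ^ (Suc (degree p) - degree m)"
    have eq: "smult k p = m * q + r" and r: "r = 0 \<or> degree r < degree m"
      using pseudo_divmod[OF m(2) qr] by (auto simp: k_def)
    have "r = [:k:] * p - q * m" using eq by (simp add: algebra_simps)
    then have "r \<in> J" using diff mult m(1) p by metis
    then have "r = 0" using r min by force
    \<comment> \<open>Passing to primitive parts reduces the multiplier \<open>k\<close> of the
      pseudo-division to a unit.\<close>
    then have "primitive_part m dvd primitive_part (smult k p)"
      using eq by (intro primitive_part_dvd_primitive_partI) auto
    also have "\<dots> = smult (unit_factor k) (primitive_part p)" by (rule primitive_part_smult)
    also have "smult (unit_factor k) (primitive_part p) dvd p"
    proof -
      have "k \<noteq> 0" using m(2) by (simp add: k_def)
      then have "is_unit (unit_factor k)" by simp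
      then obtain k' where "1 = unit_factor k * k'" by (elim dvdE)
      then have "primitive_part p = smult (unit_factor k) (primitive_part p) * [:k':]"
        by (simp add: mult.commute[of k'])
      then have "smult (unit_factor k) (primitive_part p) dvd primitive_part p" by (rule dvdI)
      also have "\<dots> dvd p" by (metis content_times_primitive_part dvd_refl dvd_smult)
      finally show ?thesis .
    qed
    finally show ?thesis .
  qed
  moreover have "smult (content m) (primitive_part m) \<in> J" "content m \<noteq> 0" using m by simp_all
  ultimately show ?thesis using that by blast
qed

section \<open>Common divisors and elimination of a variable\<close>

definition poly_ideal :: "(pt \<Rightarrow> real) set \<Rightarrow> bool" where
  "poly_ideal J \<longleftrightarrow> J \<subseteq> Collect polyfun2 \<and> (\<forall>a\<in>J. \<forall>b\<in>J. (\<lambda>z. a z + b z) \<in> J) \<and>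
    (\<forall>r a. polyfun2 r \<longrightarrow> a \<in> J \<longrightarrow> (\<lambda>z. r z * a z) \<in> J)"

definition pdvd :: "(pt \<Rightarrow> real) \<Rightarrow> (pt \<Rightarrow> real) \<Rightarrow> bool" where
  "pdvd d p \<longleftrightarrow> (\<exists>p'. polyfun2 p' \<and> p = (\<lambda>z. d z * p' z))"

lemma poly_idealD:
  assumes "poly_ideal J"
  shows "a \<in> J \<Longrightarrow> polyfun2 a" "a \<in> J \<Longrightarrow> b \<in> J \<Longrightarrow> (\<lambda>z. a z + b z) \<in> J"
    "polyfun2 r \<Longrightarrow> a \<in> J \<Longrightarrow> (\<lambda>z. r z * a z) \<in> J"
  using assms unfolding poly_ideal_def by auto

text \<open>\<open>\<phi>\<close> reads a nested polynomial with x or with y as the outer variable.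
  Accordingly the factor \<open>\<phi> [:c:]\<close> depends on y alone or on x alone.\<close>

lemma poly_ideal_ev_rep:
  assumes J: "poly_ideal J" "a \<in> J" "a \<noteq> (\<lambda>z. 0)"
    and \<phi>: "\<phi> = (\<lambda>p z. ev p (fst z) (snd z)) \<or> \<phi> = (\<lambda>p z. ev p (snd z) (fst z))"
  obtains d c where "c \<noteq> 0" "(\<lambda>z. \<phi> [:c:] z * \<phi> d z) \<in> J" "\<And>p. p \<in> J \<Longrightarrow> pdvd (\<phi> d) p"
proof -
  have poly: "polyfun2 (\<phi> p)" for p using \<phi> by auto
  have ex: "\<exists>q. p = \<phi> q" if p: "polyfun2 p" for p
  proof -
    obtain q where "p = (\<lambda>z. ev q (fst z) (snd z))" by (rule polyfun2_obtain_ev[OF p])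
    moreover obtain q' where "p = (\<lambda>z. ev q' (snd z) (fst z))" by (rule polyfun2_obtain_ev_swap[OF p])
    ultimately show ?thesis using \<phi> by blast
  qed
  have hom: "\<phi> (p - q) = (\<lambda>z. \<phi> p z + (- 1) * \<phi> q z)" "\<phi> (p * q) = (\<lambda>z. \<phi> p z * \<phi> q z)" "\<phi> 0 = (\<lambda>z. 0)"
    "\<phi> (smult c p) = (\<lambda>z. \<phi> [:c:] z * \<phi> p z)" for p q c
    using \<phi> by (auto simp: fun_eq_iff)
  define J' where "J' = {p. \<phi> p \<in> J}"
  obtain a' where a': "a = \<phi> a'" using ex J poly_idealD(1) by blast
  have a'J: "a' \<in> J'" "a' \<noteq> 0" using J a' hom by (auto simp: J'_def)
  have diff: "p - q \<in> J'" if "p \<in> J'" "q \<in> J'" for p q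
    using poly_idealD[OF J(1)] that unfolding J'_def mem_Collect_eq hom(1) by blast
  have mult: "r * p \<in> J'" if "p \<in> J'" for p r
    using poly_idealD[OF J(1)] that poly unfolding J'_def mem_Collect_eq hom(2) by blast
  obtain d c where dc: "c \<noteq> 0" "smult c d \<in> J'" "\<And>p. p \<in> J' \<Longrightarrow> d dvd p"
    by (rule ideal_min_degree[OF diff mult a'J]) (auto intro: that)
  have "pdvd (\<phi> d) p" if pJ: "p \<in> J" for p
  proof -
    obtain p' where p': "p = \<phi> p'" using ex[OF poly_idealD(1)[OF J(1) pJ]] by blast
    have "p' \<in> J'" using pJ p' by (simp add: J'_def)
    then have "d dvd p'" by (rule dc(3))
    then obtain q where "p' = d * q" by (elim dvdE)
    then have "p = (\<lambda>z. \<phi> d z * \<phi> q z)" using p' hom(2) by simp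
    then show ?thesis using poly unfolding pdvd_def by blast
  qed
  moreover have "(\<lambda>z. \<phi> [:c:] z * \<phi> d z) \<in> J" using dc(2) hom(4) by (simp add: J'_def)
  ultimately show ?thesis using that dc(1) by blast
qed

text \<open>If x^a y^b is the lexicographic leading monomial, this is a + b. It is additive on
  products and small only for constants, which is all that is required of a measure of divisors; it
  is not the total degree.\<close>

definition bideg :: "real poly poly \<Rightarrow> nat" where
  "bideg p = degree p + degree (lead_coeff p)"

lemma bideg_mult: "p \<noteq> 0 \<Longrightarrow> q \<noteq> 0 \<Longrightarrow> bideg (p * q) = bideg p + bideg q"
  unfolding bideg_def lead_coeff_mult by (simp add: degree_mult_eq)

lemma bideg_0: assumes "bideg p = 0" obtains k where "p = [:[:k:]:]"
proof -
  have "degree p = 0" "degree (lead_coeff p) = 0" using assms by (auto simp: bideg_def)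
  then show ?thesis using that by (metis degree_eq_zeroE lead_coeff_pCons(2) degree_pCons_0 coeff_pCons_0)
qed

text \<open>The ideal may be infinite, so its greatest common divisor is found as a common divisor
  of largest \<open>bideg\<close>; the values are bounded because all candidates divide
  \<open>a\<close>. A further common factor would have \<open>bideg\<close> 0.\<close>

lemma exists_max_common_divisor:
  assumes J: "poly_ideal J" "a \<in> J" "a \<noteq> (\<lambda>z. 0)"
  obtains d where "polyfun2 d" "\<And>p. p \<in> J \<Longrightarrow> pdvd d p"
    "\<forall>e. polyfun2 e \<longrightarrow> (\<forall>p\<in>J. pdvd (\<lambda>z. d z * e z) p) \<longrightarrow> (\<exists>k. k \<noteq> 0 \<and> e = (\<lambda>z. k))"
proof -
  define \<phi> :: "real poly poly \<Rightarrow> pt \<Rightarrow> real" where "\<phi> = (\<lambda>p z. ev p (fst z) (snd z))"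
  have mult: "(\<lambda>z. \<phi> p z * \<phi> q z) = \<phi> (p * q)" for p q by (simp add: \<phi>_def)
  have inj: "\<phi> p = \<phi> q \<longleftrightarrow> p = q" for p q by (simp only: \<phi>_def ev_inject)
  have ex: "\<exists>q. p = \<phi> q" if "polyfun2 p" for p
    unfolding \<phi>_def using that by (rule polyfun2_obtain_ev) blast
  obtain A where A: "a = \<phi> A" using ex J poly_idealD(1) by blast
  have "A \<noteq> 0" using J(3) by (auto simp: A \<phi>_def)
  define S where "S = {D. \<forall>p\<in>J. pdvd (\<phi> D) p}"
  have dvdA: "D dvd A" if "D \<in> S" for D
  proof -
    have "pdvd (\<phi> D) a" using that J(2) by (auto simp: S_def)
    then obtain p' where "polyfun2 p'" "a = (\<lambda>z. \<phi> D z * p' z)" unfolding pdvd_def by blast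
    then show ?thesis using ex[of p'] A mult inj by auto
  qed
  have bound: "bideg D \<le> bideg A" if D: "D \<in> S" for D
    using dvdA[OF D] \<open>A \<noteq> 0\<close> bideg_mult by (metis dvd_def le_add1 mult_eq_0_iff)
  have "1 \<in> S" using poly_idealD(1)[OF J(1)] by (auto simp: S_def pdvd_def \<phi>_def)
  then obtain D where D: "D \<in> S" "\<And>D'. D' \<in> S \<Longrightarrow> bideg D' \<le> bideg D"
    using ex_has_greatest_nat[of "\<lambda>D. D \<in> S" 1 bideg "Suc (bideg A)"] bound by (metis less_Suc_eq_le)
  have "D \<noteq> 0" using dvdA[OF D(1)] \<open>A \<noteq> 0\<close> by auto
  have max: "\<exists>k. k \<noteq> 0 \<and> e = (\<lambda>z. k)"
    if e: "polyfun2 e" "\<And>p. p \<in> J \<Longrightarrow> pdvd (\<lambda>z. \<phi> D z * e z) p" for e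
  proof -
    obtain E where E: "e = \<phi> E" using ex e by blast
    have DE: "D * E \<in> S" using e(2) by (auto simp: S_def E mult)
    then have "E \<noteq> 0" using dvdA[OF DE] \<open>A \<noteq> 0\<close> by auto
    then have "bideg E = 0" using D(2)[OF DE] bideg_mult \<open>D \<noteq> 0\<close> by simp
    then obtain k where "E = [:[:k:]:]" by (rule bideg_0)
    then show ?thesis using E \<open>E \<noteq> 0\<close> by (auto simp: \<phi>_def)
  qed
  show ?thesis
  proof (rule that[of "\<phi> D"])
    show "polyfun2 (\<phi> D)" by (simp add: \<phi>_def)
    show "pdvd (\<phi> D) p" if "p \<in> J" for p using D(1) that by (simp add: S_def)
  qed (use max in blast)
qed

text \<open>In the ideal \<open>K\<close> of all \<open>q\<close> with \<open>d q\<close> in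
  \<open>J\<close> there is an element \<open>c e\<close> with \<open>c\<close> univariate and
  \<open>e\<close> dividing all of \<open>K\<close>. Then \<open>d e\<close> divides all of
  \<open>J\<close>, and maximality of \<open>d\<close> makes \<open>e\<close> a constant. The two
  readings of nested polynomials give the two variables.\<close>

lemma univariate_multiples_in_ideal:
  assumes J: "poly_ideal J" "a \<in> J" "a \<noteq> (\<lambda>z. 0)"
  obtains d c1 c2 where "polyfun2 d" "\<And>p. p \<in> J \<Longrightarrow> pdvd d p" "c1 \<noteq> 0" "c2 \<noteq> 0"
    "(\<lambda>z. poly c1 (fst z) * d z) \<in> J" "(\<lambda>z. poly c2 (snd z) * d z) \<in> J"
proof -
  obtain d where d: "polyfun2 d" "\<And>p. p \<in> J \<Longrightarrow> pdvd d p"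
    "\<forall>e. polyfun2 e \<longrightarrow> (\<forall>p\<in>J. pdvd (\<lambda>z. d z * e z) p) \<longrightarrow> (\<exists>k. k \<noteq> 0 \<and> e = (\<lambda>z. k))"
    by (rule exists_max_common_divisor[OF J]) (rule that)
  define K where "K = {q. polyfun2 q \<and> (\<lambda>z. d z * q z) \<in> J}"
  have K: "poly_ideal K" unfolding poly_ideal_def
  proof (intro conjI ballI allI impI)
    fix a b assume "a \<in> K" "b \<in> K"
    then show "(\<lambda>z. a z + b z) \<in> K"
      using poly_idealD(2)[OF J(1), of "\<lambda>z. d z * a z" "\<lambda>z. d z * b z"] by (auto simp: K_def distrib_left)
  next
    fix r a assume "polyfun2 r" "a \<in> K"
    then show "(\<lambda>z. r z * a z) \<in> K"
      using poly_idealD(3)[OF J(1), of r "\<lambda>z. d z * a z"] by (auto simp: K_def mult_ac)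
  qed (auto simp: K_def)
  obtain a' where a': "polyfun2 a'" "a = (\<lambda>z. d z * a' z)" using d(2)[OF J(2)] by (auto simp: pdvd_def)
  then have aK: "a' \<in> K" "a' \<noteq> (\<lambda>z. 0)" using J by (auto simp: K_def)
  have main: "\<exists>c. c \<noteq> 0 \<and> (\<lambda>z. \<phi> [:c:] z * d z) \<in> J"
    if \<phi>: "\<phi> = (\<lambda>p z. ev p (fst z) (snd z)) \<or> \<phi> = (\<lambda>p z. ev p (snd z) (fst z))"
    for \<phi> :: "real poly poly \<Rightarrow> pt \<Rightarrow> real"
  proof -
    obtain e c where ec: "c \<noteq> 0" "(\<lambda>z. \<phi> [:c:] z * \<phi> e z) \<in> K" "\<And>p. p \<in> K \<Longrightarrow> pdvd (\<phi> e) p"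
      by (rule poly_ideal_ev_rep[OF K aK \<phi>]) (rule that)
    have pe: "polyfun2 (\<phi> e)" using \<phi> by auto
    have "pdvd (\<lambda>z. d z * \<phi> e z) p" if pJ: "p \<in> J" for p
    proof -
      obtain p' where p': "polyfun2 p'" "p = (\<lambda>z. d z * p' z)" using d(2)[OF pJ] by (auto simp: pdvd_def)
      then have "pdvd (\<phi> e) p'" using ec(3) pJ by (auto simp: K_def)
      then obtain p'' where p'': "polyfun2 p''" "p' = (\<lambda>z. \<phi> e z * p'' z)" unfolding pdvd_def by blast
      then have "p = (\<lambda>z. (d z * \<phi> e z) * p'' z)" using p'(2) by (simp add: mult.assoc)
      then show ?thesis using p''(1) unfolding pdvd_def by blast
    qed
    then have "\<exists>k. k \<noteq> 0 \<and> \<phi> e = (\<lambda>z. k)" using d(3)[rule_format, OF pe] by blast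
    then obtain k where k: "k \<noteq> 0" "\<phi> e = (\<lambda>z. k)" by blast
    have "(\<lambda>z. d z * (\<phi> [:c:] z * \<phi> e z)) \<in> J" using ec(2) by (simp add: K_def)
    then have "(\<lambda>z. (1 / k) * (d z * (\<phi> [:c:] z * \<phi> e z))) \<in> J"
      by (rule poly_idealD(3)[OF J(1) polyfun2_const])
    also have "(\<lambda>z. (1 / k) * (d z * (\<phi> [:c:] z * \<phi> e z))) = (\<lambda>z. \<phi> [:c:] z * d z)"
      using k by (auto simp: fun_eq_iff)
    finally show ?thesis using ec(1) by blast
  qed
  obtain c1 where c1: "c1 \<noteq> 0" "(\<lambda>z. poly c1 (fst z) * d z) \<in> J"
    using main[of "\<lambda>p z. ev p (snd z) (fst z)"] by auto
  obtain c2 where c2: "c2 \<noteq> 0" "(\<lambda>z. poly c2 (snd z) * d z) \<in> J"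
    using main[of "\<lambda>p z. ev p (fst z) (snd z)"] by auto
  show ?thesis by (rule that[of d c1 c2]) (simp_all only: d(1,2) c1 c2 not_False_eq_True)
qed

text \<open>This plays the part of resultants: the ideal generated by \<open>p\<close> and
  \<open>q\<close> has only constant common divisors, so it contains nonzero univariate polynomials
  in either variable.\<close>

lemma bezout_univariate:
  assumes p: "polyfun2 p" "p \<noteq> (\<lambda>z. 0)" and q: "polyfun2 q"
    and cop: "\<And>e. polyfun2 e \<Longrightarrow> pdvd e p \<Longrightarrow> pdvd e q \<Longrightarrow> \<exists>k. e = (\<lambda>z. k)"
  obtains c1 c2 a1 b1 a2 b2 where "c1 \<noteq> 0" "c2 \<noteq> 0" "polyfun2 a1" "polyfun2 b1" "polyfun2 a2" "polyfun2 b2"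
    "\<And>z. poly c1 (fst z) = a1 z * p z + b1 z * q z"  "\<And>z. poly c2 (snd z) = a2 z * p z + b2 z * q z"
proof -
  define J where "J = {f. \<exists>a b. polyfun2 a \<and> polyfun2 b \<and> f = (\<lambda>z. a z * p z + b z * q z)}"
  have J: "poly_ideal J" unfolding poly_ideal_def
  proof (intro conjI ballI allI impI)
    show "J \<subseteq> Collect polyfun2" unfolding J_def using p(1) q
      by (auto intro!: polyfun2_add polyfun2_mult)
    fix f g assume "f \<in> J" "g \<in> J"
    then obtain a b a' b' where "polyfun2 a" "polyfun2 b" "polyfun2 a'" "polyfun2 b'"
      "f = (\<lambda>z. a z * p z + b z * q z)" "g = (\<lambda>z. a' z * p z + b' z * q z)" by (auto simp: J_def)
    then show "(\<lambda>z. f z + g z) \<in> J" unfolding J_def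
      by (intro CollectI exI[of _ "\<lambda>z. a z + a' z"] exI[of _ "\<lambda>z. b z + b' z"]) (auto simp: algebra_simps)
  next
    fix r f assume "polyfun2 r" "f \<in> J"
    then obtain a b where "polyfun2 a" "polyfun2 b" "f = (\<lambda>z. a z * p z + b z * q z)" by (auto simp: J_def)
    with \<open>polyfun2 r\<close> show "(\<lambda>z. r z * f z) \<in> J" unfolding J_def
      by (intro CollectI exI[of _ "\<lambda>z. r z * a z"] exI[of _ "\<lambda>z. r z * b z"]) (auto simp: algebra_simps)
  qed
  have pJ: "p \<in> J" unfolding J_def
    by (intro CollectI exI[of _ "\<lambda>z. 1"] exI[of _ "\<lambda>z. 0"]) auto
  have qJ: "q \<in> J" unfolding J_def
    by (intro CollectI exI[of _ "\<lambda>z. 0"] exI[of _ "\<lambda>z. 1"]) auto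
  obtain d c1 c2 where d: "polyfun2 d" "\<And>p. p \<in> J \<Longrightarrow> pdvd d p" "c1 \<noteq> 0" "c2 \<noteq> 0"
    "(\<lambda>z. poly c1 (fst z) * d z) \<in> J" "(\<lambda>z. poly c2 (snd z) * d z) \<in> J"
    by (rule univariate_multiples_in_ideal[OF J pJ p(2)]) (rule that)
  obtain k where k: "d = (\<lambda>z. k)" using cop d(1) d(2)[OF pJ] d(2)[OF qJ] by blast
  have "k \<noteq> 0" using d(2)[OF pJ] p(2) by (auto simp: k pdvd_def)
  obtain a1 b1 where 1: "polyfun2 a1" "polyfun2 b1" "\<And>z. poly c1 (fst z) * k = a1 z * p z + b1 z * q z"
    using d(5) by (auto simp: J_def k fun_eq_iff)
  obtain a2 b2 where 2: "polyfun2 a2" "polyfun2 b2" "\<And>z. poly c2 (snd z) * k = a2 z * p z + b2 z * q z"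
    using d(6) by (auto simp: J_def k fun_eq_iff)
  show ?thesis
  proof (rule that[of "smult k c1" "smult k c2" a1 b1 a2 b2])
    show "poly (smult k c1) (fst z) = a1 z * p z + b1 z * q z" for z using 1(3)[of z] by (simp add: mult_ac)
    show "poly (smult k c2) (snd z) = a2 z * p z + b2 z * q z" for z using 2(3)[of z] by (simp add: mult_ac)
  qed (use 1 2 d \<open>k \<noteq> 0\<close> in auto)
qed

text \<open>Common zeros lie on the grid formed by the roots of the two univariate
  combinations.\<close>

lemma finite_common_zeros:
  assumes p: "polyfun2 p" "p \<noteq> (\<lambda>z. 0)" and q: "polyfun2 q"
    and cop: "\<And>e. polyfun2 e \<Longrightarrow> pdvd e p \<Longrightarrow> pdvd e q \<Longrightarrow> \<exists>k. e = (\<lambda>z. k)"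
  shows "finite {z. p z = 0 \<and> q z = 0}"
proof -
  obtain c1 c2 a1 b1 a2 b2 where c: "c1 \<noteq> 0" "c2 \<noteq> 0"
    "\<And>z. poly c1 (fst z) = a1 z * p z + b1 z * q z"  "\<And>z. poly c2 (snd z) = a2 z * p z + b2 z * q z"
    by (rule bezout_univariate[OF p q cop]) (auto intro: that)
  have "{z. p z = 0 \<and> q z = 0} \<subseteq> {x. poly c1 x = 0} \<times> {y. poly c2 y = 0}"
  proof safe
    fix x y assume "p (x, y) = 0" "q (x, y) = 0"
    then show "poly c1 x = 0" "poly c2 y = 0" using c(3)[of "(x, y)"] c(4)[of "(x, y)"] by simp_all
  qed
  moreover have "finite ({x. poly c1 x = 0} \<times> {y. poly c2 y = 0})"
    using c(1,2) by (intro finite_cartesian_product poly_roots_finite)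
  ultimately show ?thesis by (rule finite_subset)
qed

section \<open>Definite polynomials with a multiple in the ideal\<close>

lemma order_prod_linear:
  "finite Z \<Longrightarrow> (r::real) \<in> Z \<Longrightarrow> order r (\<Prod>s\<in>Z. [:- s, 1:] ^ k s) = k r"
proof (induction Z rule: finite_remove_induct)
  case (remove Z)
  have nz: "(\<Prod>s\<in>A. [:- s, 1:] ^ k s) \<noteq> 0" if "finite A" for A using that by auto
  have "poly (\<Prod>s\<in>Z - {r}. [:- s, 1:] ^ k s) r \<noteq> 0"
    using remove(1) by (auto simp: poly_prod)
  then have "order r (\<Prod>s\<in>Z - {r}. [:- s, 1:] ^ k s) = 0" by (rule order_0I)
  moreover have "(\<Prod>s\<in>Z. [:- s, 1:] ^ k s) = [:- r, 1:] ^ k r * (\<Prod>s\<in>Z - {r}. [:- s, 1:] ^ k s)"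
    using remove by (subst prod.remove[of Z r]) auto
  ultimately show ?case using nz[of "Z - {r}"] remove(1) by (simp add: order_mult order_power_n_n)
qed simp

text \<open>Equal multiplicities are needed for \<open>u1(x)\<^sup>2 + u2(y)\<^sup>2\<close> to have definite initial forms.\<close>
lemma uniform_root_multiple:
  fixes c :: "real poly"
  assumes "c \<noteq> 0"
  obtains u n where "c dvd u" "n > 0" "\<And>r. poly u r = 0 \<Longrightarrow> \<exists>e. u = [:- r, 1:] ^ n * e \<and> poly e r \<noteq> 0"
proof -
  define Z where "Z = {r. poly c r = 0}"
  have Z: "finite Z" unfolding Z_def by (rule poly_roots_finite[OF assms])
  \<comment> \<open>A number above all multiplicities of roots of \<open>c\<close>, so that the
    subtraction in the exponents of \<open>u\<close> is exact.\<close>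
  define n where "n = Suc (degree c)"
  define u where "u = (\<Prod>s\<in>Z. [:- s, 1:] ^ (n - order s c)) * c"
  have "u \<noteq> 0" using assms Z by (auto simp: u_def)
  have "\<exists>e. u = [:- r, 1:] ^ n * e \<and> poly e r \<noteq> 0" if "poly u r = 0" for r
  proof -
    have "r \<in> Z" using that Z by (auto simp: u_def Z_def poly_prod)
    have "order r u = (n - order r c) + order r c"
      using \<open>u \<noteq> 0\<close> order_prod_linear[OF Z \<open>r \<in> Z\<close>] unfolding u_def by (subst order_mult) auto
    also have "\<dots> = n" using order_degree[OF assms, of r] by (simp add: n_def)
    finally have "order r u = n" .
    then show ?thesis using order_decomp[OF \<open>u \<noteq> 0\<close>, of r] by (auto simp: dvd_iff_poly_eq_0)
  qed
  then show ?thesis using that[of u n] by (simp add: u_def n_def)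
qed

definition definite_poly :: "(pt \<Rightarrow> real) \<Rightarrow> bool" where
  "definite_poly Q \<longleftrightarrow> polyfun2 Q \<and> (\<forall>z. \<exists>m. definite_order m z Q)"

lemma polyfun2_poly: "polyfun2 (\<lambda>z. poly c (fst z))" "polyfun2 (\<lambda>z. poly c (snd z))"
  using polyfun2_ev[of "[:c:]"] by auto

text \<open>Up to nonvanishing factors this is a sum of two even powers with the same exponent
  \<open>2 M\<close>, comparable to the maximum of the two coordinate distances to the power
  \<open>2 M\<close>; that maximum is at least half the distance.\<close>

lemma definite_order_sum_powers:
  assumes a: "\<And>w. a w = (fst w - fst z) ^ M * a' w" "isCont a' z" "a' z \<noteq> 0"
    and b: "\<And>w. b w = (snd w - snd z) ^ M * b' w" "isCont b' z" "b' z \<noteq> 0"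
  shows "definite_order (2 * M) z (\<lambda>w. a w ^ 2 + b w ^ 2)"
proof -
  note 1 = vord_ge_fst_diff[of z] and 2 = vord_ge_snd_diff[of z]
  have "vord_ge M z a" unfolding a(1)[abs_def] using vord_ge_mult_isCont[OF vord_ge_power[OF 1] a(2), of M] by simp
  moreover have "vord_ge M z b" unfolding b(1)[abs_def] using vord_ge_mult_isCont[OF vord_ge_power[OF 2] b(2), of M] by simp
  ultimately have ge: "vord_ge (2 * M) z (\<lambda>w. a w ^ 2 + b w ^ 2)"
    using vord_ge_power[of M z _ 2] by (intro vord_ge_add) (simp_all add: mult.commute)
  obtain c1 where c1: "c1 > 0" "\<forall>\<^sub>F w in nhds z. c1 * dist w z ^ 0 \<le> \<bar>a' w\<bar>"
    using definite_order_0[OF a(2,3)] unfolding definite_order_def by blast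
  obtain c2 where c2: "c2 > 0" "\<forall>\<^sub>F w in nhds z. c2 * dist w z ^ 0 \<le> \<bar>b' w\<bar>"
    using definite_order_0[OF b(2,3)] unfolding definite_order_def by blast
  define c where "c = min c1 c2"
  have c: "c > 0" using c1 c2 by (simp add: c_def)
  from c1(2) c2(2) have "\<forall>\<^sub>F w in nhds z. c ^ 2 / 2 ^ (2 * M) * dist w z ^ (2 * M) \<le> \<bar>a w ^ 2 + b w ^ 2\<bar>"
  proof eventually_elim
    case (elim w)
    have sq: "c ^ 2 * (t ^ (2 * M)) \<le> (t ^ M * s) ^ 2" if "c \<le> \<bar>s\<bar>" for t s :: real
    proof -
      have "c ^ 2 \<le> s ^ 2" using that c by (metis abs_le_square_iff abs_of_pos)
      then have "(t ^ M) ^ 2 * c ^ 2 \<le> (t ^ M) ^ 2 * s ^ 2" by (intro mult_left_mono) auto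
      then show ?thesis by (simp add: power_mult_distrib power_mult[symmetric] mult_ac)
    qed
    define X where "X = max \<bar>fst w - fst z\<bar> \<bar>snd w - snd z\<bar>"
    have "dist w z = norm (fst w - fst z, snd w - snd z)" by (simp add: dist_norm minus_prod_def)
    also have "\<dots> \<le> \<bar>fst w - fst z\<bar> + \<bar>snd w - snd z\<bar>" using norm_Pair_le[of "fst w - fst z" "snd w - snd z"] by simp
    also have "\<dots> \<le> 2 * X" by (auto simp: X_def max_def)
    finally have "dist w z ^ (2 * M) \<le> (2 * X) ^ (2 * M)" by (intro power_mono) auto
    then have "c ^ 2 / 2 ^ (2 * M) * dist w z ^ (2 * M) \<le> c ^ 2 / 2 ^ (2 * M) * (2 * X) ^ (2 * M)"
      by (intro mult_left_mono) auto
    also have "\<dots> = c ^ 2 * X ^ (2 * M)" by (simp add: power_mult_distrib)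
    also have "\<dots> \<le> a w ^ 2 + b w ^ 2"
    proof -
      have A: "c ^ 2 * (fst w - fst z) ^ (2 * M) \<le> a w ^ 2"
        unfolding a(1) using elim by (intro sq) (auto simp: c_def)
      have B: "c ^ 2 * (snd w - snd z) ^ (2 * M) \<le> b w ^ 2"
        unfolding b(1) using elim by (intro sq) (auto simp: c_def)
      have "X ^ (2 * M) = (fst w - fst z) ^ (2 * M) \<or> X ^ (2 * M) = (snd w - snd z) ^ (2 * M)"
        by (auto simp: X_def max_def power_even_abs)
      then show ?thesis
      proof
        assume "X ^ (2 * M) = (fst w - fst z) ^ (2 * M)"
        then show ?thesis using A by (smt (verit) zero_le_power2)
      next
        assume "X ^ (2 * M) = (snd w - snd z) ^ (2 * M)"
        then show ?thesis using B by (smt (verit) zero_le_power2)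
      qed
    qed
    also have "\<dots> \<le> \<bar>a w ^ 2 + b w ^ 2\<bar>" by simp
    finally show ?case .
  qed
  then show ?thesis using ge c unfolding definite_order_def by (auto intro!: exI[of _ "c ^ 2 / 2 ^ (2 * M)"])
qed

text \<open>A univariate multiplier vanishes along whole lines. The sum of the squares of one in x
  and one in y vanishes only at grid points, and equal exponents make it definite there.\<close>

lemma ideal_definite_multiple:
  assumes J: "poly_ideal J" "a \<in> J" "a \<noteq> (\<lambda>z. 0)"
  obtains d D where "polyfun2 d" "\<And>p. p \<in> J \<Longrightarrow> pdvd d p" "definite_poly D" "(\<lambda>z. d z * D z) \<in> J"
proof -
  obtain d c1 c2 where d: "polyfun2 d" "\<And>p. p \<in> J \<Longrightarrow> pdvd d p" "c1 \<noteq> 0" "c2 \<noteq> 0"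
    "(\<lambda>z. poly c1 (fst z) * d z) \<in> J" "(\<lambda>z. poly c2 (snd z) * d z) \<in> J"
    by (rule univariate_multiples_in_ideal[OF J]) (rule that)
  obtain u1 n1 where u1: "c1 dvd u1" "n1 > 0" "\<And>r. poly u1 r = 0 \<Longrightarrow> \<exists>e. u1 = [:- r, 1:] ^ n1 * e \<and> poly e r \<noteq> 0"
    using uniform_root_multiple[OF d(3)] by blast
  obtain u2 n2 where u2: "c2 dvd u2" "n2 > 0" "\<And>r. poly u2 r = 0 \<Longrightarrow> \<exists>e. u2 = [:- r, 1:] ^ n2 * e \<and> poly e r \<noteq> 0"
    using uniform_root_multiple[OF d(4)] by blast
  obtain k1 where k1: "u1 = c1 * k1" using u1(1) by (elim dvdE)
  obtain k2 where k2: "u2 = c2 * k2" using u2(1) by (elim dvdE)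
  \<comment> \<open>The exponents are crossed: a root of multiplicity \<open>n1\<close> raised to
    \<open>n2\<close> and one of multiplicity \<open>n2\<close> raised to \<open>n1\<close> both get
    multiplicity \<open>n1 * n2\<close>.\<close>
  define \<alpha> where "\<alpha> = (\<lambda>z::pt. poly u1 (fst z) ^ n2)"
  define \<beta> where "\<beta> = (\<lambda>z::pt. poly u2 (snd z) ^ n1)"
  define D where "D = (\<lambda>z. \<alpha> z ^ 2 + \<beta> z ^ 2)"
  have poly: "polyfun2 \<alpha>" "polyfun2 \<beta>" "polyfun2 D"
    unfolding D_def \<alpha>_def \<beta>_def by (intro polyfun2_add polyfun2_power polyfun2_poly)+
  have "\<exists>m. definite_order m z D" for z
  proof (cases "D z = 0")
    case True
    then have 0: "\<alpha> z = 0" "\<beta> z = 0" by (auto simp: D_def sum_power2_eq_zero_iff)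
    then have "poly u1 (fst z) = 0" "poly u2 (snd z) = 0" by (auto simp: \<alpha>_def \<beta>_def)
    with u1(3) u2(3) obtain e1 e2 where e1: "u1 = [:- fst z, 1:] ^ n1 * e1" "poly e1 (fst z) \<noteq> 0"
      and e2: "u2 = [:- snd z, 1:] ^ n2 * e2" "poly e2 (snd z) \<noteq> 0" by blast
    have "definite_order (2 * (n1 * n2)) z (\<lambda>w. \<alpha> w ^ 2 + \<beta> w ^ 2)"
    proof (rule definite_order_sum_powers)
      show "\<alpha> w = (fst w - fst z) ^ (n1 * n2) * (poly e1 (fst w) ^ n2)" for w
        by (simp add: \<alpha>_def e1 poly_power power_mult_distrib power_mult)
      show "\<beta> w = (snd w - snd z) ^ (n1 * n2) * (poly e2 (snd w) ^ n1)" for w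
        by (simp add: \<beta>_def e2 poly_power power_mult_distrib power_mult mult.commute[of n1])
    qed (use e1 e2 in \<open>auto intro!: isCont_polyfun2 polyfun2_power polyfun2_poly\<close>)
    then show ?thesis unfolding D_def by blast
  qed (use definite_order_0 isCont_polyfun2 poly in blast)
  then have def: "definite_poly D" using poly by (simp add: definite_poly_def)
  have "(\<lambda>z. d z * D z) \<in> J"
  proof -
    \<comment> \<open>The cofactors of \<open>c1\<close> and \<open>c2\<close> in the two squares:
      one factor \<open>u1\<close>, respectively \<open>u2\<close>, is split off, which is possible
      as \<open>n1\<close> and \<open>n2\<close> are positive.\<close>
    define A where "A = (\<lambda>z. poly k1 (fst z) * (poly u1 (fst z) ^ (n2 - 1) * \<alpha> z))"
    define B where "B = (\<lambda>z. poly k2 (snd z) * (poly u2 (snd z) ^ (n1 - 1) * \<beta> z))"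
    have "\<alpha> z ^ 2 = A z * poly c1 (fst z)" for z
      using u2(2) by (cases n2) (auto simp: A_def \<alpha>_def k1 power2_eq_square)
    moreover have "\<beta> z ^ 2 = B z * poly c2 (snd z)" for z
      using u1(2) by (cases n1) (auto simp: B_def \<beta>_def k2 power2_eq_square)
    ultimately have "(\<lambda>z. d z * D z) = (\<lambda>z. A z * (poly c1 (fst z) * d z) + B z * (poly c2 (snd z) * d z))"
      by (auto simp: D_def algebra_simps)
    moreover have "polyfun2 A" "polyfun2 B"
      unfolding A_def B_def by (intro polyfun2_mult polyfun2_power polyfun2_poly poly)+
    ultimately show ?thesis
      using poly_idealD(2)[OF J(1) poly_idealD(3)[OF J(1) _ d(5)] poly_idealD(3)[OF J(1) _ d(6)], of A B] by simp
  qed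
  then show ?thesis by (rule that[of d D, rotated -1]) (simp_all only: d(1,2) def)
qed

section \<open>Definite zeros of a polynomial\<close>

lemma DERIV_ev: "((\<lambda>x. ev p x y) has_field_derivative ev (pderiv p) x y) (at x)"
  by (induction p) (auto intro!: derivative_eq_intros simp: pderiv_pCons)

text \<open>A definite zero cannot have order 1, since a nonzero linear form vanishes along a line.\<close>
lemma definite_zero_critical:
  assumes p: "definite_order m z (\<lambda>z. ev p (fst z) (snd z))" and z0: "ev p (fst z) (snd z) = 0"
  shows "ev (pderiv p) (fst z) (snd z) = 0"
proof -
  define f where "f = (\<lambda>z::pt. ev p (fst z) (snd z))"
  have f: "polyfun2 f" by (simp add: f_def)
  have def: "definite_order m z f" using p by (simp add: f_def)
  obtain p1 p2 where der: "polyfun2 p1" "polyfun2 p2"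
    "\<And>z. (f has_derivative (\<lambda>(h1, h2). p1 z * h1 + p2 z * h2)) (at z)"
    by (rule has_derivative_polyfun2[OF f]) (rule that)
  obtain c where c: "c > 0" "\<forall>\<^sub>F w in nhds z. c * dist w z ^ m \<le> \<bar>f w\<bar>"
    using def unfolding definite_order_def by blast
  have "f z = 0" using z0 by (simp add: f_def)
  then have "m \<noteq> 0" using eventually_nhds_x_imp_x[OF c(2)] c(1) by (intro notI) simp
  moreover have "m \<noteq> 1"
  proof
    assume m: "m = 1"
    \<comment> \<open>A direction in the kernel of the differential. Along it \<open>f\<close> is of
      smaller growth than the distance to \<open>z\<close>, whereas definiteness of order 1 would
      require at least \<open>c\<close> times this distance.\<close>
    obtain h1 h2 where h: "(h1, h2) \<noteq> (0, 0)" "p1 z * h1 + p2 z * h2 = 0"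
    proof (cases "p1 z = 0 \<and> p2 z = 0")
      case True then show ?thesis using that[of 1 0] by simp
    next
      case False then show ?thesis using that[of "p2 z" "- p1 z"] by auto
    qed
    define l where "l = (\<lambda>t::real. z + t *\<^sub>R (h1, h2))"
    have nh: "norm (h1, h2) > 0" using h(1) by (simp add: zero_prod_def)
    have dl: "dist (l t) z = \<bar>t\<bar> * norm (h1, h2)" for t
      by (simp only: l_def dist_norm add_diff_cancel_left' norm_scaleR)
    have "(l \<longlongrightarrow> z + 0 *\<^sub>R (h1, h2)) (at 0)" unfolding l_def by (intro tendsto_intros)
    then have lim: "filterlim l (nhds z) (at 0)" by (simp add: zero_prod_def[symmetric])
    have "\<forall>\<^sub>F w in nhds z. norm (f w - f z - (\<lambda>(h1, h2). p1 z * h1 + p2 z * h2) (w - z)) \<le> c / 2 * norm (w - z)"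
    proof -
      have "\<exists>d>0. \<forall>y. norm (y - z) < d \<longrightarrow>
         norm (f y - f z - (\<lambda>(h1, h2). p1 z * h1 + p2 z * h2) (y - z)) \<le> c / 2 * norm (y - z)"
        using der(3)[of z] c(1) unfolding has_derivative_at_alt by (meson half_gt_zero)
      then show ?thesis unfolding eventually_nhds_metric dist_norm by blast
    qed
    from eventually_compose_filterlim[OF this lim] eventually_compose_filterlim[OF c(2) lim]
    have "\<forall>\<^sub>F t::real in at 0. t = 0"
    proof eventually_elim
      case (elim t)
      have "l t - z = (t * h1, t * h2)" by (simp add: l_def)
      then have "(\<lambda>(h1, h2). p1 z * h1 + p2 z * h2) (l t - z) = t * (p1 z * h1 + p2 z * h2)"
        by (simp add: algebra_simps)
      then have "(\<lambda>(h1, h2). p1 z * h1 + p2 z * h2) (l t - z) = 0" using h(2) by simp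
      then have "\<bar>f (l t)\<bar> \<le> c / 2 * dist (l t) z" using elim(1) \<open>f z = 0\<close> by (simp add: dist_norm)
      with elim(2) have "c * dist (l t) z \<le> c / 2 * dist (l t) z" by (simp add: m)
      then have "dist (l t) z \<le> 0" using c(1) by (simp add: mult_le_cancel_right)
      then show "t = 0" using nh by (simp add: dl mult_le_0_iff)
    qed
    moreover have "\<forall>\<^sub>F t::real in at 0. t \<noteq> 0" by (simp add: eventually_at_filter)
    ultimately have "\<forall>\<^sub>F t::real in at 0. False" by eventually_elim simp
    then show False by simp
  qed
  ultimately have "vord_ge (Suc 1) z f" using vord_ge_mono[OF definite_order_imp_vord_ge[OF def]] by simp
  then have "vord_ge 1 z p1" by (rule vord_ge_derivative(1)[OF f der(3)])
  then have "p1 z = 0" by (rule vord_ge_1_imp_zero) simp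
  \<comment> \<open>Restriction to the horizontal line through \<open>z\<close> identifies
    \<open>p1 z\<close> with the value of the formal derivative \<open>pderiv p\<close>.\<close>
  have "((\<lambda>x. f (x, snd z)) has_derivative (\<lambda>h. (\<lambda>(h1, h2). p1 z * h1 + p2 z * h2) (h, 0))) (at (fst z))"
  proof (rule has_derivative_compose[where f = "\<lambda>x. (x, snd z)" and f' = "\<lambda>h. (h, 0)"])
    show "((\<lambda>x. (x, snd z)) has_derivative (\<lambda>h. (h, 0))) (at (fst z))"
      by (intro has_derivative_Pair has_derivative_ident has_derivative_const)
    show "(f has_derivative (\<lambda>(h1, h2). p1 z * h1 + p2 z * h2)) (at (fst z, snd z))" using der(3)[of z] by simp
  qed
  then have "((\<lambda>x. ev p x (snd z)) has_derivative (\<lambda>h. 0)) (at (fst z))" using \<open>p1 z = 0\<close> by (simp add: f_def)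
  moreover have "((\<lambda>x. ev p x (snd z)) has_derivative (\<lambda>h. ev (pderiv p) (fst z) (snd z) * h)) (at (fst z))"
    using DERIV_ev by (simp add: has_field_derivative_def)
  ultimately have "(\<lambda>h. 0) = (\<lambda>h. ev (pderiv p) (fst z) (snd z) * h)" by (rule has_derivative_unique)
  from fun_cong[OF this, of 1] show ?thesis by simp
qed

lemma pdvd_ev_iff: "pdvd (\<lambda>z. ev p (fst z) (snd z)) (\<lambda>z. ev q (fst z) (snd z)) \<longleftrightarrow> p dvd q"
proof
  assume "pdvd (\<lambda>z. ev p (fst z) (snd z)) (\<lambda>z. ev q (fst z) (snd z))"
  then obtain r where r: "polyfun2 r" "(\<lambda>z. ev q (fst z) (snd z)) = (\<lambda>z. ev p (fst z) (snd z) * r z)"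
    unfolding pdvd_def by blast
  obtain r' where "r = (\<lambda>z. ev r' (fst z) (snd z))" using r(1) by (rule polyfun2_obtain_ev)
  with r(2) have "(\<lambda>z. ev q (fst z) (snd z)) = (\<lambda>z. ev (p * r') (fst z) (snd z))" by simp
  then show "p dvd q" by (simp only: ev_inject dvd_triv_left)
next
  assume "p dvd q"
  then obtain r where "q = p * r" by (elim dvdE)
  then show "pdvd (\<lambda>z. ev p (fst z) (snd z)) (\<lambda>z. ev q (fst z) (snd z))"
    unfolding pdvd_def by (intro exI[of _ "\<lambda>z. ev r (fst z) (snd z)"]) simp
qed

lemma is_unit_ev_const:
  assumes "is_unit p" shows "\<exists>k. k \<noteq> 0 \<and> (\<lambda>z::pt. ev p (fst z) (snd z)) = (\<lambda>z. k)"
proof -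
  obtain c where c: "p = [:c:]" "is_unit c" using assms by (auto simp: is_unit_poly_iff)
  then obtain k where "c = [:k:]" "k \<noteq> 0" by (auto simp: is_unit_poly_iff dvd_field_iff)
  then show ?thesis using c by auto
qed

lemma finite_definite_zeros_prime:
  assumes "prime_elem p"
  shows "finite {z. ev p (fst z) (snd z) = 0 \<and> (\<exists>m. definite_order m z (\<lambda>z. ev p (fst z) (snd z)))}"
proof (cases "degree p = 0")
  \<comment> \<open>Here \<open>pderiv p\<close> is 0 and gives no information. But \<open>p\<close>
    depends on y alone and vanishes on the whole horizontal line through each of its zeros, whereas
    definite zeros are isolated.\<close>
  case True
  then obtain r where r: "p = [:r:]" by (rule degree_eq_zeroE)
  have "\<not> definite_order m z (\<lambda>z. ev p (fst z) (snd z))" if z: "ev p (fst z) (snd z) = 0" for m z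
  proof
    assume "definite_order m z (\<lambda>z. ev p (fst z) (snd z))"
    then have "\<forall>\<^sub>F w in at z. poly r (snd w) \<noteq> 0" using definite_order_nonzero_near r by fastforce
    then have ev: "\<forall>\<^sub>F w in nhds z. w \<noteq> z \<longrightarrow> poly r (snd w) \<noteq> 0" by (simp add: eventually_at_filter)
    have "((\<lambda>t. (fst z + t, snd z)) \<longlongrightarrow> (fst z + 0, snd z)) (at (0::real))" by (intro tendsto_intros)
    then have "filterlim (\<lambda>t. (fst z + t, snd z)) (nhds z) (at (0::real))" by simp
    from eventually_compose_filterlim[OF ev this]
    have "\<forall>\<^sub>F t::real in at 0. t = 0"
      by eventually_elim (use z r in \<open>auto simp: prod_eq_iff\<close>)
    moreover have "\<forall>\<^sub>F t::real in at 0. t \<noteq> 0" by (simp add: eventually_at_filter)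
    ultimately have "\<forall>\<^sub>F t::real in at 0. False" by eventually_elim simp
    then show False by simp
  qed
  then have empty: "{z. ev p (fst z) (snd z) = 0 \<and> (\<exists>m. definite_order m z (\<lambda>z. ev p (fst z) (snd z)))} = {}" by blast
  show ?thesis unfolding empty by (rule finite.emptyI)
next
  case False
  have "p \<noteq> 0" using assms by auto
  \<comment> \<open>As \<open>p\<close> is prime and of positive degree in x, its derivative has
    smaller degree and is not a multiple of it; hence the two have no common divisors but
    constants.\<close>
  have pd: "\<not> p dvd pderiv p"
  proof
    assume "p dvd pderiv p"
    moreover have "pderiv p \<noteq> 0" using False by (simp add: pderiv_eq_0_iff)
    ultimately have "degree p \<le> degree (pderiv p)" by (rule dvd_imp_degree_le)
    then show False using False by (simp add: degree_pderiv)
  qed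
  have "finite {z::pt. ev p (fst z) (snd z) = 0 \<and> ev (pderiv p) (fst z) (snd z) = 0}"
  proof (rule finite_common_zeros)
    show "(\<lambda>z::pt. ev p (fst z) (snd z)) \<noteq> (\<lambda>z. 0)"
      using \<open>p \<noteq> 0\<close> ev_inject(1)[of p 0] by simp
    fix e assume e: "polyfun2 e" "pdvd e (\<lambda>z. ev p (fst z) (snd z))" "pdvd e (\<lambda>z. ev (pderiv p) (fst z) (snd z))"
    obtain E where E: "e = (\<lambda>z. ev E (fst z) (snd z))" using e(1) by (rule polyfun2_obtain_ev)
    have "E dvd p" "E dvd pderiv p" using e(2,3) unfolding E pdvd_ev_iff by auto
    then obtain F where F: "p = E * F" by (elim dvdE)
    then have "is_unit E \<or> is_unit F"
      using prime_elem_imp_irreducible[OF assms] irreducibleD by blast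
    moreover have "\<not> is_unit F"
    proof
      assume "is_unit F"
      then have "p dvd E" using F by (simp add: mult_unit_dvd_iff)
      then show False using \<open>E dvd pderiv p\<close> pd dvd_trans by blast
    qed
    ultimately show "\<exists>k. e = (\<lambda>z. k)" using is_unit_ev_const E by blast
  qed auto
  moreover have "{z. ev p (fst z) (snd z) = 0 \<and> (\<exists>m. definite_order m z (\<lambda>z. ev p (fst z) (snd z)))} \<subseteq>
    {z. ev p (fst z) (snd z) = 0 \<and> ev (pderiv p) (fst z) (snd z) = 0}"
    using definite_zero_critical by blast
  ultimately show ?thesis using finite_subset by blast
qed

lemma finite_definite_zeros:
  assumes "polyfun2 d" "d \<noteq> (\<lambda>z. 0)"
  shows "finite {z. d z = 0 \<and> (\<exists>m. definite_order m z d)}"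
proof -
  let ?Z = "\<lambda>p. {z. ev p (fst z) (snd z) = 0 \<and> (\<exists>m. definite_order m z (\<lambda>z. ev p (fst z) (snd z)))}"
  obtain p where p: "d = (\<lambda>z. ev p (fst z) (snd z))" using assms(1) by (rule polyfun2_obtain_ev)
  have "p \<noteq> 0" using assms(2) p by auto
  then have "finite (?Z p)"
  proof (induction p rule: prime_divisors_induct)
    case (unit p)
    then obtain k where "k \<noteq> 0" "(\<lambda>z::pt. ev p (fst z) (snd z)) = (\<lambda>z. k)" using is_unit_ev_const by blast
    then have empty: "?Z p = {}" by (auto simp: fun_eq_iff)
    show ?case unfolding empty by (rule finite.emptyI)
  next
    case (factor q p)
    then have "p \<noteq> 0" by auto
    \<comment> \<open>At a definite zero of the product both factors are definite, and at least one
      of them vanishes.\<close>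
    have sub: "?Z (q * p) \<subseteq> ?Z q \<union> ?Z p"
    proof
      fix z assume "z \<in> ?Z (q * p)"
      then obtain m where m: "definite_order m z (\<lambda>z. ev q (fst z) (snd z) * ev p (fst z) (snd z))"
        and 0: "ev q (fst z) (snd z) = 0 \<or> ev p (fst z) (snd z) = 0" by auto
      have m': "definite_order m z (\<lambda>z. ev p (fst z) (snd z) * ev q (fst z) (snd z))"
        using m by (simp add: mult.commute)
      obtain i where "definite_order i z (\<lambda>z. ev q (fst z) (snd z))"
        by (rule definite_order_factor[OF polyfun2_ev(1) polyfun2_ev(1) m])
      moreover obtain j where "definite_order j z (\<lambda>z. ev p (fst z) (snd z))"
        by (rule definite_order_factor[OF polyfun2_ev(1) polyfun2_ev(1) m'])
      ultimately show "z \<in> ?Z q \<union> ?Z p" using 0 by blast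
    qed
    have "finite (?Z q \<union> ?Z p)"
      using finite_definite_zeros_prime[of q] factor \<open>p \<noteq> 0\<close> by (simp add: prime_def)
    with sub show ?case by (rule finite_subset)
  qed simp
  then show ?thesis by (simp add: p)
qed

lemma definite_poly_finite_zeros: "definite_poly Q \<Longrightarrow> finite {z. Q z = 0}"
proof -
  assume Q: "definite_poly Q"
  then have "Q \<noteq> (\<lambda>z. 0)" using definite_order_not_zero unfolding definite_poly_def by blast
  then have "finite {z. Q z = 0 \<and> (\<exists>m. definite_order m z Q)}"
    using Q by (intro finite_definite_zeros) (auto simp: definite_poly_def)
  moreover have "{z. Q z = 0 \<and> (\<exists>m. definite_order m z Q)} = {z. Q z = 0}" using Q by (auto simp: definite_poly_def)
  ultimately show ?thesis by simp
qed

section \<open>Local differentiability classes\<close>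

text \<open>The recursion of \<open>Ck\<close>, localised. Derivatives are taken in the full
  neighbourhood filter, so this is the intended notion for open \<open>U\<close>.\<close>

fun CkOn :: "nat \<Rightarrow> pt set \<Rightarrow> (pt \<Rightarrow> real) \<Rightarrow> bool" where
  "CkOn 0 U f = continuous_on U f"
| "CkOn (Suc n) U f = (\<exists>g1 g2. (\<forall>z\<in>U. (f has_derivative (\<lambda>(h1, h2). g1 z * h1 + g2 z * h2)) (at z))
                          \<and> CkOn n U g1 \<and> CkOn n U g2)"

lemma CkOn_UNIV: "CkOn k UNIV f \<longleftrightarrow> Ck k f"
  by (induction k arbitrary: f) auto

lemma CkOn_subset: "CkOn k U f \<Longrightarrow> V \<subseteq> U \<Longrightarrow> CkOn k V f"
proof (induction k arbitrary: f)
  case 0 then show ?case by (auto intro: continuous_on_subset)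
next
  case (Suc k)
  then obtain g1 g2 where "\<forall>z\<in>U. (f has_derivative (\<lambda>(h1, h2). g1 z * h1 + g2 z * h2)) (at z)"
    "CkOn k U g1" "CkOn k U g2" by auto
  then show ?case using Suc.IH Suc.prems(2) unfolding CkOn.simps by (intro exI[of _ g1] exI[of _ g2]) auto
qed

lemma CkOn_cong:
  assumes "CkOn k U f" "open U" "\<And>z. z \<in> U \<Longrightarrow> f z = g z" shows "CkOn k U g"
proof (cases k)
  case 0 then show ?thesis using assms continuous_on_cong[of U U f g] by auto
next
  case (Suc n)
  then obtain g1 g2 where g: "\<forall>z\<in>U. (f has_derivative (\<lambda>(h1, h2). g1 z * h1 + g2 z * h2)) (at z)"
    "CkOn n U g1" "CkOn n U g2" using assms(1) by auto
  have "(g has_derivative (\<lambda>(h1, h2). g1 z * h1 + g2 z * h2)) (at z)" if "z \<in> U" for z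
    by (rule has_derivative_transform_within_open[OF g(1)[rule_format, OF that] assms(2) that assms(3)])
  then show ?thesis using g(2,3) Suc unfolding Suc CkOn.simps by blast
qed

lemma CkOn_imp_continuous: "CkOn k U f \<Longrightarrow> continuous_on U f"
proof (cases k)
  case (Suc n)
  assume "CkOn k U f"
  then obtain g1 g2 where "\<forall>z\<in>U. (f has_derivative (\<lambda>(h1, h2). g1 z * h1 + g2 z * h2)) (at z)"
    unfolding Suc CkOn.simps by blast
  then have "isCont f z" if "z \<in> U" for z using has_derivative_continuous that by blast
  then show ?thesis by (simp add: continuous_at_imp_continuous_on)
qed simp

lemma CkOn_Suc_imp: "CkOn (Suc k) U f \<Longrightarrow> CkOn k U f"
proof (induction k arbitrary: f)
  case 0 then show ?case unfolding CkOn.simps(1) by (rule CkOn_imp_continuous)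
next
  case (Suc k)
  then obtain g1 g2 where "\<forall>z\<in>U. (f has_derivative (\<lambda>(h1, h2). g1 z * h1 + g2 z * h2)) (at z)"
    "CkOn (Suc k) U g1" "CkOn (Suc k) U g2" unfolding CkOn.simps(2)[of "Suc k"] by blast
  then show ?case unfolding CkOn.simps(2)[of k]
    by (intro exI[of _ g1] exI[of _ g2] conjI Suc.IH) auto
qed

lemma CkOn_polyfun2: "polyfun2 p \<Longrightarrow> CkOn k U p"
proof (induction k arbitrary: p)
  case 0 then show ?case by (simp add: continuous_on_polyfun2)
next
  case (Suc k)
  obtain p1 p2 where "polyfun2 p1" "polyfun2 p2"
    "\<And>z. (p has_derivative (\<lambda>(h1, h2). p1 z * h1 + p2 z * h2)) (at z)"
    by (rule has_derivative_polyfun2[OF Suc.prems]) (rule that)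
  then show ?case unfolding CkOn.simps using Suc.IH by (intro exI[of _ p1] exI[of _ p2]) auto
qed

lemma CkOn_add: "CkOn k U f \<Longrightarrow> CkOn k U g \<Longrightarrow> CkOn k U (\<lambda>z. f z + g z)"
proof (induction k arbitrary: f g)
  case 0 then show ?case by (auto intro: continuous_intros)
next
  case (Suc k)
  obtain f1 f2 where f: "\<And>z. z \<in> U \<Longrightarrow> (f has_derivative (\<lambda>(h1, h2). f1 z * h1 + f2 z * h2)) (at z)"
    "CkOn k U f1" "CkOn k U f2" using Suc.prems(1) unfolding CkOn.simps by blast
  obtain g1 g2 where g: "\<And>z. z \<in> U \<Longrightarrow> (g has_derivative (\<lambda>(h1, h2). g1 z * h1 + g2 z * h2)) (at z)"
    "CkOn k U g1" "CkOn k U g2" using Suc.prems(2) unfolding CkOn.simps by blast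
  have "((\<lambda>z. f z + g z) has_derivative (\<lambda>(h1, h2). (f1 z + g1 z) * h1 + (f2 z + g2 z) * h2)) (at z)" if "z \<in> U" for z
    by (rule has_derivative_eq_rhs[OF has_derivative_add[OF f(1)[OF that] g(1)[OF that]]]) (auto simp: algebra_simps)
  then show ?case using Suc.IH[OF f(2) g(2)] Suc.IH[OF f(3) g(3)] unfolding CkOn.simps
    by (intro exI[of _ "\<lambda>z. f1 z + g1 z"] exI[of _ "\<lambda>z. f2 z + g2 z"]) auto
qed

lemma CkOn_mult: "CkOn k U f \<Longrightarrow> CkOn k U g \<Longrightarrow> CkOn k U (\<lambda>z. f z * g z)"
proof (induction k arbitrary: f g)
  case 0 then show ?case by (auto intro: continuous_intros)
next
  case (Suc k)
  obtain f1 f2 where f: "\<And>z. z \<in> U \<Longrightarrow> (f has_derivative (\<lambda>(h1, h2). f1 z * h1 + f2 z * h2)) (at z)"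
    "CkOn k U f1" "CkOn k U f2" using Suc.prems(1) unfolding CkOn.simps by blast
  obtain g1 g2 where g: "\<And>z. z \<in> U \<Longrightarrow> (g has_derivative (\<lambda>(h1, h2). g1 z * h1 + g2 z * h2)) (at z)"
    "CkOn k U g1" "CkOn k U g2" using Suc.prems(2) unfolding CkOn.simps by blast
  note f0 = CkOn_Suc_imp[OF Suc.prems(1)] and g0 = CkOn_Suc_imp[OF Suc.prems(2)]
  have "((\<lambda>z. f z * g z) has_derivative
      (\<lambda>(h1, h2). (f z * g1 z + f1 z * g z) * h1 + (f z * g2 z + f2 z * g z) * h2)) (at z)" if "z \<in> U" for z
    by (rule has_derivative_eq_rhs[OF has_derivative_mult[OF f(1)[OF that] g(1)[OF that]]]) (auto simp: algebra_simps)
  moreover have "CkOn k U (\<lambda>z. f z * g1 z + f1 z * g z)" "CkOn k U (\<lambda>z. f z * g2 z + f2 z * g z)"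
    by (intro CkOn_add Suc.IH f0 g0 f(2,3) g(2,3))+
  ultimately show ?case unfolding CkOn.simps
    by (intro exI[of _ "\<lambda>z. f z * g1 z + f1 z * g z"] exI[of _ "\<lambda>z. f z * g2 z + f2 z * g z"]) auto
qed

lemma CkOn_power: "CkOn k U f \<Longrightarrow> CkOn k U (\<lambda>z. f z ^ n)"
  by (induction n) (auto intro: CkOn_mult CkOn_polyfun2)

lemma CkOn_inverse: "CkOn k U f \<Longrightarrow> (\<And>z. z \<in> U \<Longrightarrow> f z \<noteq> 0) \<Longrightarrow> CkOn k U (\<lambda>z. 1 / f z)"
proof (induction k arbitrary: f)
  case 0 then show ?case unfolding CkOn.simps by (intro continuous_on_divide continuous_on_const) auto
next
  case (Suc k)
  obtain f1 f2 where f: "\<And>z. z \<in> U \<Longrightarrow> (f has_derivative (\<lambda>(h1, h2). f1 z * h1 + f2 z * h2)) (at z)"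
    "CkOn k U f1" "CkOn k U f2" using Suc.prems(1) unfolding CkOn.simps by blast
  have i0: "CkOn k U (\<lambda>z. 1 / f z)"
    by (rule Suc.IH[OF CkOn_Suc_imp[OF Suc.prems(1)]]) (rule Suc.prems(2))
  have "((\<lambda>z. 1 / f z) has_derivative
      (\<lambda>(h1, h2). (- 1 * (1 / f z * (1 / f z)) * f1 z) * h1 + (- 1 * (1 / f z * (1 / f z)) * f2 z) * h2)) (at z)" if "z \<in> U" for z
    by (rule has_derivative_eq_rhs[OF has_derivative_divide'[OF has_derivative_const f(1)[OF that] Suc.prems(2)[OF that]]])
      (auto simp: field_simps Suc.prems(2)[OF that])
  moreover have "CkOn k U (\<lambda>z. - 1 * (1 / f z * (1 / f z)) * f1 z)" "CkOn k U (\<lambda>z. - 1 * (1 / f z * (1 / f z)) * f2 z)"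
    using CkOn_mult[OF CkOn_mult[OF CkOn_polyfun2[OF polyfun2_const] CkOn_mult[OF i0 i0]]] f(2,3) by blast+
  ultimately show ?case unfolding CkOn.simps
    by (intro exI[of _ "\<lambda>z. - 1 * (1 / f z * (1 / f z)) * f1 z"] exI[of _ "\<lambda>z. - 1 * (1 / f z * (1 / f z)) * f2 z"]) auto
qed

text \<open>Partial derivatives chosen on different neighbourhoods agree on overlaps, so the
  diagonal \<open>w \<mapsto> g1 w w\<close> is a global choice that is locally of the right
  class.\<close>

lemma Ck_local: "(\<And>z. \<exists>U. open U \<and> z \<in> U \<and> CkOn k U f) \<Longrightarrow> Ck k f"
proof (induction k arbitrary: f)
  case 0
  have "isCont f z" for z using 0[of z] by (auto simp: continuous_on_eq_continuous_at)
  then show ?case by (simp add: continuous_at_imp_continuous_on)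
next
  case (Suc k)
  have "\<exists>U g1 g2. open U \<and> z \<in> U \<and> (\<forall>w\<in>U. (f has_derivative (\<lambda>(h1, h2). g1 w * h1 + g2 w * h2)) (at w))
      \<and> CkOn k U g1 \<and> CkOn k U g2" for z using Suc.prems[of z] by auto
  then obtain U g1 g2 where U: "\<And>z. open (U z)" "\<And>z. z \<in> U z"
    and der: "\<And>z w. w \<in> U z \<Longrightarrow> (f has_derivative (\<lambda>(h1, h2). g1 z w * h1 + g2 z w * h2)) (at w)"
    and C: "\<And>z. CkOn k (U z) (g1 z)" "\<And>z. CkOn k (U z) (g2 z)" by metis
  have eq: "g1 z w = g1 w w" "g2 z w = g2 w w" if "w \<in> U z" for z w
    using partials_unique[OF der[OF that] der[OF U(2)]] by auto
  have "CkOn k (U z) (\<lambda>w. g1 w w)" for z by (rule CkOn_cong[OF C(1) U(1)]) (use eq in auto)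
  then have "Ck k (\<lambda>w. g1 w w)" using U by (intro Suc.IH) blast
  moreover have "CkOn k (U z) (\<lambda>w. g2 w w)" for z by (rule CkOn_cong[OF C(2) U(1)]) (use eq in auto)
  then have "Ck k (\<lambda>w. g2 w w)" using U by (intro Suc.IH) blast
  ultimately show ?case using der[OF U(2)] unfolding Ck.simps
    by (intro exI[of _ "\<lambda>w. g1 w w"] exI[of _ "\<lambda>w. g2 w w"]) auto
qed

section \<open>Differentiability of quotients with a definite denominator\<close>

lemma vord_ge_1_isCont: assumes "vord_ge 1 z f" shows "isCont f z"
proof -
  obtain C where C: "C > 0" "\<forall>\<^sub>F w in nhds z. \<bar>f w\<bar> \<le> C * dist w z ^ 1" using vord_geE[OF assms] .
  have "((\<lambda>w. C * dist w z) \<longlongrightarrow> C * dist z z) (nhds z)" by (intro tendsto_intros filterlim_ident)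
  then have "(f \<longlongrightarrow> 0) (nhds z)"
    by (intro Lim_null_comparison[of f "\<lambda>w. C * dist w z"]) (use C(2) in auto)
  moreover have "f z = 0" using vord_ge_1_imp_zero[OF assms] by simp
  ultimately show ?thesis by (metis isCont_def tendsto_at_iff_tendsto_nhds)
qed

lemma vord_ge_2_has_derivative: assumes "vord_ge 2 z f" shows "(f has_derivative (\<lambda>h. 0)) (at z)"
proof -
  have "f z = 0" using vord_ge_1_imp_zero[OF assms] by simp
  have "vord_gt 1 z f" using assms by (intro vord_ge_Suc_imp_gt) (simp add: numeral_2_eq_2)
  then have "\<exists>d>0. \<forall>y. norm (y - z) < d \<longrightarrow> norm (f y - f z - 0) \<le> e * norm (y - z)" if "e > 0" for e
    using that \<open>f z = 0\<close> unfolding vord_gt_def eventually_nhds_metric by (simp add: dist_norm)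
  then show ?thesis unfolding has_derivative_at_alt by simp
qed

lemma vord_ge_quotient:
  assumes Q: "definite_order m z Q" and P: "vord_ge (m + n) z P" and "n > 0"
  shows "vord_ge n z (\<lambda>w. P w / Q w)"
proof -
  obtain c where c: "c > 0" "\<forall>\<^sub>F w in nhds z. c * dist w z ^ m \<le> \<bar>Q w\<bar>"
    using Q unfolding definite_order_def by blast
  obtain C where C: "C > 0" "\<forall>\<^sub>F w in nhds z. \<bar>P w\<bar> \<le> C * dist w z ^ (m + n)" using vord_geE[OF P] .
  have P0: "P z = 0" using vord_ge_1_imp_zero[OF P] \<open>n > 0\<close> by simp
  from c(2) C(2) have "\<forall>\<^sub>F w in nhds z. \<bar>P w / Q w\<bar> \<le> C / c * dist w z ^ n"
  proof eventually_elim
    case (elim w)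
    show ?case
    proof (cases "w = z")
      case True then show ?thesis using P0 c(1) C(1) by simp
    next
      case False
      then have pos: "c * dist w z ^ m > 0" using c(1) by simp
      have "\<bar>P w / Q w\<bar> = \<bar>P w\<bar> / \<bar>Q w\<bar>" by simp
      also have "\<dots> \<le> (C * dist w z ^ (m + n)) / (c * dist w z ^ m)"
        using elim pos by (intro frac_le) auto
      also have "\<dots> = C / c * dist w z ^ n" using pos False by (simp add: power_add)
      finally show ?thesis .
    qed
  qed
  then show ?thesis by (rule vord_geI)
qed

text \<open>The value at \<open>z\<close> is 0 in any case: if \<open>Q z = 0\<close>, then \<open>P z / Q z = 0\<close> by convention.\<close>
lemma CkOn_quotient:
  assumes "open U" "polyfun2 P" "polyfun2 Q" "\<And>w. w \<in> U \<Longrightarrow> w \<noteq> z \<Longrightarrow> Q w \<noteq> 0"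
    "definite_order m z Q" "vord_ge (m + (k + 1)) z P"
  shows "CkOn k U (\<lambda>w. P w / Q w)"
  using assms(2-)
proof (induction k arbitrary: P Q m)
  case 0
  have "isCont (\<lambda>w. P w / Q w) w" if "w \<in> U" for w
  proof (cases "w = z")
    case True
    show ?thesis unfolding True by (rule vord_ge_1_isCont) (use vord_ge_quotient[OF "0.prems"(4), of 1 P] "0.prems"(5) in simp)
  next
    case False
    then show ?thesis using 0 that by (intro continuous_divide isCont_polyfun2) auto
  qed
  then show ?case by (simp add: continuous_at_imp_continuous_on)
next
  case (Suc k)
  obtain P1 P2 where P: "polyfun2 P1" "polyfun2 P2"
    "\<And>z. (P has_derivative (\<lambda>(h1, h2). P1 z * h1 + P2 z * h2)) (at z)"
    by (rule has_derivative_polyfun2[OF Suc.prems(1)]) (rule that)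
  obtain Q1 Q2 where Q: "polyfun2 Q1" "polyfun2 Q2"
    "\<And>z. (Q has_derivative (\<lambda>(h1, h2). Q1 z * h1 + Q2 z * h2)) (at z)"
    by (rule has_derivative_polyfun2[OF Suc.prems(2)]) (rule that)
  have Qm: "vord_ge m z Q" using Suc.prems(4) by (rule definite_order_imp_vord_ge)
  have "vord_ge (Suc (m + (k + 1))) z P" using Suc.prems(5) by simp
  note P' = vord_ge_derivative[OF Suc.prems(1) P(3) this]
  have Q': "vord_ge (m - 1) z Q1 \<and> vord_ge (m - 1) z Q2"
  proof (cases m)
    case 0 then show ?thesis using Q by (auto intro: vord_ge_isCont isCont_polyfun2)
  next
    case (Suc n)
    then have "vord_ge (Suc n) z Q" using Qm by simp
    from vord_ge_derivative[OF Suc.prems(2) Q(3) this] show ?thesis using Suc by simp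
  qed
  \<comment> \<open>The numerators of the quotient rule exceed the order \<open>m + m\<close> of the
    squared denominator by \<open>k + 1\<close>: the additional order assumed of \<open>P\<close> at
    stage \<open>Suc k\<close> pays for one differentiation. This is the induction hypothesis with
    \<open>m + m\<close> for \<open>m\<close>. The truncated \<open>m - 1\<close> is harmless for
    \<open>m = 0\<close>.\<close>
  have num: "vord_ge ((m + m) + (k + 1)) z (\<lambda>w. R w * Q w - P w * S w)"
    if "vord_ge (m + (k + 1)) z R" "vord_ge (m - 1) z S" for R S
  proof (rule vord_ge_diff)
    show "vord_ge ((m + m) + (k + 1)) z (\<lambda>w. R w * Q w)"
      by (rule vord_ge_mono[OF vord_ge_mult[OF that(1) Qm]]) simp
    show "vord_ge ((m + m) + (k + 1)) z (\<lambda>w. P w * S w)"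
      by (rule vord_ge_mono[OF vord_ge_mult[OF Suc.prems(5) that(2)]]) simp
  qed
  define N1 where "N1 = (\<lambda>w. P1 w * Q w - P w * Q1 w)"
  define N2 where "N2 = (\<lambda>w. P2 w * Q w - P w * Q2 w)"
  have N: "vord_ge ((m + m) + (k + 1)) z N1" "vord_ge ((m + m) + (k + 1)) z N2"
    unfolding N1_def N2_def using num P' Q' by blast+
  have N0: "N1 z = 0" "N2 z = 0" using N vord_ge_1_imp_zero by auto
  have poly: "polyfun2 N1" "polyfun2 N2" "polyfun2 (\<lambda>w. Q w * Q w)"
    unfolding N1_def N2_def using P Q Suc.prems by (intro polyfun2_diff polyfun2_mult; simp)+
  have der: "((\<lambda>w. P w / Q w) has_derivative (\<lambda>(h1, h2). N1 w / (Q w * Q w) * h1 + N2 w / (Q w * Q w) * h2)) (at w)"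
    if "w \<in> U" for w
  proof (cases "w = z")
    case True
    have "vord_ge (k + 2) z (\<lambda>w. P w / Q w)"
      by (rule vord_ge_quotient[OF Suc.prems(4)]) (use Suc.prems(5) in auto)
    then have "vord_ge 2 z (\<lambda>w. P w / Q w)" by (rule vord_ge_mono) simp
    from vord_ge_2_has_derivative[OF this] show ?thesis using True N0 by (simp add: case_prod_unfold)
  next
    case False
    show ?thesis
      by (rule has_derivative_eq_rhs[OF has_derivative_divide'[OF P(3) Q(3)]])
        (use Suc.prems(3)[OF that False] in \<open>auto simp: N1_def N2_def field_simps\<close>)
  qed
  have QQ: "definite_order (m + m) z (\<lambda>w. Q w * Q w)" by (intro definite_order_mult Suc.prems)
  have "CkOn k U (\<lambda>w. N1 w / (Q w * Q w))" "CkOn k U (\<lambda>w. N2 w / (Q w * Q w))"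
    using Suc.prems(3) by (intro Suc.IH[OF _ poly(3) _ QQ] poly N; simp)+
  then show ?case using der unfolding CkOn.simps
    by (intro exI[of _ "\<lambda>w. N1 w / (Q w * Q w)"] exI[of _ "\<lambda>w. N2 w / (Q w * Q w)"]) auto
qed

section \<open>Fractions with definite denominators\<close>

lemma definite_poly_swap: assumes "definite_poly Q" shows "definite_poly (\<lambda>z. Q (prod.swap z))"
  unfolding definite_poly_def
proof (intro conjI allI)
  show "polyfun2 (\<lambda>z. Q (prod.swap z))" using assms by (intro polyfun2_swap) (simp add: definite_poly_def)
  fix z :: pt
  obtain m where "definite_order m (prod.swap z) Q" using assms unfolding definite_poly_def by blast
  from definite_order_swap[OF this] show "\<exists>m. definite_order m z (\<lambda>z. Q (prod.swap z))" by auto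
qed

lemma regular_on_swap:
  assumes "regular_on S F" shows "regular_on {w. prod.swap w \<in> S} (\<lambda>w. F (prod.swap w))"
  unfolding regular_on_def
proof
  fix x :: pt assume "x \<in> {w. prod.swap w \<in> S}"
  then obtain p q where pq: "polyfun2 p" "polyfun2 q" "q (prod.swap x) \<noteq> 0" "\<forall>y\<in>S. q y \<noteq> 0 \<longrightarrow> F y = p y / q y"
    using assms unfolding regular_on_def by blast
  show "\<exists>p q. polyfun2 p \<and> polyfun2 q \<and> q x \<noteq> 0 \<and>
      (\<forall>y\<in>{w. prod.swap w \<in> S}. q y \<noteq> 0 \<longrightarrow> F (prod.swap y) = p y / q y)"
    by (intro exI[of _ "\<lambda>z. p (prod.swap z)"] exI[of _ "\<lambda>z. q (prod.swap z)"] conjI polyfun2_swap pq) (use pq(4) in auto)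
qed

text \<open>Exchanging the coordinates of the plane and of the chart turns the second chart into the
  first, so that only the first has to be analysed. \<open>Q\<close> is a predicate describing the
  centres.\<close>

lemma regular_on_swap_chart:
  assumes "regular_on {(u, v). (fst (prod.swap a) + u, snd (prod.swap a) + u * v) \<notin> {z. Q (prod.swap z)} - {prod.swap a}}
    (\<lambda>(u, v). \<phi> (prod.swap (fst (prod.swap a) + u, snd (prod.swap a) + u * v)))"
  shows "regular_on {(u, v). (fst a + u * v, snd a + v) \<notin> {z. Q z} - {a}} (\<lambda>(u, v). \<phi> (fst a + u * v, snd a + v))"
proof -
  have "{w. prod.swap w \<in> {(u, v). (fst (prod.swap a) + u, snd (prod.swap a) + u * v) \<notin> {z. Q (prod.swap z)} - {prod.swap a}}}
      = {(u, v). (fst a + u * v, snd a + v) \<notin> {z. Q z} - {a}}"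
    by (auto simp: prod.swap_def mult.commute prod_eq_iff)
  moreover have "(\<lambda>w. (\<lambda>(u, v). \<phi> (prod.swap (fst (prod.swap a) + u, snd (prod.swap a) + u * v))) (prod.swap w))
      = (\<lambda>(u, v). \<phi> (fst a + u * v, snd a + v))"
    by (auto simp: prod.swap_def mult.commute)
  ultimately show ?thesis using regular_on_swap[OF assms] by simp
qed

lemma regular_on_chart_swap:
  assumes "regular_on {(u, v). (fst a + u * v, snd a + v) \<notin> {z. Q z} - {a}} (\<lambda>(u, v). \<phi> (fst a + u * v, snd a + v))"
  shows "regular_on {(u, v). (fst (prod.swap a) + u, snd (prod.swap a) + u * v) \<notin> {z. Q (prod.swap z)} - {prod.swap a}}
    (\<lambda>(u, v). \<phi> (prod.swap (fst (prod.swap a) + u, snd (prod.swap a) + u * v)))"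
proof -
  have "{w. prod.swap w \<in> {(u, v). (fst a + u * v, snd a + v) \<notin> {z. Q z} - {a}}} =
      {(u, v). (fst (prod.swap a) + u, snd (prod.swap a) + u * v) \<notin> {z. Q (prod.swap z)} - {prod.swap a}}"
    by (auto simp: prod.swap_def mult.commute prod_eq_iff)
  moreover have "(\<lambda>w. (\<lambda>(u, v). \<phi> (fst a + u * v, snd a + v)) (prod.swap w)) =
      (\<lambda>(u, v). \<phi> (prod.swap (fst (prod.swap a) + u, snd (prod.swap a) + u * v)))"
    by (auto simp: prod.swap_def mult.commute)
  ultimately show ?thesis using regular_on_swap[OF assms] by simp
qed

lemma continuous_on_chart:
  assumes "continuous_on UNIV \<phi>"
  shows "continuous_on UNIV (\<lambda>z::pt. \<phi> (a + fst z, b + fst z * snd z) :: real)"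
  by (rule continuous_on_compose2[OF assms]) (auto intro!: continuous_intros)

lemma polyfun2_chart: "polyfun2 p \<Longrightarrow> polyfun2 (\<lambda>z. p (a + fst z, b + fst z * snd z))"
  by (rule polyfun2_compose[OF _ polyfun2_add[OF polyfun2_const polyfun2_fst]
        polyfun2_add[OF polyfun2_const polyfun2_mult[OF polyfun2_fst polyfun2_snd]]])

lemma fst_not_zero: "fst \<noteq> (\<lambda>w::pt. 0)"
  by (metis fst_conv zero_neq_one)

text \<open>Continuity of \<open>\<phi>\<close> makes the order of \<open>P = \<phi> Q\<close> at
  least that of \<open>Q\<close>. The same power of \<open>u\<close> is therefore removed from both,
  and the remaining denominator has no zero on the exceptional line.\<close>

lemma regular_on_chart:
  assumes cont: "continuous_on UNIV \<phi>" and P: "polyfun2 P" and Q: "definite_poly Q"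
    and eq: "\<And>z. \<phi> z * Q z = P z"
  shows "regular_on {(u, v). (fst a + u, snd a + u * v) \<notin> {z. Q z = 0} - {a}} (\<lambda>(u, v). \<phi> (fst a + u, snd a + u * v))"
proof -
  have Qp: "polyfun2 Q" using Q by (simp add: definite_poly_def)
  obtain m where m: "definite_order m a Q" using Q unfolding definite_poly_def by blast
  have "isCont \<phi> a" using cont continuous_on_eq_continuous_at[of UNIV \<phi>] by blast
  then have "vord_ge m a (\<lambda>z. Q z * \<phi> z)"
    by (rule vord_ge_mult_isCont[OF definite_order_imp_vord_ge[OF m]])
  also have "(\<lambda>z. Q z * \<phi> z) = P" using eq by (auto simp: mult.commute)
  finally have "vord_ge m a P" .
  then obtain P' where P': "polyfun2 P'" "\<And>u v. P (fst a + u, snd a + u * v) = u ^ m * P' (u, v)"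
    by (rule blowup_chart[OF P]) (rule that)
  obtain Q' where Q': "polyfun2 Q'" "\<And>u v. Q (fst a + u, snd a + u * v) = u ^ m * Q' (u, v)"
    by (rule blowup_chart[OF Qp definite_order_imp_vord_ge[OF m]]) (rule that)
  \<comment> \<open>Division by \<open>u^m\<close> is valid only off the exceptional line;
    continuity extends the identity across it.\<close>
  have F: "\<phi> (fst a + fst w, snd a + fst w * snd w) * Q' w = P' w" for w
  proof (rule eq_by_density[OF polyfun2_fst fst_not_zero])
    show "continuous_on UNIV (\<lambda>w. \<phi> (fst a + fst w, snd a + fst w * snd w) * Q' w)"
      by (intro continuous_on_mult continuous_on_chart cont continuous_on_polyfun2 Q')
    show "continuous_on UNIV P'" by (rule continuous_on_polyfun2[OF P'(1)])
    fix w :: pt assume "fst w \<noteq> 0"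
    then show "\<phi> (fst a + fst w, snd a + fst w * snd w) * Q' w = P' w"
      using eq[of "(fst a + fst w, snd a + fst w * snd w)"] P'(2)[of "fst w" "snd w"] Q'(2)[of "fst w" "snd w"] by simp
  qed
  have nz: "Q' (u, v) \<noteq> 0" if "(fst a + u, snd a + u * v) \<notin> {z. Q z = 0} - {a}" for u v
  proof (cases "u = 0")
    case True then show ?thesis using definite_order_chart_nonzero[OF m Q'] by simp
  next
    case False
    then have "(fst a + u, snd a + u * v) \<noteq> a" by (auto simp: prod_eq_iff)
    then show ?thesis using that Q'(2)[of u v] by auto
  qed
  have Feq: "(case y of (u, v) \<Rightarrow> \<phi> (fst a + u, snd a + u * v)) = P' y / Q' y" if "Q' y \<noteq> 0" for y
    using F[of y] that by (simp add: case_prod_unfold field_simps)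
  show ?thesis unfolding regular_on_def
  proof
    fix x assume "x \<in> {(u, v). (fst a + u, snd a + u * v) \<notin> {z. Q z = 0} - {a}}"
    then have "Q' x \<noteq> 0" using nz by auto
    then show "\<exists>p q. polyfun2 p \<and> polyfun2 q \<and> q x \<noteq> 0 \<and>
        (\<forall>y\<in>{(u, v). (fst a + u, snd a + u * v) \<notin> {z. Q z = 0} - {a}}. q y \<noteq> 0 \<longrightarrow>
          (case y of (u, v) \<Rightarrow> \<phi> (fst a + u, snd a + u * v)) = p y / q y)"
      by (intro exI[of _ P'] exI[of _ Q'] conjI P'(1) Q'(1) ballI impI Feq)
  qed
qed

text \<open>The centres are the finitely many zeros of \<open>Q\<close>. The relation is stated
  without division because at these zeros \<open>\<phi>\<close> is determined by continuity, not by
  the fraction.\<close>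

lemma Rk1I:
  assumes Ck: "Ck k \<phi>" and P: "polyfun2 P" and Q: "definite_poly Q" and eq: "\<And>z. \<phi> z * Q z = P z"
  shows "\<phi> \<in> Rk1 k"
proof -
  have cont: "continuous_on UNIV \<phi>" using CkOn_imp_continuous[of k UNIV \<phi>] Ck by (simp add: CkOn_UNIV)
  have Qp: "polyfun2 Q" using Q by (simp add: definite_poly_def)
  have fin: "finite {z. Q z = 0}" by (rule definite_poly_finite_zeros[OF Q])
  have div: "\<phi> z = P z / Q z" if "Q z \<noteq> 0" for z using eq[of z] that by (simp add: field_simps)
  have "zariski_open {z. Q z \<noteq> 0}" unfolding zariski_open_def zariski_closed_def
    by (rule exI[of _ "{Q}"]) (use Qp in auto)
  moreover have "{z. Q z \<noteq> 0} \<noteq> {}"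
  proof -
    obtain m where "definite_order m 0 Q" using Q unfolding definite_poly_def by blast
    from definite_order_not_zero[OF this] show ?thesis by auto
  qed
  ultimately have "\<phi> \<in> Rk k" unfolding Rk_def using Ck P Qp div
    by (intro CollectI conjI exI[of _ P] exI[of _ Q] exI[of _ "{z. Q z \<noteq> 0}"]) auto
  moreover have "regular_after_blowup {z. Q z = 0} \<phi>"
    unfolding regular_after_blowup_def
  proof (intro conjI ballI)
    show "regular_on (- {z. Q z = 0}) \<phi>" unfolding regular_on_def
      by (intro ballI exI[of _ P] exI[of _ Q]) (use P Qp div in auto)
    fix a
    show "regular_on {(u, v). (fst a + u, snd a + u * v) \<notin> {z. Q z = 0} - {a}} (\<lambda>(u, v). \<phi> (fst a + u, snd a + u * v))"
      by (rule regular_on_chart[OF cont P Q eq])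
    have "regular_on {(u, v). (fst (prod.swap a) + u, snd (prod.swap a) + u * v) \<notin> {z. Q (prod.swap z) = 0} - {prod.swap a}}
        (\<lambda>(u, v). \<phi> (prod.swap (fst (prod.swap a) + u, snd (prod.swap a) + u * v)))"
    proof (rule regular_on_chart)
      show "continuous_on UNIV (\<lambda>z. \<phi> (prod.swap z))"
        by (rule continuous_on_compose2[OF cont]) (auto intro!: continuous_intros)
    qed (use P Q eq in \<open>auto intro: polyfun2_swap definite_poly_swap\<close>)
    then show "regular_on {(u, v). (fst a + u * v, snd a + v) \<notin> {z. Q z = 0} - {a}} (\<lambda>(u, v). \<phi> (fst a + u * v, snd a + v))"
      by (rule regular_on_swap_chart)
  qed
  ultimately show ?thesis unfolding Rk1_def using fin by blast
qed

section \<open>Regularity on the blowing-up forces definite denominators\<close>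

lemma factor_out_fst:
  assumes "polyfun2 t" "t \<noteq> (\<lambda>z. 0)"
  obtains r t' where "polyfun2 t'" "\<And>u v. t (u, v) = u ^ r * t' (u, v)" "\<exists>v. t' (0, v) \<noteq> 0"
proof -
  obtain T where T: "t = (\<lambda>z. ev T (fst z) (snd z))" using assms(1) by (rule polyfun2_obtain_ev)
  have "T \<noteq> 0" using assms(2) T by auto
  then obtain T' where T': "T = [:0, 1:] ^ order 0 T * T'" and nd: "\<not> [:0, 1:] dvd T'"
    using order_decomp[of T 0] by auto
  have "poly T' 0 \<noteq> 0" using nd by (metis dvd_iff_poly_eq_0 minus_zero)
  then obtain v where "poly (poly T' 0) v \<noteq> 0" using poly_fun_eq_0 by blast
  then have v: "ev T' 0 v \<noteq> 0" by (simp add: ev_def)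
  have eq: "t (u, v) = u ^ order 0 T * ev T' u v" for u v
    by (simp only: T fst_conv snd_conv) (subst T', simp)
  show ?thesis
    by (rule that[of "\<lambda>z. ev T' (fst z) (snd z)" "order 0 T"]) (use v eq in auto)
qed

lemma cancel_fst_powers_le:
  assumes "polyfun2 X" "polyfun2 Y" and eq: "\<And>u v. u ^ n * X (u, v) = u ^ m * Y (u, v)" and "X (0, v) \<noteq> 0" and "n \<le> m"
  shows "n = m \<and> (\<forall>z. X z = Y z)"
proof -
  have *: "X z = fst z ^ (m - n) * Y z" for z
  proof (rule eq_by_density[OF polyfun2_fst fst_not_zero])
    show "continuous_on UNIV X" "continuous_on UNIV (\<lambda>z. fst z ^ (m - n) * Y z)"
      using assms by (auto intro!: continuous_on_polyfun2 polyfun2_mult polyfun2_power)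
    fix z :: pt assume z: "fst z \<noteq> 0"
    have "fst z ^ n * X z = fst z ^ n * (fst z ^ (m - n) * Y z)"
      using eq[of "fst z" "snd z"] \<open>n \<le> m\<close> by (simp add: power_add[symmetric] mult.assoc[symmetric])
    then show "X z = fst z ^ (m - n) * Y z" using z by simp
  qed
  then have "n = m" using assms(4,5) *[of "(0, v)"] by (cases "m - n") auto
  then show ?thesis using * by simp
qed

text \<open>Neither \<open>X\<close> nor \<open>Y\<close> vanishes identically on
  \<open>u = 0\<close>, so \<open>n\<close> and \<open>m\<close> are both the exact exponent of
  \<open>u\<close>.\<close>

lemma cancel_fst_powers:
  assumes "polyfun2 X" "polyfun2 Y" and eq: "\<And>u v. u ^ n * X (u, v) = u ^ m * Y (u, v)"
    and "X (0, v) \<noteq> 0" "Y (0, v') \<noteq> 0"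
  shows "X z = Y z"
proof (cases "n \<le> m")
  case True
  then show ?thesis using cancel_fst_powers_le[OF assms(1,2) eq assms(4)] by blast
next
  case False
  then have "m \<le> n" by simp
  have "\<forall>z. Y z = X z" using cancel_fst_powers_le[OF assms(2,1) eq[symmetric] assms(5) \<open>m \<le> n\<close>] by blast
  then show ?thesis by metis
qed

text \<open>Regularity gives the fraction only on \<open>S\<close>. As \<open>S\<close> contains the
  complement of the zero set of a nonzero polynomial \<open>T\<close>, continuity extends the
  identity to the plane.\<close>

lemma regular_imp_global_fraction:
  assumes cont: "continuous_on UNIV F" and T: "polyfun2 T" "T \<noteq> (\<lambda>z. 0)" "\<And>z. T z \<noteq> 0 \<Longrightarrow> z \<in> S"
    and reg: "regular_on S F" and "x \<in> S"
  obtains p q where "polyfun2 p" "polyfun2 q" "q x \<noteq> 0" "\<And>z. F z * q z = p z"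
proof -
  obtain p q where pq: "polyfun2 p" "polyfun2 q" "q x \<noteq> 0" "\<forall>y\<in>S. q y \<noteq> 0 \<longrightarrow> F y = p y / q y"
    using reg \<open>x \<in> S\<close> unfolding regular_on_def by blast
  have "F z * q z = p z" for z
  proof (rule eq_by_density[of "\<lambda>z. T z * q z" "\<lambda>z. F z * q z" p])
    show "polyfun2 (\<lambda>z. T z * q z)" using T pq by (intro polyfun2_mult)
    show "(\<lambda>z. T z * q z) \<noteq> (\<lambda>w. 0)"
    proof
      assume "(\<lambda>z. T z * q z) = (\<lambda>w. 0)"
      then have "T z * q z = 0" for z by metis
      then have "(\<forall>z. T z = 0) \<or> (\<forall>z. q z = 0)" by (rule polyfun2_mult_eq_0[OF T(1) pq(2)])
      then show False using T(2) pq(3) ext[of T "\<lambda>z. 0"] by blast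
    qed
    show "continuous_on UNIV (\<lambda>z. F z * q z)" "continuous_on UNIV p"
      by (intro continuous_on_mult cont continuous_on_polyfun2 pq)+
    fix z assume "T z * q z \<noteq> 0"
    then have "z \<in> S" "q z \<noteq> 0" using T(3) by auto
    then show "F z * q z = p z" using pq(4) by simp
  qed
  then show ?thesis using that pq by blast
qed

text \<open>The Bezout identity \<open>c(x) = \<alpha> P + \<beta> Q\<close> survives the blowing-up, and \<open>c\<close> becomes a power
  of the exceptional coordinate times a unit; so a zero of the strict transform of \<open>Q\<close> on the
  exceptional line would be a zero of every denominator of \<open>P / Q\<close>.\<close>
lemma strict_transform_nonzero:
  assumes cont: "continuous_on UNIV \<phi>" and P: "polyfun2 P" and Q: "polyfun2 Q" and eq: "\<And>z. \<phi> z * Q z = P z"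
    and c: "c \<noteq> 0" "polyfun2 \<alpha>" "polyfun2 \<beta>" "\<And>z. poly c (fst z) = \<alpha> z * P z + \<beta> z * Q z"
    and Q': "polyfun2 Q'" "\<And>u v. Q (fst a + u, snd a + u * v) = u ^ N * Q' (u, v)" "\<exists>v. Q' (0, v) \<noteq> 0"
    and A: "finite A"
    and reg: "regular_on {(u, v). (fst a + u, snd a + u * v) \<notin> A - {a}} (\<lambda>(u, v). \<phi> (fst a + u, snd a + u * v))"
  shows "Q' (0, v0) \<noteq> 0"
proof -
  define \<pi> where "\<pi> = (\<lambda>z::pt. (fst a + fst z, snd a + fst z * snd z))"
  have pol: "polyfun2 (\<lambda>z. p (\<pi> z))" if "polyfun2 p" for p unfolding \<pi>_def using that by (rule polyfun2_chart)
  have F: "(\<lambda>(u, v). \<phi> (fst a + u, snd a + u * v)) = (\<lambda>z. \<phi> (\<pi> z))" by (auto simp: \<pi>_def)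
  have "dist_poly (A - {a}) (\<pi> (0, v0)) \<noteq> 0" using A by (simp add: dist_poly_eq_0_iff \<pi>_def)
  then have Tnz: "(\<lambda>z. dist_poly (A - {a}) (\<pi> z)) \<noteq> (\<lambda>z. 0)" by metis
  obtain p q where pq: "polyfun2 p" "polyfun2 q" "q (0, v0) \<noteq> 0" "\<And>z. \<phi> (\<pi> z) * q z = p z"
  proof (rule regular_imp_global_fraction[OF _ pol[OF polyfun2_dist_poly] Tnz _ reg[unfolded F]])
    show "continuous_on UNIV (\<lambda>z. \<phi> (\<pi> z))" unfolding \<pi>_def by (rule continuous_on_chart[OF cont])
    show "(0, v0) \<in> {(u, v). (fst a + u, snd a + u * v) \<notin> A - {a}}" by simp
    fix z assume "dist_poly (A - {a}) (\<pi> z) \<noteq> 0"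
    then show "z \<in> {(u, v). (fst a + u, snd a + u * v) \<notin> A - {a}}"
      using A by (auto simp: dist_poly_eq_0_iff \<pi>_def)
  qed (rule that)
  \<comment> \<open>Chosen so that \<open>Q \<circ> \<pi>\<close> times \<open>t\<close> is
    \<open>c\<close> at the first coordinate of \<open>\<pi>\<close> times \<open>q\<close>:
    multiply the Bezout identity by \<open>q\<close> and replace \<open>\<phi> q\<close> by
    \<open>p\<close>.\<close>
  define t where "t = (\<lambda>z. \<alpha> (\<pi> z) * p z + \<beta> (\<pi> z) * q z)"
  have t: "polyfun2 t" unfolding t_def by (intro polyfun2_add polyfun2_mult pol c pq)
  define n where "n = order (fst a) c"
  obtain e where e: "c = [:- fst a, 1:] ^ n * e" "\<not> [:- fst a, 1:] dvd e"
    using order_decomp[OF c(1), of "fst a"] by (auto simp: n_def)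
  have e0: "poly e (fst a) \<noteq> 0" using e(2) by (simp add: dvd_iff_poly_eq_0)
  \<comment> \<open>The product of \<open>c\<close> and \<open>q\<close> without the power
    \<open>u^n\<close>; the remaining factor \<open>e\<close> has no zero on the exceptional
    line.\<close>
  define X where "X = (\<lambda>z. poly e (fst a + fst z) * q z)"
  have "polyfun2 (\<lambda>z. poly e (fst (\<pi> z)))" by (rule pol) (rule polyfun2_poly)
  then have X: "polyfun2 X" unfolding X_def using pq(2) by (simp add: \<pi>_def polyfun2_mult)
  have id: "u ^ n * X (u, v) = u ^ N * (Q' (u, v) * t (u, v))" for u v
  proof -
    have "u ^ n * X (u, v) = poly c (fst (\<pi> (u, v))) * q (u, v)"
      by (simp add: e(1) X_def \<pi>_def poly_power)
    also have "\<dots> = \<alpha> (\<pi> (u, v)) * (\<phi> (\<pi> (u, v)) * Q (\<pi> (u, v))) * q (u, v) + \<beta> (\<pi> (u, v)) * Q (\<pi> (u, v)) * q (u, v)"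
      by (simp add: c(4) eq[symmetric] algebra_simps)
    also have "\<dots> = Q (\<pi> (u, v)) * t (u, v)"
      by (simp add: t_def pq(4)[symmetric] algebra_simps)
    also have "\<dots> = u ^ N * (Q' (u, v) * t (u, v))" using Q'(2)[of u v] by (simp add: \<pi>_def)
    finally show ?thesis .
  qed
  have X0: "X (0, v0) \<noteq> 0" using e0 pq(3) by (simp add: X_def)
  have "t \<noteq> (\<lambda>z. 0)"
  proof
    assume "t = (\<lambda>z. 0)"
    then have "fst z ^ n * X z = 0" for z using id[of "fst z" "snd z"] by simp
    then have "(\<forall>z::pt. fst z ^ n = 0) \<or> (\<forall>z. X z = 0)" by (intro polyfun2_mult_eq_0 X polyfun2_power polyfun2_fst)
    moreover have "fst (1::real, 0::real) ^ n \<noteq> 0" by simp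
    ultimately show False using X0 by blast
  qed
  then obtain r t' where t': "polyfun2 t'" "\<And>u v. t (u, v) = u ^ r * t' (u, v)" "\<exists>v. t' (0, v) \<noteq> 0"
    by (rule factor_out_fst[OF t]) (rule that)
  have poly0: "polyfun2 (\<lambda>w. Q' (0, snd w))" "polyfun2 (\<lambda>w. t' (0, snd w))"
    by (rule polyfun2_compose[OF Q'(1) polyfun2_const polyfun2_snd]
        polyfun2_compose[OF t'(1) polyfun2_const polyfun2_snd])+
  have "\<exists>v. Q' (0, v) * t' (0, v) \<noteq> 0"
  proof (rule ccontr)
    assume "\<nexists>v. Q' (0, v) * t' (0, v) \<noteq> 0"
    then have "(\<forall>w::pt. Q' (0, snd w) = 0) \<or> (\<forall>w::pt. t' (0, snd w) = 0)"
      by (intro polyfun2_mult_eq_0 poly0) blast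
    then show False using Q'(3) t'(3) by auto
  qed
  then obtain v1 where v1: "Q' (0, v1) * t' (0, v1) \<noteq> 0" by blast
  \<comment> \<open>After removal of the exact power of \<open>u\<close> on each side,
    \<open>Q'\<close> is a factor of \<open>X\<close>, which is nonzero at
    \<open>(0, v0)\<close>.\<close>
  have "X (0, v0) = Q' (0, v0) * t' (0, v0)"
  proof (rule cancel_fst_powers[where n = n and m = "N + r" and Y = "\<lambda>z. Q' z * t' z"])
    show "u ^ n * X (u, v) = u ^ (N + r) * (Q' (u, v) * t' (u, v))" for u v
      using id[of u v] by (simp add: t'(2) power_add mult_ac)
  qed (use X X0 v1 Q'(1) t'(1) in \<open>auto intro: polyfun2_mult\<close>)
  then show ?thesis using X0 by auto
qed

lemma Rk_imp_coprime_fraction: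
  assumes "\<phi> \<in> Rk k"
  obtains P Q where "Q \<noteq> 0" "coprime P Q" "\<And>z. \<phi> z * ev Q (fst z) (snd z) = ev P (fst z) (snd z)"
proof -
  have cont: "continuous_on UNIV \<phi>" using assms CkOn_imp_continuous[of k UNIV \<phi>] by (simp add: CkOn_UNIV Rk_def)
  obtain p0 q0 U where U: "polyfun2 p0" "polyfun2 q0" "zariski_open U" "U \<noteq> {}" "\<forall>z\<in>U. q0 z \<noteq> 0 \<and> \<phi> z = p0 z / q0 z"
    using assms unfolding Rk_def by blast
  obtain Ps where Ps: "\<forall>p\<in>Ps. polyfun2 p" "- U = {z. \<forall>p\<in>Ps. p z = 0}"
    using U(3) unfolding zariski_open_def zariski_closed_def by blast
  obtain z0 where z0: "z0 \<in> U" using U(4) by blast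
  then obtain s where s: "s \<in> Ps" "s z0 \<noteq> 0" using Ps(2) by blast
  have 0: "\<phi> z * q0 z = p0 z" for z
  proof (rule eq_by_density[of s])
    show "polyfun2 s" "s \<noteq> (\<lambda>w. 0)" using s Ps(1) by auto
    show "continuous_on UNIV (\<lambda>z. \<phi> z * q0 z)" "continuous_on UNIV p0"
      by (intro continuous_on_mult cont continuous_on_polyfun2 U)+
    fix z assume "s z \<noteq> 0"
    then have "z \<in> U" using s(1) Ps(2) by blast
    then show "\<phi> z * q0 z = p0 z" using U(5) by simp
  qed
  obtain p where p: "p0 = (\<lambda>z. ev p (fst z) (snd z))" using U(1) by (rule polyfun2_obtain_ev)
  obtain q where q: "q0 = (\<lambda>z. ev q (fst z) (snd z))" using U(2) by (rule polyfun2_obtain_ev)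
  have "q \<noteq> 0" using U(5) z0 by (auto simp: q)
  then have g: "gcd p q \<noteq> 0" by simp
  then obtain P Q where PQ: "p = P * gcd p q" "q = Q * gcd p q" "coprime P Q"
    using gcd_coprime_exists[OF g] by blast
  have "Q \<noteq> 0" using \<open>q \<noteq> 0\<close> PQ(2) by auto
  moreover have "\<phi> z * ev Q (fst z) (snd z) = ev P (fst z) (snd z)" for z
  proof (rule eq_by_density[OF polyfun2_ev(1)[of "gcd p q"]])
    show "(\<lambda>z::pt. ev (gcd p q) (fst z) (snd z)) \<noteq> (\<lambda>w. 0)" using g ev_inject(1)[of "gcd p q" 0] by simp
    show "continuous_on UNIV (\<lambda>z. \<phi> z * ev Q (fst z) (snd z))" "continuous_on UNIV (\<lambda>z::pt. ev P (fst z) (snd z))"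
      by (intro continuous_on_mult cont continuous_on_polyfun2 polyfun2_ev)+
    fix z :: pt assume nz: "ev (gcd p q) (fst z) (snd z) \<noteq> 0"
    have "\<phi> z * ev (Q * gcd p q) (fst z) (snd z) = ev (P * gcd p q) (fst z) (snd z)"
      using 0[of z] unfolding p q PQ(1,2)[symmetric] .
    then show "\<phi> z * ev Q (fst z) (snd z) = ev P (fst z) (snd z)" using nz by simp
  qed
  ultimately show ?thesis using that PQ(3) by blast
qed

text \<open>The reduced denominator works. Off the centres it divides a denominator without zero at
  the point; at a centre, its strict transform misses the exceptional line in both charts.\<close>

lemma Rk1_imp_definite_fraction:
  assumes "\<phi> \<in> Rk1 k"
  obtains P Q where "polyfun2 P" "definite_poly Q" "\<And>z. \<phi> z * Q z = P z"
proof -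
  obtain A where A: "finite A" "regular_after_blowup A \<phi>" and Rk: "\<phi> \<in> Rk k"
    using assms unfolding Rk1_def by blast
  have cont: "continuous_on UNIV \<phi>" using Rk CkOn_imp_continuous[of k UNIV \<phi>] by (simp add: CkOn_UNIV Rk_def)
  obtain p q where pq: "q \<noteq> 0" "coprime p q" "\<And>z. \<phi> z * ev q (fst z) (snd z) = ev p (fst z) (snd z)"
    by (rule Rk_imp_coprime_fraction[OF Rk]) (rule that)
  define P where "P = (\<lambda>z::pt. ev p (fst z) (snd z))"
  define Q where "Q = (\<lambda>z::pt. ev q (fst z) (snd z))"
  have P: "polyfun2 P" and Q: "polyfun2 Q" by (simp_all add: P_def Q_def)
  have Qnz: "Q \<noteq> (\<lambda>z. 0)" using pq(1) ev_inject(1)[of q 0] by (simp add: Q_def)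
  have eq: "\<phi> z * Q z = P z" for z using pq(3) by (simp add: P_def Q_def)
  \<comment> \<open>Coprimality: every polynomial denominator of \<open>\<phi>\<close> is a multiple
    of the reduced one.\<close>
  have dvd: "pdvd Q s" if s: "polyfun2 s" "polyfun2 r" "\<And>z. \<phi> z * s z = r z" for r s
  proof -
    obtain s' where s': "s = (\<lambda>z. ev s' (fst z) (snd z))" using s(1) by (rule polyfun2_obtain_ev)
    obtain r' where r': "r = (\<lambda>z. ev r' (fst z) (snd z))" using s(2) by (rule polyfun2_obtain_ev)
    have "P z * s z = Q z * r z" for z using eq[of z] s(3)[of z] by (metis mult.assoc mult.commute)
    then have "(\<lambda>z. ev (p * s') (fst z) (snd z)) = (\<lambda>z. ev (q * r') (fst z) (snd z))"
      by (auto simp: P_def Q_def s' r' fun_eq_iff)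
    then have "p * s' = q * r'" by (simp only: ev_inject)
    then have "q dvd p * s'" by simp
    moreover have "coprime q p" using pq(2) by (simp add: coprime_commute)
    ultimately have "q dvd s'" by (simp add: coprime_dvd_mult_right_iff)
    then show ?thesis unfolding Q_def s' by (simp only: pdvd_ev_iff)
  qed
  have cop: "\<exists>k. e = (\<lambda>z. k)" if e: "polyfun2 e" "pdvd e Q" "pdvd e P" for e
  proof -
    obtain e' where e': "e = (\<lambda>z. ev e' (fst z) (snd z))" using e(1) by (rule polyfun2_obtain_ev)
    have "e' dvd q" "e' dvd p" using e(2,3) unfolding e' P_def Q_def pdvd_ev_iff by auto
    then have "is_unit e'" using pq(2) coprime_common_divisor by blast
    then show ?thesis using is_unit_ev_const e' by blast
  qed
  obtain c1 c2 a1 b1 a2 b2 where c: "c1 \<noteq> 0" "c2 \<noteq> 0" "polyfun2 a1" "polyfun2 b1" "polyfun2 a2" "polyfun2 b2"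
    "\<And>z. poly c1 (fst z) = a1 z * Q z + b1 z * P z"  "\<And>z. poly c2 (snd z) = a2 z * Q z + b2 z * P z"
    by (rule bezout_univariate[OF Q Qnz P cop]) (auto intro: that)
  have "\<exists>m. definite_order m a Q" for a
  proof (cases "a \<in> A")
    case False
    have reg: "regular_on (- A) \<phi>" using A(2) by (simp add: regular_after_blowup_def)
    have "dist_poly A a \<noteq> 0" using A(1) False by (simp add: dist_poly_eq_0_iff)
    then have Tnz: "dist_poly A \<noteq> (\<lambda>z. 0)" by metis
    obtain r s where rs: "polyfun2 r" "polyfun2 s" "s a \<noteq> 0" "\<And>z. \<phi> z * s z = r z"
      by (rule regular_imp_global_fraction[OF cont polyfun2_dist_poly Tnz _ reg])
        (use A(1) False in \<open>auto simp: dist_poly_eq_0_iff intro: that\<close>)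
    have "pdvd Q s" using dvd rs by blast
    then have "Q a \<noteq> 0" using rs(3) by (auto simp: pdvd_def)
    then show ?thesis using definite_order_0 isCont_polyfun2[OF Q] by blast
  next
    case True
    obtain N where N: "vord_ge N a Q" "\<not> vord_ge (Suc N) a Q" using exists_order[OF Q Qnz] .
    obtain Q1 where Q1: "polyfun2 Q1" "\<And>u v. Q (fst a + u, snd a + u * v) = u ^ N * Q1 (u, v)"
      "\<not> vord_ge (Suc N) a Q \<longrightarrow> (\<exists>v. Q1 (0, v) \<noteq> 0)"
      by (rule blowup_chart[OF Q N(1)]) (rule that)
    have ex1: "\<exists>v. Q1 (0, v) \<noteq> 0" using Q1(3) N(2) by blast
    have nz1: "Q1 (0, v) \<noteq> 0" for v
    proof (rule strict_transform_nonzero[OF cont P Q eq c(1) c(4,3) _ Q1(1,2) ex1 A(1)])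
      show "poly c1 (fst z) = b1 z * P z + a1 z * Q z" for z using c(7)[of z] by simp
      show "regular_on {(u, v). (fst a + u, snd a + u * v) \<notin> A - {a}} (\<lambda>(u, v). \<phi> (fst a + u, snd a + u * v))"
        using A(2) True by (simp add: regular_after_blowup_def)
    qed
    \<comment> \<open>The second chart is handled as the first chart of the exchanged functions,
      with the Bezout identity in y in place of the one in x.\<close>
    have sN: "vord_ge N (prod.swap a) (\<lambda>z. Q (prod.swap z))" using N(1) by (rule vord_ge_swap)
    have sN': "\<not> vord_ge (Suc N) (prod.swap a) (\<lambda>z. Q (prod.swap z))" using N(2) vord_ge_swap[of "Suc N" "prod.swap a" "\<lambda>z. Q (prod.swap z)"] by auto
    obtain Q2 where Q2: "polyfun2 Q2" "\<And>u v. Q (prod.swap (fst (prod.swap a) + u, snd (prod.swap a) + u * v)) = u ^ N * Q2 (u, v)"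
      "\<not> vord_ge (Suc N) (prod.swap a) (\<lambda>z. Q (prod.swap z)) \<longrightarrow> (\<exists>v. Q2 (0, v) \<noteq> 0)"
      by (rule blowup_chart[OF polyfun2_swap[OF Q] sN]) (rule that)
    have ex2: "\<exists>v. Q2 (0, v) \<noteq> 0" using Q2(3) sN' by blast
    have nz2: "Q2 (0, v) \<noteq> 0" for v
    proof (rule strict_transform_nonzero[OF _ polyfun2_swap[OF P] polyfun2_swap[OF Q] eq c(2)
          polyfun2_swap[OF c(6)] polyfun2_swap[OF c(5)] _ Q2(1,2) ex2])
      show "poly c2 (fst z) = b2 (prod.swap z) * P (prod.swap z) + a2 (prod.swap z) * Q (prod.swap z)" for z
        using c(8)[of "prod.swap z"] by simp
      show "continuous_on UNIV (\<lambda>z. \<phi> (prod.swap z))"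
        by (rule continuous_on_compose2[OF cont]) (auto intro!: continuous_intros)
      show "finite (prod.swap ` A)" using A(1) by simp
      have "regular_on {(u, v). (fst a + u * v, snd a + v) \<notin> {z. z \<in> A} - {a}} (\<lambda>(u, v). \<phi> (fst a + u * v, snd a + v))"
        using A(2) True by (simp add: regular_after_blowup_def)
      from regular_on_chart_swap[OF this]
      have "regular_on {(u, v). (fst (prod.swap a) + u, snd (prod.swap a) + u * v) \<notin> {z. prod.swap z \<in> A} - {prod.swap a}}
        (\<lambda>(u, v). \<phi> (prod.swap (fst (prod.swap a) + u, snd (prod.swap a) + u * v)))" .
      moreover have "{z. prod.swap z \<in> A} = prod.swap ` A"
      proof safe
        fix x y assume "prod.swap (x, y) \<in> A"
        from imageI[OF this, of prod.swap] show "(x, y) \<in> prod.swap ` A" by simp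
      qed simp
      ultimately show "regular_on {(u, v). (fst (prod.swap a) + u, snd (prod.swap a) + u * v) \<notin> prod.swap ` A - {prod.swap a}}
        (\<lambda>(u, v). \<phi> (prod.swap (fst (prod.swap a) + u, snd (prod.swap a) + u * v)))" by simp
    qed
    have "definite_order N a Q"
      by (rule definite_order_of_charts[OF Q N(1) Q1(1) nz1 Q1(2) Q2(1) nz2]) (use Q2(2) in simp)
    then show ?thesis by blast
  qed
  then have "definite_poly Q" using Q by (simp add: definite_poly_def)
  then show ?thesis by (rule that[OF P _ eq])
qed

section \<open>Ideals and their radicals\<close>

lemma Rk1_imp_Ck: "\<phi> \<in> Rk1 k \<Longrightarrow> Ck k \<phi>"
  by (simp add: Rk1_def Rk_def)

lemma Ck_imp_continuous: "Ck k \<phi> \<Longrightarrow> continuous_on UNIV \<phi>"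
  using CkOn_imp_continuous[of k UNIV \<phi>] by (simp add: CkOn_UNIV)

lemma Ck_imp_isCont: "Ck k \<phi> \<Longrightarrow> isCont \<phi> z"
  using Ck_imp_continuous continuous_on_eq_continuous_at[of UNIV \<phi>] by blast

lemma definite_polyD: "definite_poly Q \<Longrightarrow> polyfun2 Q"
  by (simp add: definite_poly_def)

lemma definite_poly_mult:
  assumes "definite_poly P" "definite_poly Q" shows "definite_poly (\<lambda>z. P z * Q z)"
  unfolding definite_poly_def
proof (intro conjI allI)
  show "polyfun2 (\<lambda>z. P z * Q z)" using assms by (intro polyfun2_mult definite_polyD)
  fix z
  obtain m n where "definite_order m z P" "definite_order n z Q"
    using assms unfolding definite_poly_def by blast
  from definite_order_mult[OF this] show "\<exists>m. definite_order m z (\<lambda>z. P z * Q z)" by blast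
qed

lemma definite_poly_power: "definite_poly P \<Longrightarrow> definite_poly (\<lambda>z. P z ^ n)"
  unfolding definite_poly_def using definite_order_power polyfun2_power by blast

text \<open>Choosing the order 0 outside \<open>T\<close> lets a sum over a finite \<open>T\<close>
  bound all orders simultaneously.\<close>

lemma definite_poly_orders:
  assumes Q: "definite_poly Q" and T: "{z. Q z = 0} \<subseteq> T"
  obtains q where "\<And>z. definite_order (q z) z Q" "\<And>z. z \<notin> T \<Longrightarrow> q z = 0"
proof -
  have "\<exists>m. definite_order m z Q \<and> (z \<notin> T \<longrightarrow> m = 0)" for z
  proof (cases "z \<in> T")
    case False
    then have "Q z \<noteq> 0" using T by blast
    then show ?thesis using definite_order_0[OF isCont_polyfun2[OF definite_polyD[OF Q]]] by blast
  next
    case True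
    then show ?thesis using Q unfolding definite_poly_def by blast
  qed
  then obtain q where "\<And>z. definite_order (q z) z Q \<and> (z \<notin> T \<longrightarrow> q z = 0)" by metis
  then show ?thesis using that by blast
qed

lemma polyfun2_in_Rk1: assumes "polyfun2 p" shows "p \<in> Rk1 k"
proof (rule Rk1I[OF _ assms])
  show "Ck k p" using CkOn_polyfun2[OF assms, of k UNIV] by (simp add: CkOn_UNIV)
  show "definite_poly (\<lambda>z. 1)" unfolding definite_poly_def using definite_order_0[where p = "\<lambda>z. 1"] by auto
qed simp

text \<open>The witness is \<open>g\<^sup>N / f\<close>, which is 0 on the zero set of \<open>f\<close> by the convention \<open>x / 0 = 0\<close>.\<close>
lemma power_quotient_in_Rk1:
  assumes f: "Ck k f" and g: "Ck k g" and d: "polyfun2 d" and P: "polyfun2 P"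
    and Q: "definite_poly Q" and V: "definite_poly V" and W: "definite_poly W"
    and gQ: "\<And>z. g z * Q z = d z * P z" and fV: "\<And>z. f z * V z ^ 2 = d z ^ 2 * W z"
    and zero: "\<And>z. f z = 0 \<Longrightarrow> g z = 0"
  shows "\<exists>(N::nat) h. h \<in> Rk1 k \<and> (\<lambda>z. g z ^ N) = (\<lambda>z. f z * h z)"
proof -
  define T where "T = {z. Q z = 0} \<union> {z. W z = 0}"
  have T: "finite T" unfolding T_def using definite_poly_finite_zeros Q W by simp
  obtain q where q: "\<And>z. definite_order (q z) z Q" "\<And>z. z \<notin> T \<Longrightarrow> q z = 0"
    by (rule definite_poly_orders[OF Q, of T]) (auto simp: T_def intro: that)
  obtain r where r: "\<And>z. definite_order (r z) z W" "\<And>z. z \<notin> T \<Longrightarrow> r z = 0"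
    by (rule definite_poly_orders[OF W, of T]) (auto simp: T_def intro: that)
  \<comment> \<open>At a zero of \<open>f\<close> the numerator \<open>Ph\<close> has order at least
    \<open>(q + 1) n\<close> and the denominator \<open>Qh\<close> has order
    \<open>q n + 2 q + r\<close>. The surplus \<open>n - 2 q - r\<close> has to be at least
    \<open>k + 1\<close>.\<close>
  define n where "n = (\<Sum>z\<in>T. 2 * q z + r z) + (k + 1)"
  have n: "2 * q z + r z + (k + 1) \<le> n" for z
  proof (cases "z \<in> T")
    case True
    then have "2 * q z + r z \<le> (\<Sum>z\<in>T. 2 * q z + r z)" using T by (intro member_le_sum) auto
    then show ?thesis by (simp add: n_def)
  qed (use q(2) r(2) in \<open>simp add: n_def\<close>)
  have "n > 0" by (simp add: n_def)
  \<comment> \<open>Two of the \<open>N\<close> factors \<open>d P\<close> supply the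
    \<open>d^2\<close> that cancels against \<open>f\<close>; the other \<open>n\<close> provide the
    order of vanishing.\<close>
  define N where "N = n + 2"
  define h where "h = (\<lambda>z. g z ^ N / f z)"
  have fh: "f z * h z = g z ^ N" for z
    using zero[of z] by (cases "f z = 0") (auto simp: h_def N_def)
  define Ph where "Ph = (\<lambda>z. (d z * P z) ^ n * (P z ^ 2 * V z ^ 2))"
  define Qh where "Qh = (\<lambda>z. Q z ^ N * W z)"
  have Pp: "polyfun2 Ph"
    unfolding Ph_def using d P definite_polyD[OF V] by (intro polyfun2_mult polyfun2_power)
  have Qd: "definite_poly Qh" unfolding Qh_def by (intro definite_poly_mult definite_poly_power Q W)
  \<comment> \<open>Where \<open>V\<close> vanishes, the relation between \<open>f\<close> and
    \<open>W\<close> says nothing about \<open>f\<close>. These finitely many points are recovered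
    by continuity once \<open>h\<close> is known to be of class C^k.\<close>
  have hQ: "h z * Qh z = Ph z" if V0: "V z \<noteq> 0" for z
  proof (cases "d z = 0")
    case True
    then have "f z = 0" using fV[of z] V0 by simp
    then have "h z = 0" by (simp add: h_def)
    then show ?thesis using True \<open>n > 0\<close> by (simp add: Ph_def)
  next
    case False
    have "(h z * Qh z) * d z ^ 2 = h z * Q z ^ N * (d z ^ 2 * W z)" by (simp add: Qh_def)
    also have "\<dots> = (f z * h z) * Q z ^ N * V z ^ 2" by (simp add: fV[symmetric])
    also have "\<dots> = (g z * Q z) ^ N * V z ^ 2" by (simp add: fh power_mult_distrib)
    also have "\<dots> = Ph z * d z ^ 2" unfolding gQ
      by (simp add: Ph_def N_def power_add power_mult_distrib power2_eq_square mult_ac)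
    finally show ?thesis using False by simp
  qed
  have "\<exists>U. open U \<and> z \<in> U \<and> CkOn k U h" for z
  proof (cases "f z = 0")
    case False
    define U where "U = {w. f w \<noteq> 0}"
    have "open U" unfolding U_def by (intro open_Collect_neq Ck_imp_continuous[OF f] continuous_on_const)
    moreover have "CkOn k U (\<lambda>w. g w ^ N * (1 / f w))"
    proof (intro CkOn_mult CkOn_power CkOn_inverse)
      show "CkOn k U g" "CkOn k U f" using CkOn_subset[of k UNIV _ U] f g by (auto simp: CkOn_UNIV)
    qed (simp add: U_def)
    then have "CkOn k U h" by (simp add: h_def)
    ultimately show ?thesis using False U_def by blast
  next
    case True
    define m where "m = q z * N + r z"
    have Qm: "definite_order m z Qh"
      unfolding m_def Qh_def by (intro definite_order_mult definite_order_power q r)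
    \<comment> \<open>Only continuity of \<open>g\<close> and its zero at \<open>z\<close> enter
      here; that \<open>d P\<close> is a polynomial then yields the additional order.\<close>
    have "vord_gt (q z) z (\<lambda>w. g w * Q w)"
      by (rule vord_gt_mult[OF Ck_imp_isCont[OF g] zero[OF True] definite_order_imp_vord_ge[OF q(1)]])
    then have "vord_gt (q z) z (\<lambda>w. d w * P w)" by (simp add: gQ)
    then have "vord_ge (Suc (q z)) z (\<lambda>w. d w * P w)"
      by (rule vord_gt_imp_ge_Suc[OF polyfun2_mult[OF d P]])
    then have "vord_ge (Suc (q z) * n) z (\<lambda>w. (d w * P w) ^ n)" by (rule vord_ge_power)
    then have "vord_ge (Suc (q z) * n) z Ph" unfolding Ph_def
      by (rule vord_ge_mult_isCont) (intro isCont_polyfun2 polyfun2_mult polyfun2_power P definite_polyD V)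
    moreover have "m + (k + 1) \<le> Suc (q z) * n" using n[of z] by (simp add: m_def N_def algebra_simps)
    ultimately have Pm: "vord_ge (m + (k + 1)) z Ph" by (rule vord_ge_mono)
    obtain l where "definite_order l z V" using V unfolding definite_poly_def by blast
    then have "\<forall>\<^sub>F w in at z. Qh w \<noteq> 0 \<and> V w \<noteq> 0"
      using definite_order_nonzero_near Qm by (intro eventually_conj) blast+
    then obtain U where U: "open U" "z \<in> U" "\<And>w. w \<in> U \<Longrightarrow> w \<noteq> z \<Longrightarrow> Qh w \<noteq> 0 \<and> V w \<noteq> 0"
      unfolding eventually_at_topological by blast
    have "CkOn k U (\<lambda>w. Ph w / Qh w)"
      by (rule CkOn_quotient[OF U(1) Pp definite_polyD[OF Qd] _ Qm Pm]) (use U(3) in blast)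
    moreover have "Ph w / Qh w = h w" if "w \<in> U" for w
    proof (cases "w = z")
      case True
      have "Ph z = 0" by (rule vord_ge_1_imp_zero[OF Pm]) simp
      then show ?thesis using True \<open>f z = 0\<close> by (simp add: h_def)
    next
      case False
      then show ?thesis using U(3)[OF that] hQ[of w] by (metis nonzero_mult_div_cancel_right)
    qed
    ultimately have "CkOn k U h" by (rule CkOn_cong[OF _ U(1)])
    then show ?thesis using U(1,2) by blast
  qed
  then have Ck: "Ck k h" by (rule Ck_local)
  have "h z * Qh z = Ph z" for z
  proof (rule eq_by_cofinite[of "{z. V z = 0}"])
    show "finite {z. V z = 0}" by (rule definite_poly_finite_zeros[OF V])
    show "continuous_on UNIV (\<lambda>z. h z * Qh z)" "continuous_on UNIV Ph"
      by (intro continuous_on_mult Ck_imp_continuous[OF Ck] continuous_on_polyfun2 Pp definite_polyD[OF Qd])+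
  qed (use hQ in simp)
  then have "h \<in> Rk1 k" by (rule Rk1I[OF Ck Pp Qd])
  then show ?thesis using fh by (intro exI[of _ N] exI[of _ h]) auto
qed

section \<open>Ideals of functions and the construction of \<open>f\<close>\<close>

lemma is_ideal_inD:
  assumes "is_ideal_in R I"
  shows "a \<in> I \<Longrightarrow> a \<in> R" "a \<in> I \<Longrightarrow> b \<in> I \<Longrightarrow> (\<lambda>z. a z + b z) \<in> I"
    "r \<in> R \<Longrightarrow> a \<in> I \<Longrightarrow> (\<lambda>z. r z * a z) \<in> I"
  using assms unfolding is_ideal_in_def by auto

lemma radical_eqI:
  assumes I: "is_ideal_in R I" and f: "f \<in> I"
    and pow: "\<And>g. g \<in> I \<Longrightarrow> \<exists>(N::nat) h. h \<in> R \<and> (\<lambda>z. g z ^ N) = (\<lambda>z. f z * h z)"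
  shows "radical_in R I = radical_in R (principal_ideal R f)"
proof (rule set_eqI, rule iffI)
  fix g assume "g \<in> radical_in R I"
  then obtain M where g: "g \<in> R" "(\<lambda>z. g z ^ M) \<in> I" unfolding radical_in_def by blast
  obtain N h where "h \<in> R" "(\<lambda>z. (g z ^ M) ^ N) = (\<lambda>z. f z * h z)" using pow[OF g(2)] by blast
  then have "(\<lambda>z. g z ^ (M * N)) \<in> principal_ideal R f" unfolding principal_ideal_def by (auto simp: power_mult)
  then show "g \<in> radical_in R (principal_ideal R f)" using g(1) unfolding radical_in_def by blast
next
  fix g assume "g \<in> radical_in R (principal_ideal R f)"
  then obtain N h where g: "g \<in> R" "h \<in> R" "(\<lambda>z. g z ^ N) = (\<lambda>z. f z * h z)"
    unfolding radical_in_def principal_ideal_def by blast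
  have "(\<lambda>z. h z * f z) \<in> I" by (rule is_ideal_inD(3)[OF I g(2) f])
  then have "(\<lambda>z. g z ^ N) \<in> I" by (simp add: g(3) mult.commute)
  then show "g \<in> radical_in R I" using g(1) unfolding radical_in_def by blast
qed

text \<open>Squares are added one by one, so positivity already achieved at earlier points cannot be
  cancelled.\<close>

lemma ideal_positive_on_finite:
  assumes I: "is_ideal_in R I" and "finite B" "\<And>b. b \<in> B \<Longrightarrow> \<exists>g\<in>I. g b \<noteq> 0"
  shows "\<exists>G\<in>I. (\<forall>z. G z \<ge> 0) \<and> (\<forall>b\<in>B. G b > 0)"
  using assms(2,3)
proof (induction B)
  case empty
  show ?case using I unfolding is_ideal_in_def by (intro bexI[of _ "\<lambda>_. 0"]) auto
next
  case (insert b B)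
  then obtain G where G: "G \<in> I" "\<forall>z. G z \<ge> 0" "\<forall>b\<in>B. G b > 0" by blast
  obtain g where g: "g \<in> I" "g b \<noteq> 0" using insert.prems by blast
  have "(\<lambda>z. g z * g z) \<in> I" by (rule is_ideal_inD(3)[OF I is_ideal_inD(1)[OF I g(1)] g(1)])
  then have mem: "(\<lambda>z. G z + g z * g z) \<in> I" by (rule is_ideal_inD(2)[OF I G(1)])
  show ?case
  proof (intro bexI[OF _ mem] conjI allI ballI)
    show "G z + g z * g z \<ge> 0" for z using G(2)[rule_format, of z] by simp
    fix c assume "c \<in> insert b B"
    then consider "c = b" | "c \<in> B" by blast
    then show "G c + g c * g c > 0"
    proof cases
      case 1
      then have "g c * g c > 0" using g(2) by (simp add: zero_less_mult_iff) linarith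
      then show ?thesis using G(2)[rule_format, of c] by linarith
    next
      case 2
      then have "G c > 0" using G(3) by blast
      then show ?thesis using zero_le_square[of "g c"] by linarith
    qed
  qed
qed

text \<open>A continuous factor that is nonzero at \<open>z\<close> does not affect definiteness, so
  \<open>d P\<close> is definite there and with it the factor \<open>d\<close>.\<close>

lemma definite_order_factor_of_eq:
  assumes g: "isCont g z" "g z \<noteq> 0" and Q: "definite_order m z Q" and d: "polyfun2 d" and P: "polyfun2 P"
    and eq: "\<And>w. g w * Q w = d w * P w"
  obtains i where "definite_order i z d"
proof -
  have "definite_order (0 + m) z (\<lambda>w. g w * Q w)" by (rule definite_order_mult[OF definite_order_0[OF g] Q])
  then have "definite_order (0 + m) z (\<lambda>w. d w * P w)" by (simp add: eq)
  then show ?thesis by (rule definite_order_factor[OF d P]) (rule that)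
qed

theorem theorem5p16:
  fixes k :: nat and I :: "(pt \<Rightarrow> real) set"
  assumes "is_ideal_in (Rk1 k) I"
  shows "\<exists>f\<in>I. (\<forall>g\<in>I. \<exists>(N::nat) h. h \<in> Rk1 k \<and> (\<lambda>z. g z ^ N) = (\<lambda>z. f z * h z))
              \<and> radical_in (Rk1 k) I = radical_in (Rk1 k) (principal_ideal (Rk1 k) f)"
proof -
  note sub = is_ideal_inD(1)[OF assms] and add = is_ideal_inD(2)[OF assms] and mult = is_ideal_inD(3)[OF assms]
  have CkI: "Ck k g" if "g \<in> I" for g using sub[OF that] by (rule Rk1_imp_Ck)
  have "\<exists>f\<in>I. \<forall>g\<in>I. \<exists>(N::nat) h. h \<in> Rk1 k \<and> (\<lambda>z. g z ^ N) = (\<lambda>z. f z * h z)"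
  proof (cases "\<exists>g\<in>I. g \<noteq> (\<lambda>z. 0)")
    case False
    have zero: "(\<lambda>_. 0) \<in> I" using assms unfolding is_ideal_in_def by blast
    have "\<exists>(N::nat) h. h \<in> Rk1 k \<and> (\<lambda>z. g z ^ N) = (\<lambda>z. 0 * h z)" if "g \<in> I" for g
    proof -
      have "g = (\<lambda>z. 0)" using False that by blast
      then show ?thesis by (intro exI[of _ 1] exI[of _ "\<lambda>z. 0"]) (simp add: polyfun2_in_Rk1)
    qed
    then show ?thesis by (intro bexI[OF _ zero]) blast
  next
    case True
    then obtain g0 where g0: "g0 \<in> I" "g0 \<noteq> (\<lambda>z. 0)" by blast
    define J where "J = {p \<in> I. polyfun2 p}"
    have J: "poly_ideal J" unfolding poly_ideal_def
    proof (intro conjI ballI allI impI)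
      fix a b assume "a \<in> J" "b \<in> J"
      then show "(\<lambda>z. a z + b z) \<in> J" using add by (auto simp: J_def)
    next
      fix r a assume "polyfun2 r" "a \<in> J"
      then show "(\<lambda>z. r z * a z) \<in> J" using mult polyfun2_in_Rk1 by (auto simp: J_def)
    qed (auto simp: J_def)
    \<comment> \<open>Denominators are polynomials, hence in the ring; so numerators of members of
      \<open>I\<close> are again in \<open>I\<close>.\<close>
    have numerator: "\<exists>P Q. P \<in> J \<and> definite_poly Q \<and> (\<forall>z. g z * Q z = P z)" if gI: "g \<in> I" for g
    proof -
      obtain P Q where PQ: "polyfun2 P" "definite_poly Q" "\<And>z. g z * Q z = P z"
        by (rule Rk1_imp_definite_fraction[OF sub[OF gI]]) (rule that)
      have "(\<lambda>z. Q z * g z) \<in> I" by (rule mult[OF polyfun2_in_Rk1[OF definite_polyD[OF PQ(2)]] gI])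
      then have "P \<in> J" using PQ by (simp add: J_def mult.commute)
      then show ?thesis using PQ by blast
    qed
    obtain P0 Q0 where P0: "P0 \<in> J" "definite_poly Q0" "\<forall>z. g0 z * Q0 z = P0 z" using numerator[OF g0(1)] by blast
    have P0nz: "P0 \<noteq> (\<lambda>z. 0)"
    proof
      assume 0: "P0 = (\<lambda>z. 0)"
      have "g0 z = 0" for z
      proof (rule eq_by_cofinite[OF definite_poly_finite_zeros[OF P0(2)]])
        show "continuous_on UNIV g0" by (rule Ck_imp_continuous[OF CkI[OF g0(1)]])
        show "g0 z = 0" if "z \<notin> {z. Q0 z = 0}" for z using that P0(3)[rule_format, of z] 0 by simp
      qed simp
      then show False using g0(2) by auto
    qed
    obtain d D where d: "polyfun2 d" "\<And>p. p \<in> J \<Longrightarrow> pdvd d p" and D: "definite_poly D" "(\<lambda>z. d z * D z) \<in> J"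
      by (rule ideal_definite_multiple[OF J P0(1) P0nz]) (rule that)
    have "d \<noteq> (\<lambda>z. 0)" using d(2)[OF P0(1)] P0nz by (auto simp: pdvd_def)
    have frac: "\<exists>P Q. polyfun2 P \<and> definite_poly Q \<and> (\<forall>z. g z * Q z = d z * P z)" if gI: "g \<in> I" for g
    proof -
      obtain P Q where PQ: "P \<in> J" "definite_poly Q" "\<forall>z. g z * Q z = P z" using numerator[OF gI] by blast
      obtain P' where "polyfun2 P'" "P = (\<lambda>z. d z * P' z)" using d(2)[OF PQ(1)] unfolding pdvd_def by blast
      then show ?thesis using PQ by blast
    qed
    define Z where "Z = {z. \<forall>g\<in>I. g z = 0}"
    \<comment> \<open>The zeros of \<open>d D\<close> off the zero set of \<open>I\<close>, where
      the second summand of \<open>f\<close> has to be positive.\<close>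
    define B where "B = ({z. d z = 0} \<union> {z. D z = 0}) - Z"
    have "finite B"
    proof -
      have "{z. d z = 0} - Z \<subseteq> {z. d z = 0 \<and> (\<exists>m. definite_order m z d)}"
      proof
        fix z assume z: "z \<in> {z. d z = 0} - Z"
        then obtain g where g: "g \<in> I" "g z \<noteq> 0" by (auto simp: Z_def)
        obtain P Q where PQ: "polyfun2 P" "definite_poly Q" "\<forall>z. g z * Q z = d z * P z" using frac[OF g(1)] by blast
        obtain m where "definite_order m z Q" using PQ(2) unfolding definite_poly_def by blast
        then obtain i where "definite_order i z d"
          by (rule definite_order_factor_of_eq[OF Ck_imp_isCont[OF CkI[OF g(1)]] g(2) _ d(1) PQ(1)]) (use PQ(3) in \<open>auto intro: that\<close>)
        then show "z \<in> {z. d z = 0 \<and> (\<exists>m. definite_order m z d)}" using z by blast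
      qed
      then have "finite ({z. d z = 0} - Z)"
        using finite_definite_zeros[OF d(1) \<open>d \<noteq> _\<close>] finite_subset by blast
      moreover have "finite {z. D z = 0}" by (rule definite_poly_finite_zeros[OF D(1)])
      ultimately have "finite (({z. d z = 0} - Z) \<union> {z. D z = 0})" by simp
      then show ?thesis by (rule finite_subset[rotated]) (auto simp: B_def)
    qed
    moreover have "\<exists>g\<in>I. g b \<noteq> 0" if "b \<in> B" for b using that by (auto simp: B_def Z_def)
    ultimately obtain G where G: "G \<in> I" "\<forall>b\<in>B. G b > 0" using ideal_positive_on_finite[OF assms] by blast
    obtain P V where V: "polyfun2 P" "definite_poly V" "\<forall>z. G z * V z = d z * P z" using frac[OF G(1)] by blast
    define S where "S = ({z. D z = 0} \<union> {z. V z = 0}) \<inter> Z"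
    have S: "finite S" unfolding S_def using definite_poly_finite_zeros D(1) V(2) by simp
    have DV: "definite_poly (\<lambda>z. (D z * V z) ^ 2)" by (intro definite_poly_power definite_poly_mult D V)
    obtain M where M: "\<And>z. definite_order (M z) z (\<lambda>z. (D z * V z) ^ 2)"
      by (rule definite_poly_orders[OF DV subset_UNIV]) (rule that)
    \<comment> \<open>Larger than the order of \<open>(D V)^2\<close> at every point of
      \<open>S\<close>, so that a single factor \<open>E\<close> already makes
      \<open>(E P)^2\<close> of higher order there.\<close>
    define L where "L = Suc (\<Sum>b\<in>S. M b)"
    define E where "E = (\<lambda>z. dist_poly S z ^ L)"
    \<comment> \<open>A sum of squares, so it vanishes only where both terms do. As \<open>S\<close>
      lies in the zero set \<open>Z\<close> of the ideal, \<open>E\<close> has no zero off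
      \<open>Z\<close> and cannot destroy the contribution of \<open>G\<close> on
      \<open>B\<close>.\<close>
    define f where "f = (\<lambda>z. (d z * D z) * (d z * D z) + E z ^ 2 * (G z * G z))"
    define W where "W = (\<lambda>z. (D z * V z) ^ 2 + (E z * P z) ^ 2)"
    have E: "polyfun2 E" unfolding E_def by (intro polyfun2_power polyfun2_dist_poly)
    have W: "polyfun2 W" unfolding W_def
      by (intro polyfun2_add polyfun2_power polyfun2_mult E V(1) definite_polyD D(1) V(2))
    have dD: "(\<lambda>z. d z * D z) \<in> I" using D(2) by (simp add: J_def)
    have fI: "f \<in> I" unfolding f_def
      by (intro add mult[OF sub[OF dD] dD] mult[OF polyfun2_in_Rk1[OF polyfun2_power[OF E]] mult[OF sub[OF G(1)] G(1)]])
    have fV: "f z * V z ^ 2 = d z ^ 2 * W z" for z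
    proof -
      have "f z * V z ^ 2 = (d z * D z * V z) ^ 2 + (E z * (G z * V z)) ^ 2"
        by (simp add: f_def power2_eq_square algebra_simps)
      also have "\<dots> = d z ^ 2 * W z" 
        unfolding V(3)[rule_format] by (simp add: W_def power2_eq_square algebra_simps)
      finally show ?thesis .
    qed
    have fnz: "f z \<noteq> 0" if "z \<notin> Z" for z
    proof (cases "d z * D z = 0")
      case True
      then have "z \<in> B" using that by (auto simp: B_def)
      then have "G z > 0" using G(2) by blast
      moreover have "E z \<noteq> 0" using that dist_poly_eq_0_iff[OF S] by (auto simp: E_def S_def)
      ultimately show ?thesis using True by (auto simp: f_def)
    next
      case False
      have "(d z * D z) * (d z * D z) > 0" using False by (metis not_real_square_gt_zero)
      then show ?thesis unfolding f_def by (smt (verit) zero_le_power2 zero_le_mult_iff zero_le_square)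
    qed
    have "\<exists>m. definite_order m z W" for z
    proof (cases "z \<in> Z")
      \<comment> \<open>Off \<open>Z\<close> both \<open>f\<close> and the definite bound for
        \<open>V^2\<close> are available, and \<open>f V^2 = d^2 W\<close> exhibits \<open>W\<close>
        as a factor of a definite polynomial.\<close>
      case False
      obtain m where "definite_order m z V" using V(2) unfolding definite_poly_def by blast
      from definite_order_power[OF this] have m: "definite_order (m * 2) z (\<lambda>w. V w ^ 2)" .
      obtain i where "definite_order i z W"
        by (rule definite_order_factor_of_eq[OF Ck_imp_isCont[OF CkI[OF fI]] fnz[OF False] m W polyfun2_power[OF d(1), of 2]])
          (auto simp: fV mult.commute intro: that)
      then show ?thesis by blast
    next
      case z: True
      show ?thesis
      proof (cases "z \<in> S")
        case True
        have "vord_ge (1 * L) z E" unfolding E_def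
          by (rule vord_ge_power[OF vord_ge_dist_poly[OF S True]])
        then have "vord_ge (1 * L) z (\<lambda>w. E w * (E w * P w ^ 2))"
          by (rule vord_ge_mult_isCont) (intro isCont_polyfun2 polyfun2_mult polyfun2_power E V(1))
        moreover have "Suc (M z) \<le> 1 * L" unfolding L_def using S True by (simp add: member_le_sum)
        ultimately have "vord_ge (Suc (M z)) z (\<lambda>w. E w * (E w * P w ^ 2))" by (rule vord_ge_mono)
        then have "vord_ge (Suc (M z)) z (\<lambda>w. (E w * P w) ^ 2)"
          by (simp add: power2_eq_square mult_ac)
        from definite_order_add[OF M this] show ?thesis unfolding W_def by blast
      next
        case False
        then have "D z * V z \<noteq> 0" using z by (auto simp: S_def)
        then have "W z \<noteq> 0" by (simp add: W_def sum_power2_eq_zero_iff)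
        then show ?thesis using definite_order_0[OF isCont_polyfun2[OF W]] by blast
      qed
    qed
    then have Wd: "definite_poly W" using W by (simp add: definite_poly_def)
    have "\<exists>(N::nat) h. h \<in> Rk1 k \<and> (\<lambda>z. g z ^ N) = (\<lambda>z. f z * h z)" if gI: "g \<in> I" for g
    proof -
      obtain P' Q where Q: "polyfun2 P'" "definite_poly Q" "\<forall>z. g z * Q z = d z * P' z" using frac[OF gI] by blast
      have "g z = 0" if "f z = 0" for z using fnz[of z] that gI by (auto simp: Z_def)
      then show ?thesis
        using Q(3) by (intro power_quotient_in_Rk1[OF CkI[OF fI] CkI[OF gI] d(1) Q(1,2) V(2) Wd _ fV]) auto
    qed
    then show ?thesis using fI by blast
  qed
  then obtain f where f: "f \<in> I" "\<And>g. g \<in> I \<Longrightarrow> \<exists>(N::nat) h. h \<in> Rk1 k \<and> (\<lambda>z. g z ^ N) = (\<lambda>z. f z * h z)" by blast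
  from radical_eqI[OF assms f] f show ?thesis by blast
qed

end
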